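(* Let $V$ be one of the spaces $(\mathbb{R}^n,\|\cdot\|_p)$, $(\mathbb{S}^n,\|\cdot\|_p)$, or $(\mathbb{R}^{n\times N},\|\cdot\|_p)$ with $n\le N$, where $p\in(1,2]$. Suppose the convex function $f:V\to\mathbb{R}$ is $L$-Lipschitz and $\mu$-sharp with respect to $\|\cdot\|_p$, write $f^*=\min_V f$, and suppose $x_0\in V$ satisfies $f(x_0)-f^*\le\epsilon_0$. Let $0<\epsilon\le\epsilon_0$ and set $$\epsilon_k=\epsilon_0e^{-k/2},\quad K=\left\lceil 2\ln\left(\tfrac{\epsilon_0}{\epsilon}\right)\right\rceil,\quad t=\left\lceil\frac{eL^2}{\mu^2(p-1)}\right\rceil,\quad \eta_k=\frac{(p-1)\epsilon_k}{L^2}.$$ Then each iterate $x_k$ in $\mathtt{RMD}(f,L,x_0,K,\{\eta_k\},t,p)$ satisfies $f(x_k)-f^*\le\epsilon_k$. In particular, an $\epsilon$-optimizer (a point $x$ with $f(x)-f^*\le\epsilon$) can be computed in $$O\left(\frac{L^2}{\mu^2(p-1)}\log\left(\frac{\epsilon_0}{\epsilon}\right)\right)$$ total mirror descent steps. If, instead, the convex function $f:V\to\mathbb{R}$ is $L$-Lipschitz and $\mu$-sharp with respect to $\|\cdot\|_1$ (and $n\ge3$), then, for $p=1+\frac1{\ln n}$, $f$ is $\mu$-sharp and $eL$-Lipschitz with respect to $\|\cdot\|_p$. Consequently, in this case, if $f^*=\min_V f$, $x_0\in V$ satisfies $f(x_0)-f^*\le\epsilon_0$, $0<\epsilon\le\epsilon_0$,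 and one sets $$\epsilon_k=\epsilon_0e^{-k/2},\quad K=\left\lceil 2\ln\left(\tfrac{\epsilon_0}{\epsilon}\right)\right\rceil,\quad t=\left\lceil\frac{e(eL)^2}{\mu^2(p-1)}\right\rceil=\left\lceil\frac{e^3L^2\ln n}{\mu^2}\right\rceil,\quad \eta_k=\frac{(p-1)\epsilon_k}{(eL)^2}=\frac{\epsilon_k}{e^2L^2\ln n},$$ then each iterate $x_k$ in $\mathtt{RMD}(f,eL,x_0,K,\{\eta_k\},t,p)$ with $p=1+\frac1{\ln n}$ satisfies $f(x_k)-f^*\le\epsilon_k$, and in particular an $\epsilon$-optimizer can be computed in $$O\left(\frac{(eL)^2}{\mu^2(p-1)}\log\left(\frac{\epsilon_0}{\epsilon}\right)\right)=O\left(\frac{L^2\ln n}{\mu^2}\log\left(\frac{\epsilon_0}{\epsilon}\right)\right)$$ total mirror descent steps.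
   Context: For vectors $\|\cdot\|_p$ is the $\ell_p$ norm; for matrices it is the Schatten-$p$ norm. $\mathbb{S}^n$ is the space of real symmetric $n\times n$ matrices. Sharpness: a convex $f:V\to\mathbb{R}$ is $\mu$-sharp ($\mu>0$) with respect to a norm $\|\cdot\|$ if the set $\mathcal{X}=\arg\min f$ is nonempty and $f(\bar x)-\min_V f\ge\mu\min_{x\in\mathcal{X}}\|\bar x-x\|$ for all $\bar x\in V$. $L$-Lipschitz: $|f(x)-f(y)|\le L\|x-y\|$ for all $x,y\in V$. Mirror descent $\mathtt{mirror}(h,f,L,\bar x,T,\eta)$: given a differentiable $h:V\to\mathbb{R}$, start with $y_0=\bar x$ and $\theta_0=0$; for $s=1,\dots,T$ choose any subgradient $g_s\in\partial f(y_{s-1})$, set $\theta_s=\theta_{s-1}-\eta g_s$ and $y_s=(\nabla h)^{-1}(\theta_s)$; output the $y_s$ minimizing $f(y_s)$ among $s\in\{0,\dots,T\}$. Each $s$ is one mirror descent step. Restarted mirror descent $\mathtt{RMD}(f,L,x_0,K,\{\eta_k\},t,p)$: for $k=1,\dots,K$, set $x_k\leftarrow\mathtt{mirror}(h_{x_{k-1}},f,L,x_{k-1},t,\eta_k)$, where $h_{x_{k-1}}(x):=\frac12\|x-x_{k-1}\|_p^2$; output $x_K$. (For $p\in(1,2]$, $h_{\bar x}$ is differentiable with invertible gradient map.)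
   Formalization: The O-bounds on total steps are proved with a constant uniform over ε0/ε ≥ c, for each c>1; as ε→ε0 the logarithm tends to 0 though at least one step may be needed. They assume μ ≤ L (μ ≤ eL in the ℓ1 case), which holds unless f is constant, when no steps are needed. *)

theory Defs
  imports "HOL-Analysis.Analysis" "HOL-Library.Landau_Symbols"
begin

definition lp_norm :: "real \<Rightarrow> real ^ 'n \<Rightarrow> real" where
  "lp_norm p x = (\<Sum>i\<in>UNIV. \<bar>x $ i\<bar> powr p) powr (1 / p)"

text \<open>The type \<open>real ^ 'N ^ 'n\<close> consists of matrices with \<open>n\<close> rows and \<open>N\<close> columns. The singular
  values of \<open>A\<close> are the square roots of the eigenvalues of \<open>A A\<^sup>T\<close>, counted with multiplicity. As
  \<open>A A\<^sup>T\<close> is symmetric, the multiplicity is the dimension of the eigenspace.\<close>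

definition sv_eigenspace :: "real ^ 'N ^ 'n \<Rightarrow> real \<Rightarrow> (real ^ 'n) set" where
  "sv_eigenspace A s = {v. (A ** transpose A) *v v = s\<^sup>2 *\<^sub>R v}"

definition singular_values :: "real ^ 'N ^ 'n \<Rightarrow> real set" where
  "singular_values A = {s. 0 \<le> s \<and> (\<exists>v\<in>sv_eigenspace A s. v \<noteq> 0)}"

definition schatten_norm :: "real \<Rightarrow> real ^ 'N ^ 'n \<Rightarrow> real" where
  "schatten_norm p A =
     (\<Sum>s\<in>singular_values A. real (dim (sv_eigenspace A s)) * s powr p) powr (1 / p)"

definition sym_matrices :: "(real ^ 'n ^ 'n) set" where
  "sym_matrices = {A. transpose A = A}"

text \<open>In what follows, a space is a linear subspace \<open>V\<close> of a Euclidean space together with a norm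
  function \<open>nrm\<close> (unrelated to the ambient norm). Functions matter only through their values on \<open>V\<close>.
  The dual of \<open>V\<close> is identified with \<open>V\<close> by the ambient inner product, which on matrices is the
  trace inner product.\<close>

definition min_on :: "'a set \<Rightarrow> ('a \<Rightarrow> real) \<Rightarrow> real" where
  "min_on V f = (INF x\<in>V. f x)"

definition argmin_on :: "'a set \<Rightarrow> ('a \<Rightarrow> real) \<Rightarrow> 'a set" where
  "argmin_on V f = {x. is_arg_min f (\<lambda>y. y \<in> V) x}"

definition lipschitz_wrt ::
  "'a::euclidean_space set \<Rightarrow> ('a \<Rightarrow> real) \<Rightarrow> real \<Rightarrow> ('a \<Rightarrow> real) \<Rightarrow> bool" where
  "lipschitz_wrt V nrm L f \<longleftrightarrow> (\<forall>x\<in>V. \<forall>y\<in>V. \<bar>f x - f y\<bar> \<le> L * nrm (x - y))"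

text \<open>The distance to the closed nonempty set of minimizers is attained, so the infimum below is a
  minimum.\<close>

definition sharp_wrt ::
  "'a::euclidean_space set \<Rightarrow> ('a \<Rightarrow> real) \<Rightarrow> real \<Rightarrow> ('a \<Rightarrow> real) \<Rightarrow> bool" where
  "sharp_wrt V nrm \<mu> f \<longleftrightarrow> \<mu> > 0 \<and> argmin_on V f \<noteq> {} \<and>
     (\<forall>z\<in>V. f z - min_on V f \<ge> \<mu> * (INF x\<in>argmin_on V f. nrm (z - x)))"

definition eps_optimizer :: "'a set \<Rightarrow> ('a \<Rightarrow> real) \<Rightarrow> real \<Rightarrow> 'a \<Rightarrow> bool" where
  "eps_optimizer V f \<epsilon> x \<longleftrightarrow> x \<in> V \<and> f x - min_on V f \<le> \<epsilon>"

definition subdifferential :: "'a::euclidean_space set \<Rightarrow> ('a \<Rightarrow> real) \<Rightarrow> 'a \<Rightarrow> 'a set" where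
  "subdifferential V f x = {g\<in>V. \<forall>y\<in>V. f y \<ge> f x + g \<bullet> (y - x)}"

definition grad_on :: "'a::euclidean_space set \<Rightarrow> ('a \<Rightarrow> real) \<Rightarrow> 'a \<Rightarrow> 'a" where
  "grad_on V h x = (THE g. g \<in> V \<and> (h has_derivative (\<lambda>d. g \<bullet> d)) (at x within V))"

text \<open>\<open>mirror V h f z T \<eta> x\<close> says that \<open>x\<close> is a possible output of \<open>T\<close> mirror descent steps started
  at \<open>z\<close>. It is a relation because the subgradients and the choice among equally good iterates are
  free. The Lipschitz constant, formally also an input, is not used by the procedure.\<close>

definition mirror ::
  "'a::euclidean_space set \<Rightarrow> ('a \<Rightarrow> real) \<Rightarrow> ('a \<Rightarrow> real) \<Rightarrow> 'a \<Rightarrow> nat \<Rightarrow> real \<Rightarrow> 'a \<Rightarrow> bool" where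
  "mirror V h f z T \<eta> x \<longleftrightarrow>
     (\<exists>y \<theta> g :: nat \<Rightarrow> 'a.
        y 0 = z \<and> \<theta> 0 = 0 \<and>
        (\<forall>s\<in>{1..T}. g s \<in> subdifferential V f (y (s - 1)) \<and>
                     \<theta> s = \<theta> (s - 1) - \<eta> *\<^sub>R g s \<and>
                     y s = inv_into V (grad_on V h) (\<theta> s)) \<and>
        (\<exists>s\<le>T. x = y s \<and> (\<forall>r\<le>T. f (y s) \<le> f (y r))))"

text \<open>\<open>RMD V nrm f x0 K \<eta> t xs\<close>: the sequence \<open>xs 0, \<dots>, xs K\<close> is a possible sequence of iterates of
  restarted mirror descent. It takes \<open>K * t\<close> mirror descent steps in total.\<close>

definition RMD ::
  "'a::euclidean_space set \<Rightarrow> ('a \<Rightarrow> real) \<Rightarrow> ('a \<Rightarrow> real) \<Rightarrow> 'a \<Rightarrow> nat \<Rightarrow> (nat \<Rightarrow> real) \<Rightarrow> nat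
     \<Rightarrow> (nat \<Rightarrow> 'a) \<Rightarrow> bool" where
  "RMD V nrm f x0 K \<eta> t xs \<longleftrightarrow> xs 0 = x0 \<and>
     (\<forall>k\<in>{1..K}. mirror V (\<lambda>x. (nrm (x - xs (k - 1)))\<^sup>2 / 2) f (xs (k - 1)) t (\<eta> k) (xs k))"

definition rmd_eps :: "real \<Rightarrow> nat \<Rightarrow> real" where
  "rmd_eps \<epsilon>0 k = \<epsilon>0 * exp (- real k / 2)"

definition rmd_K :: "real \<Rightarrow> real \<Rightarrow> nat" where
  "rmd_K \<epsilon>0 \<epsilon> = nat \<lceil>2 * ln (\<epsilon>0 / \<epsilon>)\<rceil>"

definition rmd_t :: "real \<Rightarrow> real \<Rightarrow> real \<Rightarrow> nat" where
  "rmd_t L \<mu> p = nat \<lceil>exp 1 * L\<^sup>2 / (\<mu>\<^sup>2 * (p - 1))\<rceil>"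

definition rmd_eta :: "real \<Rightarrow> real \<Rightarrow> real \<Rightarrow> nat \<Rightarrow> real" where
  "rmd_eta L p \<epsilon>0 k = (p - 1) * rmd_eps \<epsilon>0 k / L\<^sup>2"

text \<open>Runs exist; every run, whatever choices it makes, has the stated accuracy at each iterate and
  ends in an \<open>\<epsilon>\<close>-optimizer. The last conjunct places \<open>(L, \<mu>)\<close> in the range on which the asymptotic
  step count is stated: \<open>\<mu> \<le> L\<close> can only fail if \<open>f\<close> is constant, and then the starting point, found
  in zero steps, is optimal.\<close>

definition RMD_guarantee ::
  "'a::euclidean_space set \<Rightarrow> (real \<Rightarrow> 'a \<Rightarrow> real) \<Rightarrow> real \<Rightarrow> ('a \<Rightarrow> real) \<Rightarrow> real \<Rightarrow> real
     \<Rightarrow> 'a \<Rightarrow> real \<Rightarrow> real \<Rightarrow> bool" where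
  "RMD_guarantee V nrm p f L \<mu> x0 \<epsilon>0 \<epsilon> \<longleftrightarrow>
     (\<exists>xs. RMD V (nrm p) f x0 (rmd_K \<epsilon>0 \<epsilon>) (rmd_eta L p \<epsilon>0) (rmd_t L \<mu> p) xs) \<and>
     (\<forall>xs. RMD V (nrm p) f x0 (rmd_K \<epsilon>0 \<epsilon>) (rmd_eta L p \<epsilon>0) (rmd_t L \<mu> p) xs \<longrightarrow>
        (\<forall>k\<le>rmd_K \<epsilon>0 \<epsilon>. f (xs k) - min_on V f \<le> rmd_eps \<epsilon>0 k) \<and>
        eps_optimizer V f \<epsilon> (xs (rmd_K \<epsilon>0 \<epsilon>))) \<and>
     (\<mu> \<le> L \<or> (\<forall>x\<in>V. f x = min_on V f))"

text \<open>Parameter ranges for the asymptotic step counts. The ratio \<open>\<epsilon>0 / \<epsilon>\<close> has to stay away from 1: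
  for \<open>\<epsilon>\<close> slightly below \<open>\<epsilon>0\<close> at least one step is needed while \<open>ln (\<epsilon>0 / \<epsilon>)\<close> tends to 0.\<close>

definition steps_range :: "real \<Rightarrow> (real \<times> real \<times> real \<times> real \<times> real) set" where
  "steps_range c = {(L, \<mu>, p, \<epsilon>0, \<epsilon>).
     0 < \<mu> \<and> \<mu> \<le> L \<and> 1 < p \<and> p \<le> 2 \<and> 0 < \<epsilon> \<and> c \<le> \<epsilon>0 / \<epsilon>}"

definition steps_range1 :: "real \<Rightarrow> (real \<times> real \<times> nat \<times> real \<times> real) set" where
  "steps_range1 c = {(L, \<mu>, n, \<epsilon>0, \<epsilon>).
     0 < \<mu> \<and> \<mu> \<le> exp 1 * L \<and> 3 \<le> n \<and> 0 < \<epsilon> \<and> c \<le> \<epsilon>0 / \<epsilon>}"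

text \<open>The exponent replacing 1 in dimension \<open>n\<close>.\<close>

definition p1 :: "nat \<Rightarrow> real" where
  "p1 n = 1 + 1 / ln (real n)"

end

theory Submission
  imports Defs
begin

text \<open>Sharpness bounds the squared distance from a restart point with gap \<open>\<epsilon>\<close> to the minimizers by
\<open>\<epsilon>\<^sup>2 / \<mu>\<^sup>2\<close>, and the mirror descent bound \<open>D / (\<eta> T) + \<eta> L\<^sup>2 / (2 \<sigma>)\<close>, where \<open>D\<close> is half that squared
distance and \<open>\<sigma>\<close> the modulus of strong convexity of the mirror map, then shrinks the gap by the
factor \<open>exp (- 1 / 2)\<close> in each round. Apart from rounding the constants leave no slack: half the
squared norm has to be strongly convex with the sharp modulus \<open>\<sigma> = p - 1\<close>. For Schatten norms this
is an inequality of Ball, Carlen and Lieb, and most of what follows proves it.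

Let \<open>F\<close> be the trace of \<open>\<bar>X\<bar> powr p\<close> for a self-adjoint operator \<open>X\<close>. Derivatives of eigenvalues are
avoided: if \<open>E\<close> and \<open>E'\<close> are orthonormal eigenbases of \<open>T\<close> and \<open>S\<close>, then the Bregman distance of \<open>F\<close>
from \<open>T\<close> to \<open>S\<close> and the pairing of the gradient difference with \<open>S - T\<close> are sums over pairs \<open>(e, e')\<close>
with the doubly stochastic weights \<open>(e \<bullet> e')\<^sup>2\<close> of the corresponding scalar expressions in the
eigenvalues (\<open>trace_bregman_expansion\<close>, \<open>trace_monotonicity_expansion\<close>). Scalar inequalities thus
give convexity of \<open>F\<close>, an error of order \<open>p > 1\<close> in the first-order expansion, hence
differentiability, and monotonicity of the gradient.

The sharp monotonicity constant is \<open>trace_powr_strongly_monotone\<close>. By the scalar midpoint inequality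
\<open>dpow_strongly_monotone\<close>, the pairing of the gradient difference with \<open>S - T\<close> dominates
\<open>\<Sum> q\<^sup>2 m powr (p - 2)\<close> up to the factor \<open>p (p - 1)\<close>, where the \<open>q\<close> are the entries of \<open>S - T\<close> between the
two eigenbases and \<open>m\<close> is the mean of the two absolute eigenvalues. Passing to the eigenbasis of
\<open>S - T\<close> can only decrease this sum, because \<open>t powr (p - 2)\<close> is operator convex:
\<open>resolvent_compression\<close> shows this for the resolvents \<open>1 / (m + u)\<close>, and integration in \<open>u\<close> yields
the power. In the eigenbasis of \<open>S - T\<close>, the inequalities of Hoelder and Jensen finish the estimate.

Since \<open>2 / p \<ge> 1\<close>, the estimate for \<open>F\<close> gives the right modulus for \<open>F powr (2 / p) / 2\<close> in the limit of
nearby points (\<open>Phi_local_strong_convexity\<close>), and a function on a segment that has local supporting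
lines everywhere lies above its tangents (\<open>local_support_imp_above_tangent\<close>). Vectors enter as
diagonal operators, rectangular matrices through the symmetric dilation, whose nonzero eigenvalues
are plus and minus the nonzero singular values; symmetric matrices form a subspace. For the 1-norm,
the choice \<open>p = 1 + 1 / ln n\<close> makes the \<open>p\<close>-norm equivalent to it up to the factor \<open>exp 1\<close>.\<close>

section \<open>Spectral decomposition of self-adjoint operators\<close>

definition selfadj :: "('a::euclidean_space \<Rightarrow> 'a) \<Rightarrow> bool" where
  "selfadj T \<longleftrightarrow> linear T \<and> (\<forall>x y. T x \<bullet> y = x \<bullet> T y)"

definition eigbasis :: "('a::euclidean_space \<Rightarrow> 'a) \<Rightarrow> 'a set \<Rightarrow> bool" where
  "eigbasis T E \<longleftrightarrow> pairwise orthogonal E \<and> (\<forall>e\<in>E. norm e = 1) \<and> span E = UNIV \<and>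
     (\<forall>e\<in>E. T e = (e \<bullet> T e) *\<^sub>R e)"

text \<open>A maximizer \<open>v\<close> of the Rayleigh quotient on the unit sphere of an invariant subspace is an
eigenvector: moving from \<open>v\<close> in the direction of the residual \<open>u = T v - l v\<close> would increase the
quotient to first order unless \<open>u = 0\<close>.\<close>

lemma selfadj_eigenvector_exists:
  assumes T: "selfadj T" and S: "subspace S" "T ` S \<subseteq> S" "S \<noteq> {0}"
  shows "\<exists>v\<in>S. norm v = 1 \<and> T v = (v \<bullet> T v) *\<^sub>R v"
proof -
  have lin: "linear T" and sa: "T x \<bullet> y = x \<bullet> T y" for x y using T by (auto simp: selfadj_def)
  let ?K = "S \<inter> sphere 0 1"
  obtain x0 where x0: "x0 \<in> S" "x0 \<noteq> 0" using S subspace_0[OF S(1)] by blast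
  have "compact ?K" using S(1) by (simp add: closed_Int_compact closed_subspace)
  moreover have "inverse (norm x0) *\<^sub>R x0 \<in> ?K"
    using x0 S(1) by (auto simp: subspace_scale)
  moreover have "continuous_on ?K (\<lambda>v. v \<bullet> T v)"
    using lin by (intro continuous_intros linear_continuous_on) (auto simp: linear_conv_bounded_linear)
  ultimately have "\<exists>v\<in>?K. \<forall>x\<in>?K. x \<bullet> T x \<le> v \<bullet> T v"
    by (intro continuous_attains_sup) auto
  then obtain v where v: "v \<in> ?K" and max: "\<And>x. x \<in> ?K \<Longrightarrow> x \<bullet> T x \<le> v \<bullet> T v"
    by blast
  define l where "l = v \<bullet> T v"
  have vS: "v \<in> S" and v1: "v \<bullet> v = 1" using v by (auto simp: norm_eq_1)
  have le: "x \<bullet> T x \<le> l * (x \<bullet> x)" if "x \<in> S" for x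
  proof (cases "x = 0")
    case False
    have "inverse (norm x) *\<^sub>R x \<in> ?K" using False that S(1) by (auto simp: subspace_scale)
    from max[OF this] have "inverse (norm x) * inverse (norm x) * (x \<bullet> T x) \<le> l"
      using lin by (simp add: linear_scale l_def)
    then show ?thesis using False
      by (simp add: field_simps power2_norm_eq_inner[symmetric] power2_eq_square)
  qed (use lin in \<open>simp add: linear_0\<close>)
  define u where "u = T v - l *\<^sub>R v"
  have uS: "u \<in> S" using vS S unfolding u_def by (intro subspace_diff subspace_scale) auto
  have 1: "2 * e * (u \<bullet> u) \<le> e\<^sup>2 * (l * (u \<bullet> u) - u \<bullet> T u)" for e
  proof -
    have "v + e *\<^sub>R u \<in> S" using vS uS S(1) by (simp add: subspace_add subspace_scale)
    from le[OF this] have "l + 2 * e * (u \<bullet> T v) + e\<^sup>2 * (u \<bullet> T u) \<le> l * (1 + 2 * e * (u \<bullet> v) + e\<^sup>2 * (u \<bullet> u))"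
      using lin sa[of v u] v1 by (simp add: linear_add linear_scale inner_simps inner_commute l_def power2_eq_square algebra_simps)
    moreover have "u \<bullet> u = u \<bullet> (T v - l *\<^sub>R v)" by (simp add: u_def)
    then have uTv: "u \<bullet> T v = u \<bullet> u + l * (u \<bullet> v)" by (simp add: inner_diff_right)
    ultimately show ?thesis unfolding uTv by (simp add: algebra_simps)
  qed
  have "u \<bullet> u = 0"
  proof (rule ccontr)
    assume "u \<bullet> u \<noteq> 0"
    then have pos: "u \<bullet> u > 0" using inner_gt_zero_iff by fastforce
    \<comment> \<open>\<open>M\<close> bounds the second-order coefficient and is positive; \<open>e\<close> is so small that the first-order term
      wins.\<close>
    define M where "M = \<bar>l * (u \<bullet> u) - u \<bullet> T u\<bar> + 1"
    define e where "e = (u \<bullet> u) / M"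
    have M: "M > 0" "l * (u \<bullet> u) - u \<bullet> T u \<le> M" by (auto simp: M_def)
    have e: "e > 0" using pos M by (simp add: e_def)
    have "2 * e * (u \<bullet> u) \<le> e\<^sup>2 * M" using 1[of e] M(2) by (smt (verit) mult_left_mono zero_le_power2)
    also have "\<dots> = e * (u \<bullet> u)" using M by (simp add: e_def power2_eq_square)
    finally show False using e pos by simp
  qed
  then have "T v = l *\<^sub>R v" by (simp add: u_def)
  then show ?thesis using vS v unfolding l_def by auto
qed

lemma selfadj_orthonormal_eigenvectors:
  assumes T: "selfadj T"
  shows "subspace S \<Longrightarrow> T ` S \<subseteq> S \<Longrightarrow> \<exists>E. pairwise orthogonal E \<and> (\<forall>e\<in>E. norm e = 1) \<and>
    span E = S \<and> (\<forall>e\<in>E. T e = (e \<bullet> T e) *\<^sub>R e)"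
proof (induction "dim S" arbitrary: S rule: less_induct)
  case less
  have lin: "linear T" and sa: "T x \<bullet> y = x \<bullet> T y" for x y using T by (auto simp: selfadj_def)
  show ?case
  proof (cases "S = {0}")
    case True
    then show ?thesis by (intro exI[of _ "{}"]) auto
  next
    case False
    then obtain v where v: "v \<in> S" "norm v = 1" "T v = (v \<bullet> T v) *\<^sub>R v"
      using selfadj_eigenvector_exists[OF T less.prems] by blast
    define S' where "S' = {x \<in> S. v \<bullet> x = 0}"
    have sub: "subspace S'" using less.prems(1) unfolding S'_def
      by (auto simp: subspace_def inner_simps)
    have inv: "T ` S' \<subseteq> S'"
    proof (clarsimp simp: S'_def)
      fix x assume "x \<in> S" "v \<bullet> x = 0"
      then show "T x \<in> S \<and> v \<bullet> T x = 0"
        using less.prems(2) sa[of v x] by (metis image_subset_iff inner_scaleR_left mult_zero_right v(3))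
    qed
    have vv: "v \<bullet> v = 1" using v(2) by (simp add: norm_eq_1)
    have "v \<notin> S'" using vv by (simp add: S'_def)
    then have "S' \<subset> S" using v(1) S'_def by blast
    then have "dim S' < dim S"
      by (metis dim_psubset span_eq_iff sub less.prems(1))
    from less.hyps[OF this sub inv] obtain E where E: "pairwise orthogonal E" "\<forall>e\<in>E. norm e = 1"
      "span E = S'" "\<forall>e\<in>E. T e = (e \<bullet> T e) *\<^sub>R e" by blast
    have ES: "e \<in> S'" if "e \<in> E" for e using that E(3) span_base by blast
    have "span (insert v E) = S"
    proof
      show "span (insert v E) \<subseteq> S"
        using v(1) ES less.prems(1) by (intro span_minimal) (auto simp: S'_def)
      show "S \<subseteq> span (insert v E)"
      proof
        fix x assume x: "x \<in> S"
        have "x - (v \<bullet> x) *\<^sub>R v \<in> S'"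
          using x v(1) vv less.prems(1) by (auto simp: S'_def inner_simps subspace_diff subspace_scale)
        then show "x \<in> span (insert v E)" using E(3) by (auto simp: span_breakdown_eq)
      qed
    qed
    moreover have "pairwise orthogonal (insert v E)"
      using E(1) ES by (auto simp: pairwise_insert S'_def orthogonal_def inner_commute)
    ultimately show ?thesis using E v by (intro exI[of _ "insert v E"]) auto
  qed
qed

theorem selfadj_eigbasis_exists: "selfadj T \<Longrightarrow> \<exists>E. eigbasis T E"
  unfolding eigbasis_def using selfadj_orthonormal_eigenvectors[of T UNIV] by auto

definition onb :: "'a::euclidean_space set \<Rightarrow> bool" where
  "onb E \<longleftrightarrow> pairwise orthogonal E \<and> (\<forall>e\<in>E. norm e = 1) \<and> span E = UNIV"

lemma eigbasis_onb: "eigbasis T E \<Longrightarrow> onb E" by (auto simp: eigbasis_def onb_def)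

lemma onb_independent: "onb E \<Longrightarrow> independent E"
  unfolding onb_def by (metis norm_zero pairwise_orthogonal_independent zero_neq_one)

lemma onb_finite: "onb E \<Longrightarrow> finite E"
  using onb_independent independent_imp_finite by blast

lemma onb_card: "onb (E :: 'a::euclidean_space set) \<Longrightarrow> card E = DIM('a)"
  using onb_independent[of E] by (metis dim_UNIV dim_eq_card_independent dim_span onb_def)

lemma onb_inner:
  assumes "onb E" "e \<in> E" "e' \<in> E" shows "e \<bullet> e' = (if e = e' then 1 else 0)"
  using assms by (auto simp: onb_def pairwise_def orthogonal_def norm_eq_1)

lemma onb_expand: "onb E \<Longrightarrow> (\<Sum>e\<in>E. (x \<bullet> e) *\<^sub>R e) = x"
  by (rule orthonormal_basis_expand) (auto simp: onb_def onb_finite)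

lemma onb_inner_expand: "onb E \<Longrightarrow> (\<Sum>e\<in>E. (x \<bullet> e) * (y \<bullet> e)) = x \<bullet> y"
  by (subst (3) onb_expand[symmetric, of E]) (auto simp: inner_sum_right intro: sum.cong)

lemma onb_parseval: "onb E \<Longrightarrow> norm x = 1 \<Longrightarrow> (\<Sum>e\<in>E. (x \<bullet> e)\<^sup>2) = 1"
  using onb_inner_expand[of E x x] by (simp add: power2_eq_square norm_eq_1)

lemma eigbasis_expand:
  assumes "selfadj T" "eigbasis T E"
  shows "x \<bullet> T y = (\<Sum>e\<in>E. (e \<bullet> T e) * (x \<bullet> e) * (y \<bullet> e))"
proof -
  have lin: "linear T" using assms by (simp add: selfadj_def)
  have "T y = T (\<Sum>e\<in>E. (y \<bullet> e) *\<^sub>R e)" using onb_expand[OF eigbasis_onb[OF assms(2)]] by simp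
  also have "\<dots> = (\<Sum>e\<in>E. (y \<bullet> e) *\<^sub>R T e)" using lin by (simp add: linear_sum linear_scale)
  also have "\<dots> = (\<Sum>e\<in>E. (y \<bullet> e) *\<^sub>R (e \<bullet> T e) *\<^sub>R e)"
    using assms(2) unfolding eigbasis_def by (intro sum.cong refl) metis
  finally show ?thesis by (simp add: inner_sum_right algebra_simps)
qed

lemma eigbasis_eigenvector:
  assumes "eigbasis T E" "e \<in> E" shows "T e = (e \<bullet> T e) *\<^sub>R e"
  using assms by (simp add: eigbasis_def)

lemma eigbasis_norm: "eigbasis T E \<Longrightarrow> e \<in> E \<Longrightarrow> norm e = 1"
  by (simp add: eigbasis_def)

lemma selfadj_diff: "selfadj S \<Longrightarrow> selfadj T \<Longrightarrow> selfadj (\<lambda>x. S x - T x)"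
  by (auto simp: selfadj_def linear_compose_sub inner_simps)

text \<open>In a pair of eigenvectors the difference of the operators acts like the difference of the eigenvalues,
although the operators do not commute. Squaring this turns weighted sums of \<open>(\<mu> - \<lambda>)\<^sup>2\<close> into sums of
squared entries of \<open>S - T\<close>.\<close>

lemma cross_matrix_entry:
  assumes "selfadj S" "selfadj T" "eigbasis T E" "eigbasis S E'" "e \<in> E" "e' \<in> E'"
  shows "e' \<bullet> (S e - T e) = (e' \<bullet> S e' - e \<bullet> T e) * (e \<bullet> e')"
proof -
  have "e' \<bullet> S e = S e' \<bullet> e" using assms(1) by (simp add: selfadj_def)
  also have "\<dots> = (e' \<bullet> S e') * (e \<bullet> e')"
    by (subst eigbasis_eigenvector[OF assms(4,6)]) (simp add: inner_commute)
  finally have 1: "e' \<bullet> S e = (e' \<bullet> S e') * (e \<bullet> e')" .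
  have "e' \<bullet> T e = (e \<bullet> T e) * (e \<bullet> e')"
    by (subst eigbasis_eigenvector[OF assms(3,5)]) (simp add: inner_commute)
  with 1 show ?thesis by (simp add: inner_diff_right left_diff_distrib)
qed

text \<open>By Parseval's identity the squares \<open>(e \<bullet> e')\<^sup>2\<close> sum to 1 in each index, so a trace can be written as
a double sum over two unrelated orthonormal bases. This and the two variants below bring traces that
involve two operators with different eigenbases to a common form.\<close>

lemma trace_in_other_basis:
  assumes "eigbasis T E" "onb E'"
  shows "(\<Sum>e\<in>E. \<phi> (e \<bullet> T e)) = (\<Sum>e\<in>E. \<Sum>e'\<in>E'. (e \<bullet> e')\<^sup>2 * \<phi> (e \<bullet> T e))"
proof (rule sum.cong[OF refl])
  fix e assume "e \<in> E"
  then have "(\<Sum>e'\<in>E'. (e \<bullet> e')\<^sup>2) = 1" using assms eigbasis_norm onb_parseval by blast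
  then show "\<phi> (e \<bullet> T e) = (\<Sum>e'\<in>E'. (e \<bullet> e')\<^sup>2 * \<phi> (e \<bullet> T e))"
    by (simp add: sum_distrib_right[symmetric])
qed

lemma trace_in_other_basis':
  assumes "onb E" "eigbasis S E'"
  shows "(\<Sum>e'\<in>E'. \<phi> (e' \<bullet> S e')) = (\<Sum>e\<in>E. \<Sum>e'\<in>E'. (e \<bullet> e')\<^sup>2 * \<phi> (e' \<bullet> S e'))"
  by (subst sum.swap) (simp add: inner_commute trace_in_other_basis[OF assms(2,1)])

lemma trace_product_in_other_basis:
  assumes "selfadj S" "eigbasis S E'"
  shows "(\<Sum>e\<in>E. \<phi> e * (e \<bullet> S e)) = (\<Sum>e\<in>E. \<Sum>e'\<in>E'. (e \<bullet> e')\<^sup>2 * (\<phi> e * (e' \<bullet> S e')))"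
  by (subst eigbasis_expand[OF assms]) (simp add: sum_distrib_left power2_eq_square algebra_simps)

text \<open>Eigenvectors that are not orthogonal have equal eigenvalues, so the two double sums agree term by
term. Hence the choice of the eigenbasis does not matter.\<close>

lemma trace_fun_unique:
  fixes \<phi> :: "real \<Rightarrow> real"
  assumes T: "selfadj T" "eigbasis T E" "eigbasis T E'"
  shows "(\<Sum>e\<in>E. \<phi> (e \<bullet> T e)) = (\<Sum>e\<in>E'. \<phi> (e \<bullet> T e))"
proof -
  have "(e \<bullet> e')\<^sup>2 * \<phi> (e \<bullet> T e) = (e \<bullet> e')\<^sup>2 * \<phi> (e' \<bullet> T e')" if "e \<in> E" "e' \<in> E'" for e e'
    using cross_matrix_entry[OF T(1,1,2,3) that] by auto
  then show ?thesis
    unfolding trace_in_other_basis[OF T(2) eigbasis_onb[OF T(3)]]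
      trace_in_other_basis'[OF eigbasis_onb[OF T(2)] T(3)] by (intro sum.cong refl) blast
qed

section \<open>Scalar inequalities\<close>

text \<open>The derivative of \<open>\<bar>x\<bar> powr p\<close>.\<close>

definition dpow :: "real \<Rightarrow> real \<Rightarrow> real" where
  "dpow p x = p * (sgn x * \<bar>x\<bar> powr (p - 1))"

lemma abs_powr_tangent:
  assumes "1 < p"
  shows "\<bar>x\<bar> powr p + dpow p x * (y - x) \<le> \<bar>y\<bar> powr p"
proof (cases "x = 0 \<or> y = 0")
  case True
  have "\<bar>x\<bar> powr p = x * (sgn x * \<bar>x\<bar> powr (p - 1))" 
    using powr_mult_base[of "\<bar>x\<bar>" "p - 1"] by (cases x "0::real" rule: linorder_cases) auto
  moreover have "\<bar>x\<bar> powr p * (p - 1) \<ge> 0" using assms by simp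
  ultimately show ?thesis using True assms by (auto simp: dpow_def algebra_simps)
next
  case False
  have e: "\<bar>x\<bar> powr p = x * (sgn x * \<bar>x\<bar> powr (p - 1))" 
    using powr_mult_base[of "\<bar>x\<bar>" "p - 1"] by (cases x "0::real" rule: linorder_cases) auto
  have "(\<bar>x\<bar> powr p) powr ((p - 1) / p) * (\<bar>y\<bar> powr p) powr (1 / p)
    \<le> (p - 1) / p * \<bar>x\<bar> powr p + 1 / p * \<bar>y\<bar> powr p"
    using assms False by (intro Youngs_inequality_0) (auto simp: field_simps)
  then have "p * (\<bar>x\<bar> powr (p - 1) * \<bar>y\<bar>) \<le> p * ((p - 1) / p * \<bar>x\<bar> powr p + 1 / p * \<bar>y\<bar> powr p)"
    using assms False by (intro mult_left_mono) (auto simp: powr_powr)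
  then have 1: "p * (\<bar>x\<bar> powr (p - 1) * \<bar>y\<bar>) \<le> (p - 1) * \<bar>x\<bar> powr p + \<bar>y\<bar> powr p"
    using assms by (simp add: distrib_left)
  have "sgn x * y \<le> \<bar>y\<bar>" by (simp add: sgn_if abs_if)
  then have "p * (\<bar>x\<bar> powr (p - 1) * (sgn x * y)) \<le> p * (\<bar>x\<bar> powr (p - 1) * \<bar>y\<bar>)"
    using assms by (intro mult_left_mono) auto
  with 1 e show ?thesis by (simp add: dpow_def algebra_simps)
qed

lemma powr_subadditive:
  fixes a b s :: real
  assumes "0 \<le> a" "0 \<le> b" "0 < s" "s \<le> 1"
  shows "(a + b) powr s \<le> a powr s + b powr s"
proof (cases "a + b = 0")
  case False
  then have c: "a + b > 0" using assms by simp
  have "x * (a + b) powr (s - 1) \<le> x powr s" if "0 \<le> x" "x \<le> a + b" for x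
  proof (cases "x = 0")
    case False
    then have "(a + b) powr (s - 1) \<le> x powr (s - 1)" using that assms by (intro powr_mono2') auto
    then show ?thesis using False that powr_mult_base[of x "s - 1"] by (metis add.commute diff_add_cancel mult_left_mono)
  qed simp
  from this[of a] this[of b] have "(a + b) * (a + b) powr (s - 1) \<le> a powr s + b powr s"
    using assms by (simp add: distrib_right)
  then show ?thesis using powr_mult_base[of "a + b" "s - 1"] c by simp
qed (use assms in auto)

text \<open>Hoelder continuity of the derivative, with exponent \<open>p - 1\<close>, is what makes the trace power
differentiable also at operators with eigenvalue 0, where the second derivative blows up.\<close>

lemma dpow_holder:
  assumes p: "1 < p" "p \<le> 2"
  shows "\<bar>dpow p x - dpow p y\<bar> \<le> 2 * p * \<bar>x - y\<bar> powr (p - 1)"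
proof -
  have *: "\<bar>dpow p x - dpow p y\<bar> \<le> 2 * p * \<bar>x - y\<bar> powr (p - 1)" if "\<bar>y\<bar> \<le> \<bar>x\<bar>" for x y
  proof (cases "sgn x * sgn y \<ge> 0")
    case True
    have "\<bar>x\<bar> = \<bar>y\<bar> + \<bar>x - y\<bar>" using True that by (auto simp: sgn_if abs_if split: if_splits)
    then have "\<bar>x\<bar> powr (p - 1) = (\<bar>y\<bar> + \<bar>x - y\<bar>) powr (p - 1)" by (rule arg_cong)
    also have "\<dots> \<le> \<bar>y\<bar> powr (p - 1) + \<bar>x - y\<bar> powr (p - 1)"
      using p by (intro powr_subadditive) auto
    finally have A: "\<bar>x\<bar> powr (p - 1) - \<bar>y\<bar> powr (p - 1) \<le> \<bar>x - y\<bar> powr (p - 1)" by linarith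
    have B: "\<bar>y\<bar> powr (p - 1) \<le> \<bar>x\<bar> powr (p - 1)" using that p by (intro powr_mono2) auto
    have C: "0 \<le> \<bar>x - y\<bar> powr (p - 1)" by simp
    have "\<bar>sgn x * \<bar>x\<bar> powr (p - 1) - sgn y * \<bar>y\<bar> powr (p - 1)\<bar> = \<bar>x\<bar> powr (p - 1) - \<bar>y\<bar> powr (p - 1)"
    proof (cases "y = 0")
      case False
      then have "sgn x = sgn y" "\<bar>sgn y\<bar> = 1" using True that by (auto simp: sgn_if split: if_splits)
      then show ?thesis using B by (simp add: right_diff_distrib[symmetric] abs_mult)
    qed (auto simp: abs_mult)
    with A C have "\<bar>sgn x * \<bar>x\<bar> powr (p - 1) - sgn y * \<bar>y\<bar> powr (p - 1)\<bar> \<le> 2 * \<bar>x - y\<bar> powr (p - 1)"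
      by linarith
    then have "p * \<bar>sgn x * \<bar>x\<bar> powr (p - 1) - sgn y * \<bar>y\<bar> powr (p - 1)\<bar> \<le> p * (2 * \<bar>x - y\<bar> powr (p - 1))"
      using p by (intro mult_left_mono) auto
    moreover have "\<bar>dpow p x - dpow p y\<bar> = p * \<bar>sgn x * \<bar>x\<bar> powr (p - 1) - sgn y * \<bar>y\<bar> powr (p - 1)\<bar>"
      using p unfolding dpow_def right_diff_distrib[symmetric] abs_mult by simp
    ultimately show ?thesis by simp
  next
    case False
    then have "\<bar>x - y\<bar> = \<bar>x\<bar> + \<bar>y\<bar>" by (auto simp: sgn_if split: if_splits)
    then have "\<bar>x\<bar> powr (p - 1) \<le> \<bar>x - y\<bar> powr (p - 1)" "\<bar>y\<bar> powr (p - 1) \<le> \<bar>x - y\<bar> powr (p - 1)"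
      using p by (auto intro!: powr_mono2)
    moreover have "\<bar>sgn t * a\<bar> \<le> a" if "0 \<le> a" for t a :: real
      using that by (cases t "0::real" rule: linorder_cases) simp_all
    then have "\<bar>sgn x * \<bar>x\<bar> powr (p - 1)\<bar> \<le> \<bar>x\<bar> powr (p - 1)" "\<bar>sgn y * \<bar>y\<bar> powr (p - 1)\<bar> \<le> \<bar>y\<bar> powr (p - 1)"
      by simp_all
    ultimately have "\<bar>sgn x * \<bar>x\<bar> powr (p - 1) - sgn y * \<bar>y\<bar> powr (p - 1)\<bar> \<le> 2 * \<bar>x - y\<bar> powr (p - 1)"
      using abs_triangle_ineq4[of "sgn x * \<bar>x\<bar> powr (p - 1)" "sgn y * \<bar>y\<bar> powr (p - 1)"] by linarith
    then have "p * \<bar>sgn x * \<bar>x\<bar> powr (p - 1) - sgn y * \<bar>y\<bar> powr (p - 1)\<bar> \<le> p * (2 * \<bar>x - y\<bar> powr (p - 1))"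
      using p by (intro mult_left_mono) auto
    moreover have "\<bar>dpow p x - dpow p y\<bar> = p * \<bar>sgn x * \<bar>x\<bar> powr (p - 1) - sgn y * \<bar>y\<bar> powr (p - 1)\<bar>"
      using p unfolding dpow_def right_diff_distrib[symmetric] abs_mult by simp
    ultimately show ?thesis by simp
  qed
  show ?thesis
    using *[of y x] *[of x y] by (cases "\<bar>y\<bar> \<le> \<bar>x\<bar>") (auto simp: abs_minus_commute)
qed

text \<open>The Hermite--Hadamard inequality for the convex function \<open>t powr (s - 1)\<close>. Subtracting from \<open>t powr s\<close>
an antiderivative of the tangent to its derivative at the midpoint leaves a nondecreasing function \<open>k\<close>;
the quadratic term takes equal values at both endpoints and drops out.\<close>

lemma powr_diff_midpoint:
  fixes x y s :: real
  assumes "0 \<le> y" "y < x" "0 < s" "s \<le> 1"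
  shows "s * ((x + y) / 2) powr (s - 1) * (x - y) \<le> x powr s - y powr s"
proof -
  define m where "m = (x + y) / 2"
  have m: "m > 0" using assms by (simp add: m_def)
  define A where "A = s * m powr (s - 1)"
  define B where "B = s * (s - 1) * m powr (s - 2)"
  define k where "k = (\<lambda>t. t powr s - A * t - B * (t - m)\<^sup>2 / 2)"
  have "k y \<le> k x"
  proof (rule DERIV_nonneg_imp_increasing_open[where f = k and a = y and b = x])
    fix t assume t: "y < t" "t < x"
    then have t0: "t > 0" using assms by simp
    have "(k has_real_derivative s * t powr (s - 1) - A - B * (t - m)) (at t)"
    proof -
      have d1: "((\<lambda>t. t powr s) has_real_derivative s * t powr (s - 1)) (at t)"
        using has_real_derivative_powr[OF t0] .
      have d2: "((\<lambda>t. (t - m)\<^sup>2) has_real_derivative 2 * (t - m)) (at t)"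
        by (auto intro!: derivative_eq_intros)
      have "(k has_real_derivative s * t powr (s - 1) - A * 1 - B * (2 * (t - m)) / 2) (at t)"
        unfolding k_def by (rule DERIV_diff[OF DERIV_diff[OF d1 DERIV_cmult[OF DERIV_ident]] DERIV_cdivide[OF DERIV_cmult[OF d2]]])
      moreover have "B * (2 * (t - m)) / 2 = B * (t - m)" by simp
      ultimately show ?thesis by (simp only: mult_1_right)
    qed
    moreover have "m powr (s - 1) + (s - 1) * m powr (s - 2) * (t - m) \<le> t powr (s - 1)"
    proof -
      have x: "t / m > 0" using t0 m by simp
      have "(s - 1) * (t / m - 1) \<le> (s - 1) * ln (t / m)"
        using assms ln_le_minus_one[OF x] by (intro mult_left_mono_neg) auto
      then have "1 + (s - 1) * (t / m - 1) \<le> 1 + (s - 1) * ln (t / m)" by simp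
      also have "\<dots> \<le> exp ((s - 1) * ln (t / m))" by (rule exp_ge_add_one_self)
      also have "\<dots> = (t / m) powr (s - 1)" using t0 m by (simp add: powr_def)
      finally have "m powr (s - 1) * (1 + (s - 1) * (t / m - 1)) \<le> m powr (s - 1) * (t / m) powr (s - 1)"
        by (intro mult_left_mono) auto
      also have "\<dots> = t powr (s - 1)" using m t0 by (simp add: powr_mult[symmetric])
      finally have "m powr (s - 1) * (1 + (s - 1) * (t / m - 1)) \<le> t powr (s - 1)" .
      moreover have "m powr (s - 1) * (1 + (s - 1) * (t / m - 1)) =
        m powr (s - 1) + (s - 1) * m powr (s - 2) * (t - m)"
      proof -
        have e: "m powr (s - 1) = m powr (s - 2) * m" using powr_mult_base[of m "s - 2"] m by (simp add: mult.commute)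
        have "m powr (s - 1) * ((s - 1) * (t / m - 1)) = (s - 1) * m powr (s - 2) * (m * (t / m - 1))"
          unfolding e by (simp only: mult_ac)
        also have "m * (t / m - 1) = t - m" using m by (simp add: right_diff_distrib)
        finally show ?thesis by (simp only: distrib_left mult_1_right)
      qed
      ultimately show ?thesis by simp
    qed
    then have "s * (m powr (s - 1) + (s - 1) * m powr (s - 2) * (t - m)) \<le> s * t powr (s - 1)"
      using assms by (intro mult_left_mono) auto
    then have "0 \<le> s * t powr (s - 1) - A - B * (t - m)"
      unfolding A_def B_def by (simp only: distrib_left mult.assoc)
    ultimately show "\<exists>d. (k has_real_derivative d) (at t) \<and> 0 \<le> d" by blast
  next
    show "continuous_on {y..x} k" unfolding k_def using assms
      by (intro continuous_intros continuous_on_powr') auto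
  qed (use assms in simp)
  moreover have "(y - m)\<^sup>2 = (x - m)\<^sup>2" by (simp add: m_def power2_eq_square field_simps)
  ultimately have "A * (x - y) \<le> x powr s - y powr s" unfolding k_def by (simp add: right_diff_distrib)
  then show ?thesis unfolding A_def m_def .
qed

text \<open>The counterpart of the midpoint inequality for arguments of opposite sign, with absolute values \<open>a\<close>
and \<open>b\<close>. It follows from subadditivity since \<open>s \<le> 2 powr (s - 1)\<close>.\<close>

lemma powr_sum_midpoint:
  fixes a b s :: real
  assumes "0 \<le> a" "0 \<le> b" "0 < a + b" "0 < s" "s \<le> 1"
  shows "s * ((a + b) / 2) powr (s - 1) * (a + b) \<le> a powr s + b powr s"
proof -
  have "s \<le> 2 powr (s - 1)"
  proof -
    have "ln 2 \<le> (1::real)" using ln_2_less_1 by simp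
    then have "(s - 1) * 1 \<le> (s - 1) * ln 2" using assms by (intro mult_left_mono_neg) auto
    then have "exp (s - 1) \<le> 2 powr (s - 1)" by (simp add: powr_def)
    moreover have "s \<le> exp (s - 1)" using exp_ge_add_one_self[of "s - 1"] by simp
    ultimately show ?thesis by simp
  qed
  then have "s * ((a + b) / 2) powr (s - 1) * (a + b) \<le> 2 powr (s - 1) * ((a + b) / 2) powr (s - 1) * (a + b)"
    using assms by (intro mult_right_mono) auto
  also have "2 powr (s - 1) * ((a + b) / 2) powr (s - 1) = (2 * ((a + b) / 2)) powr (s - 1)"
    by (rule powr_mult[symmetric])
  also have "2 * ((a + b) / 2) = a + b" by simp
  also have "(a + b) powr (s - 1) * (a + b) = (a + b) * (a + b) powr (s - 1)" by (rule mult.commute)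
  also have "\<dots> = (a + b) powr s" using powr_mult_base[of "a + b" "s - 1"] assms by simp
  also have "\<dots> \<le> a powr s + b powr s" using assms by (intro powr_subadditive) auto
  finally show ?thesis .
qed

text \<open>The weight is the mean of the absolute values because the compression to a third basis requires a sum
of a function of \<open>x\<close> and a function of \<open>y\<close>; with the geometric mean the inequality would fail. The
shift \<open>\<delta>\<close> keeps the weight positive.\<close>

lemma dpow_strongly_monotone:
  assumes p: "1 < p" "p \<le> 2" and d: "\<delta> > 0"
  shows "p * (p - 1) * ((\<bar>x\<bar> + \<bar>y\<bar>) / 2 + \<delta>) powr (- (2 - p)) * (x - y)\<^sup>2 \<le> (dpow p x - dpow p y) * (x - y)"
proof -
  let ?\<sigma> = "\<lambda>x. sgn x * \<bar>x\<bar> powr (p - 1)"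
  have *: "(p - 1) * ((\<bar>x\<bar> + \<bar>y\<bar>) / 2) powr (p - 2) * (x - y) \<le> ?\<sigma> x - ?\<sigma> y" if "y < x" for x y
  proof -
    consider "0 \<le> y" | "x \<le> 0" | "y < 0" "0 < x" by linarith
    then show ?thesis
    proof cases
      case 1
      then show ?thesis using powr_diff_midpoint[of y x "p - 1"] p that by (cases "y = 0") simp_all
    next
      case 2
      then show ?thesis using powr_diff_midpoint[of "-x" "-y" "p - 1"] p that
        by (cases "x = 0") (simp_all add: add.commute)
    next
      case 3
      then show ?thesis using powr_sum_midpoint[of x "-y" "p - 1"] p that by simp
    qed
  qed
  have **: "p * (p - 1) * ((\<bar>x\<bar> + \<bar>y\<bar>) / 2 + \<delta>) powr (- (2 - p)) * (x - y)\<^sup>2 \<le> (dpow p x - dpow p y) * (x - y)"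
    if "y < x" for x y
  proof -
    have "((\<bar>x\<bar> + \<bar>y\<bar>) / 2 + \<delta>) powr (p - 2) \<le> ((\<bar>x\<bar> + \<bar>y\<bar>) / 2) powr (p - 2)"
      using that p d by (intro powr_mono2') (auto simp: abs_if)
    then have "(p - 1) * ((\<bar>x\<bar> + \<bar>y\<bar>) / 2 + \<delta>) powr (p - 2) * (x - y) \<le> (p - 1) * ((\<bar>x\<bar> + \<bar>y\<bar>) / 2) powr (p - 2) * (x - y)"
      using that p by (intro mult_left_mono mult_right_mono) auto
    also note *[OF that]
    finally have "p * ((p - 1) * ((\<bar>x\<bar> + \<bar>y\<bar>) / 2 + \<delta>) powr (p - 2) * (x - y)) * (x - y) \<le> p * (?\<sigma> x - ?\<sigma> y) * (x - y)"
      using p that by (intro mult_right_mono mult_left_mono) auto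
    moreover have "dpow p x - dpow p y = p * (?\<sigma> x - ?\<sigma> y)" by (simp add: dpow_def right_diff_distrib)
    ultimately show ?thesis by (simp only: power2_eq_square mult.assoc minus_diff_eq)
  qed
  show ?thesis using **[of y x] **[of x y]
    by (cases x y rule: linorder_cases) (auto simp: algebra_simps power2_eq_square)
qed

text \<open>Summing the tangent inequality at the weighted mean avoids a separate treatment of the boundary point
0 of the domain of convexity.\<close>

lemma powr_jensen:
  fixes c a :: "'i \<Rightarrow> real"
  assumes "1 < p" "finite I" "\<And>i. i \<in> I \<Longrightarrow> 0 \<le> c i" "(\<Sum>i\<in>I. c i) = 1" "\<And>i. i \<in> I \<Longrightarrow> 0 \<le> a i"
  shows "(\<Sum>i\<in>I. c i * a i) powr p \<le> (\<Sum>i\<in>I. c i * a i powr p)"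
proof -
  define m where "m = (\<Sum>i\<in>I. c i * a i)"
  have m: "m \<ge> 0" unfolding m_def using assms by (intro sum_nonneg) auto
  have "(\<Sum>i\<in>I. c i * (m powr p + dpow p m * (a i - m))) \<le> (\<Sum>i\<in>I. c i * a i powr p)"
    using abs_powr_tangent[OF assms(1), of m] assms(3,5) m
    by (intro sum_mono mult_left_mono) (metis abs_of_nonneg)+
  moreover have "(\<Sum>i\<in>I. c i * (m powr p + dpow p m * (a i - m))) =
    (\<Sum>i\<in>I. c i) * (m powr p) + dpow p m * ((\<Sum>i\<in>I. c i * a i) - (\<Sum>i\<in>I. c i) * m)"
    by (simp add: algebra_simps sum.distrib sum_subtractf sum_distrib_left sum_distrib_right)
  ultimately show ?thesis using assms(4) by (simp add: m_def)
qed

text \<open>Hoelder's inequality for the splitting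
\<open>\<bar>b\<bar> powr p = (b\<^sup>2 d powr (p - 2)) powr (p / 2) * (d powr p) powr (1 - p / 2)\<close>, solved for the sum
of the first factors. Its proof applies Young's inequality to the normalized terms.\<close>

lemma weighted_square_sum_lower_bound:
  fixes b d :: "'i \<Rightarrow> real"
  assumes p: "1 < p" "p \<le> 2" and W: "finite W" and d: "\<And>w. w \<in> W \<Longrightarrow> d w > 0"
  shows "(\<Sum>w\<in>W. \<bar>b w\<bar> powr p) powr (2 / p) * (\<Sum>w\<in>W. d w powr p) powr (- ((2 - p) / p))
    \<le> (\<Sum>w\<in>W. (b w)\<^sup>2 * d w powr (- (2 - p)))"
proof -
  define x where "x w = (b w)\<^sup>2 * d w powr (- (2 - p))" for w
  define B where "B = sum x W"
  define D where "D = (\<Sum>w\<in>W. d w powr p)"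
  define S where "S = (\<Sum>w\<in>W. \<bar>b w\<bar> powr p)"
  have x0: "x w \<ge> 0" for w by (simp add: x_def)
  have B0: "B \<ge> 0" unfolding B_def by (intro sum_nonneg x0)
  have S0: "S \<ge> 0" unfolding S_def by (intro sum_nonneg) auto
  show ?thesis
  proof (cases "B = 0")
    case True
    then have "\<forall>w\<in>W. x w = 0" using W x0 unfolding B_def by (subst (asm) sum_nonneg_eq_0_iff) auto
    then have "\<forall>w\<in>W. b w = 0" using d unfolding x_def by fastforce
    then have "S = 0" unfolding S_def by simp
    then show ?thesis using p B0 unfolding S_def B_def x_def by simp
  next
    case False
    then have Bp: "B > 0" using B0 by simp
    have "W \<noteq> {}" using False by (auto simp: B_def)
    then have Dp: "D > 0" unfolding D_def using W d by (intro sum_pos) (auto, fastforce)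
    let ?a = "p / 2"
    have t: "\<bar>b w\<bar> powr p \<le> B powr ?a * D powr (1 - ?a) * (?a * (x w / B) + (1 - ?a) * (d w powr p / D))"
      if w: "w \<in> W" for w
    proof (cases "b w = 0")
      case True
      then show ?thesis using p Bp Dp x0 by (auto intro!: mult_nonneg_nonneg add_nonneg_nonneg)
    next
      case False
      have xp: "x w > 0" using False d[OF w] by (simp add: x_def)
      have dp: "d w powr p > 0" using d[OF w] by simp
      have y: "(x w / B) powr ?a * (d w powr p / D) powr (1 - ?a) \<le> ?a * (x w / B) + (1 - ?a) * (d w powr p / D)"
        using p xp dp Bp Dp by (intro Youngs_inequality_0) auto
      have "x w powr ?a = \<bar>b w\<bar> powr p * d w powr (- (2 - p) * ?a)"
      proof -
        have "(b w)\<^sup>2 = \<bar>b w\<bar> powr 2" using False by simp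
        then have "x w = \<bar>b w\<bar> powr 2 * d w powr (- (2 - p))" by (simp only: x_def)
        then show ?thesis by (simp only: powr_mult powr_powr) simp
      qed
      have "(d w powr p) powr (1 - ?a) = d w powr ((2 - p) * ?a)"
      proof -
        have "p * (1 - ?a) = (2 - p) * ?a" by (simp add: field_simps)
        then show ?thesis by (simp only: powr_powr)
      qed
      then have e: "x w powr ?a * (d w powr p) powr (1 - ?a) = \<bar>b w\<bar> powr p"
      proof -
        have "d w powr (- (2 - p) * ?a) * d w powr ((2 - p) * ?a) = d w powr (- (2 - p) * ?a + (2 - p) * ?a)"
          by (rule powr_add[symmetric])
        also have "- (2 - p) * ?a + (2 - p) * ?a = 0" by (simp only: minus_mult_left[symmetric] left_minus)
        finally have "d w powr (- (2 - p) * ?a) * d w powr ((2 - p) * ?a) = 1" using d[OF w] by simp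
        then show ?thesis
          unfolding \<open>x w powr ?a = _\<close> \<open>(d w powr p) powr _ = _\<close> by (simp only: mult.assoc mult_1_right)
      qed
      have "\<bar>b w\<bar> powr p = B powr ?a * D powr (1 - ?a) * ((x w / B) powr ?a * (d w powr p / D) powr (1 - ?a))"
        using xp dp Bp Dp by (simp add: powr_divide e[symmetric])
      also have "\<dots> \<le> B powr ?a * D powr (1 - ?a) * (?a * (x w / B) + (1 - ?a) * (d w powr p / D))"
        using y by (intro mult_left_mono) auto
      finally show ?thesis .
    qed
    have "S \<le> (\<Sum>w\<in>W. B powr ?a * D powr (1 - ?a) * (?a * (x w / B) + (1 - ?a) * (d w powr p / D)))"
      unfolding S_def by (intro sum_mono t)
    also have "\<dots> = B powr ?a * D powr (1 - ?a) * (?a * (B / B) + (1 - ?a) * (D / D))"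
    proof -
      have "(\<Sum>w\<in>W. ?a * (x w / B) + (1 - ?a) * (d w powr p / D)) = ?a * (sum x W / B) + (1 - ?a) * ((\<Sum>w\<in>W. d w powr p) / D)"
        by (simp only: sum_distrib_left sum.distrib sum_divide_distrib)
      then show ?thesis unfolding B_def[symmetric] D_def[symmetric] by (simp only: sum_distrib_left[symmetric])
    qed
    also have "\<dots> = B powr ?a * D powr (1 - ?a)" using Bp Dp by simp
    finally have "S powr (2 / p) \<le> (B powr ?a * D powr (1 - ?a)) powr (2 / p)"
      using p S0 by (intro powr_mono2) auto
    also have "\<dots> = B * D powr ((2 - p) / p)"
    proof -
      have "?a * (2 / p) = 1" "(1 - ?a) * (2 / p) = (2 - p) / p"
        using p by (simp_all add: field_simps)
      then show ?thesis using Bp by (simp only: powr_mult powr_powr powr_one)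
    qed
    finally have "S powr (2 / p) * D powr (- ((2 - p) / p)) \<le> B * D powr ((2 - p) / p) * D powr (- ((2 - p) / p))"
      by (intro mult_right_mono) auto
    also have "\<dots> = B" using Dp by (simp add: powr_minus)
    finally show ?thesis unfolding S_def D_def B_def x_def .
  qed
qed

section \<open>Negative powers as integrals of resolvents\<close>

text \<open>For \<open>0 < r < 1\<close> the function \<open>t powr (- r)\<close> is, up to a constant factor, the integral of
\<open>u powr (- r) / (t + u)\<close> over \<open>u > 0\<close>. The next lemmas establish this: convergence of the integral,
its scaling in \<open>t\<close> and positivity of the constant.\<close>

lemma powr_kernel_integrable:
  assumes r: "0 < r" "r < 1"
  shows "integrable lborel (\<lambda>u::real. indicator {0<..} u * (u powr (- r) / (1 + u)))"
proof -
  have i1: "integrable lborel (\<lambda>u::real. indicator {0..1} u *\<^sub>R u powr (- r))"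
  proof -
    have "((\<lambda>u. u powr (- r)) has_integral (1 powr (- r + 1) / (- r + 1))) {0..1}"
      using r by (intro has_integral_powr_from_0) auto
    then have "(\<lambda>u. u powr (- r)) absolutely_integrable_on {0..1}"
      by (intro nonnegative_absolutely_integrable_1) (auto simp: has_integral_integrable)
    then have "integrable lebesgue (\<lambda>u::real. indicator {0..1} u *\<^sub>R u powr (- r))" unfolding set_integrable_def .
    then show ?thesis by (subst (asm) integrable_completion) auto
  qed
  have i2: "integrable lborel (\<lambda>u::real. indicator {1..} u *\<^sub>R u powr (- r - 1))"
  proof -
    have "((\<lambda>u. u powr (- r - 1)) has_integral (-(1 powr ((- r - 1) + 1)) / ((- r - 1) + 1))) {1..}"
      using r by (intro has_integral_powr_to_inf) auto
    then have "(\<lambda>u. u powr (- r - 1)) absolutely_integrable_on {1..}"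
      by (intro nonnegative_absolutely_integrable_1) (auto simp: has_integral_integrable)
    then have "integrable lebesgue (\<lambda>u::real. indicator {1..} u *\<^sub>R u powr (- r - 1))" unfolding set_integrable_def .
    then show ?thesis by (subst (asm) integrable_completion) auto
  qed
  show ?thesis
  proof (rule Bochner_Integration.integrable_bound[OF Bochner_Integration.integrable_add[OF i1 i2]])
    have le: "indicator {0<..} u * (u powr (- r) / (1 + u)) \<le> indicator {0..1} u * u powr (- r) + indicator {1..} u * u powr (- r - 1)"
      for u :: real
    proof -
      consider "u \<le> 0" | "0 < u" "u \<le> 1" | "u > 1" by linarith
      then show ?thesis
      proof cases
        case 2
        have "u powr (- r) / (1 + u) \<le> u powr (- r) / 1" using 2 by (intro divide_left_mono) auto
        then show ?thesis using 2 by (auto simp: indicator_def)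
      next
        case 3
        have "u powr (- r) / (1 + u) \<le> u powr (- r) / u" using 3 by (intro divide_left_mono) auto
        also have "\<dots> = u powr (- r - 1)" using 3 by (simp add: powr_diff)
        finally show ?thesis using 3 by (auto simp: indicator_def)
      qed (auto simp: indicator_def)
    qed
    have nn: "0 \<le> indicator {0<..} u * (u powr (- r) / (1 + u))" for u :: real
      by (cases "u > 0") auto
    show "AE u in lborel. norm (indicator {0<..} u * (u powr (- r) / (1 + u)))
      \<le> norm (indicator {0..1} u *\<^sub>R u powr (- r) + indicator {1..} u *\<^sub>R u powr (- r - 1))"
    proof (intro AE_I2)
      fix u :: real
      have "norm (indicator {0<..} u * (u powr (- r) / (1 + u))) = indicator {0<..} u * (u powr (- r) / (1 + u))"
        unfolding real_norm_def using nn by (rule abs_of_nonneg)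
      also have "\<dots> \<le> indicator {0..1} u *\<^sub>R u powr (- r) + indicator {1..} u *\<^sub>R u powr (- r - 1)"
        unfolding real_scaleR_def by (rule le)
      also have "\<dots> \<le> norm \<dots>" unfolding real_norm_def by (rule abs_ge_self)
      finally show "norm (indicator {0<..} u * (u powr (- r) / (1 + u)))
        \<le> norm (indicator {0..1} u *\<^sub>R u powr (- r) + indicator {1..} u *\<^sub>R u powr (- r - 1))" .
    qed
  qed measurable
qed

lemma powr_kernel_scaled:
  assumes r: "0 < r" "r < 1" and t: "t > 0"
  defines "k \<equiv> \<lambda>t u::real. indicator {0<..} u * (u powr (- r) / (t + u))"
  shows "has_bochner_integral lborel (k t) (t powr (- r) * (\<integral>u. k 1 u \<partial>lborel))"
proof -
  have int: "integrable lborel (k 1)" unfolding k_def by (rule powr_kernel_integrable[OF r])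
  have eq: "k t u = t powr (- r - 1) * k 1 (0 + (1 / t) * u)" for u
  proof (cases "u > 0")
    case True
    have "1 + u / t = (t + u) / t" using t by (simp add: add_divide_distrib)
    moreover have "(u / t) powr (- r) = u powr (- r) / t powr (- r)" using True t by (simp add: powr_divide)
    moreover have "t powr (- r - 1) = t powr (- r) / t" using t by (simp add: powr_diff)
    ultimately show ?thesis using True t by (simp add: k_def)
  next
    case False
    then show ?thesis using t by (simp add: k_def zero_less_divide_iff)
  qed
  have "integrable lborel (k t)" unfolding eq
    using lborel_integrable_real_affine[OF int, of "1 / t" 0] t by simp
  moreover have "(\<integral>u. k t u \<partial>lborel) = t powr (- r) * (\<integral>u. k 1 u \<partial>lborel)"
  proof -
    have "(\<integral>u. k 1 u \<partial>lborel) = (1 / t) * (\<integral>u. k 1 (0 + (1 / t) * u) \<partial>lborel)"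
      using lborel_integral_real_affine[of "1 / t" "k 1" 0] t by simp
    moreover have "(\<integral>u. k t u \<partial>lborel) = t powr (- r - 1) * (\<integral>u. k 1 (0 + (1 / t) * u) \<partial>lborel)"
      unfolding eq by simp
    ultimately show ?thesis using t by (simp add: powr_diff)
  qed
  ultimately show ?thesis by (simp add: has_bochner_integral_iff)
qed

lemma powr_kernel_pos:
  assumes r: "0 < r" "r < 1"
  shows "(\<integral>u. indicator {0<..} u * (u powr (- r) / (1 + u)) \<partial>lborel) > (0::real)"
proof -
  let ?k = "\<lambda>u::real. indicator {0<..} u * (u powr (- r) / (1 + u))"
  have nn: "?k u \<ge> 0" for u by (auto simp: indicator_def)
  have "(\<integral>u. ?k u \<partial>lborel) \<noteq> 0"
  proof
    assume "(\<integral>u. ?k u \<partial>lborel) = 0"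
    then have "AE u in lborel. ?k u = 0"
      using integral_nonneg_eq_0_iff_AE[OF powr_kernel_integrable[OF r]] nn by auto
    then have "AE u in lborel. u \<notin> {0<..<1::real}" by eventually_elim (auto simp: indicator_def)
    then have "emeasure lborel {0<..<1::real} = 0" by (subst (asm) AE_iff_measurable[of "{0<..<1}"]) auto
    then show False by simp
  qed
  moreover have "(\<integral>u. ?k u \<partial>lborel) \<ge> 0" by (rule Bochner_Integration.integral_nonneg) (rule nn)
  ultimately show ?thesis by simp
qed

text \<open>Integrating the hypothesis against \<open>u powr (- r)\<close>. The case \<open>r = 0\<close>, where the integral diverges,
arises for \<open>p = 2\<close> and is covered by the comparison of the plain sums.\<close>

lemma resolvent_comparison_imp_powr_comparison:
  fixes a m :: "'i \<Rightarrow> real" and b d :: "'j \<Rightarrow> real"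
  assumes r: "0 \<le> r" "r < 1"
    and m: "\<And>i. i \<in> I \<Longrightarrow> m i > 0" and d: "\<And>j. j \<in> J \<Longrightarrow> d j > 0"
    and eq: "sum b J \<le> sum a I"
    and le: "\<And>u. u > 0 \<Longrightarrow> (\<Sum>j\<in>J. b j / (d j + u)) \<le> (\<Sum>i\<in>I. a i / (m i + u))"
  shows "(\<Sum>j\<in>J. b j * d j powr (- r)) \<le> (\<Sum>i\<in>I. a i * m i powr (- r))"
proof (cases "r = 0")
  case True
  have "(\<Sum>j\<in>J. b j * d j powr (- r)) = sum b J" using d True by (intro sum.cong refl) fastforce
  moreover have "(\<Sum>j\<in>I. a j * m j powr (- r)) = sum a I" using m True by (intro sum.cong refl) fastforce
  ultimately show ?thesis using eq by simp
next
  case False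
  then have r: "0 < r" "r < 1" using r by auto
  define k where "k = (\<lambda>t u::real. indicator {0<..} u * (u powr (- r) / (t + u)))"
  define C where "C = (\<integral>u. k 1 u \<partial>lborel)"
  have C: "C > 0" unfolding C_def k_def by (rule powr_kernel_pos[OF r])
  have K: "has_bochner_integral lborel (k t) (t powr (- r) * C)" if "t > 0" for t
    unfolding C_def k_def by (rule powr_kernel_scaled[OF r that])
  have I: "has_bochner_integral lborel (\<lambda>u. \<Sum>i\<in>I. a i * k (m i) u) (\<Sum>i\<in>I. a i * (m i powr (- r) * C))"
    by (intro has_bochner_integral_sum has_bochner_integral_mult_right K m)
  have J: "has_bochner_integral lborel (\<lambda>u. \<Sum>j\<in>J. b j * k (d j) u) (\<Sum>j\<in>J. b j * (d j powr (- r) * C))"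
    by (intro has_bochner_integral_sum has_bochner_integral_mult_right K d)
  have "(\<Sum>j\<in>J. b j * k (d j) u) \<le> (\<Sum>i\<in>I. a i * k (m i) u)" for u
  proof (cases "u > 0")
    case True
    have "u powr (- r) * (\<Sum>j\<in>J. b j / (d j + u)) \<le> u powr (- r) * (\<Sum>i\<in>I. a i / (m i + u))"
      using le[OF True] by (intro mult_left_mono) auto
    then show ?thesis using True by (simp add: k_def sum_distrib_left mult_ac)
  qed (simp add: k_def)
  then have "(\<Sum>j\<in>J. b j * (d j powr (- r) * C)) \<le> (\<Sum>i\<in>I. a i * (m i powr (- r) * C))"
    using I J unfolding has_bochner_integral_iff by (metis (no_types, lifting) integral_mono)
  then have "C * (\<Sum>j\<in>J. b j * d j powr (- r)) \<le> C * (\<Sum>i\<in>I. a i * m i powr (- r))"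
    by (simp add: sum_distrib_left mult_ac)
  then show ?thesis using C by simp
qed

section \<open>Strong monotonicity of the gradient of the trace power\<close>

text \<open>Both sides are the inner product of the vectors with coefficients \<open>c\<close> and \<open>c'\<close> in the basis \<open>W\<close>.\<close>

lemma onb_coefficients:
  fixes c c' :: "'a::euclidean_space \<Rightarrow> real"
  assumes W: "onb W" and E: "onb E"
  shows "(\<Sum>e\<in>E. (\<Sum>w\<in>W. c w * (e \<bullet> w)) * (\<Sum>w\<in>W. c' w * (e \<bullet> w))) = (\<Sum>w\<in>W. c w * c' w)"
proof -
  let ?v = "\<lambda>c. \<Sum>w\<in>W. c w *\<^sub>R w"
  have 1: "(\<Sum>w\<in>W. c w * (e \<bullet> w)) = ?v c \<bullet> e" for c e
    unfolding inner_sum_left by (simp add: inner_commute)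
  have 2: "?v c \<bullet> w = c w" if "w \<in> W" for c w
  proof -
    have "?v c \<bullet> w = (\<Sum>w'\<in>W. if w' = w then c w' else 0)"
      unfolding inner_sum_left inner_scaleR_left
      by (intro sum.cong refl) (use onb_inner[OF W _ that] in auto)
    then show ?thesis using that onb_finite[OF W] by (simp add: sum.delta' )
  qed
  have "(\<Sum>e\<in>E. (?v c \<bullet> e) * (?v c' \<bullet> e)) = (\<Sum>w\<in>W. (?v c \<bullet> w) * (?v c' \<bullet> w))"
    using onb_inner_expand[OF E] onb_inner_expand[OF W] by simp
  then show ?thesis by (simp add: 1 2)
qed

text \<open>Multiplication of the entry \<open>(e, e')\<close> by \<open>a e + b e'\<close> is a positive operator \<open>M\<close> on matrices, \<open>q\<close> is a
matrix that is diagonal in the basis \<open>W\<close>, and \<open>d\<close> is the compression of \<open>M\<close> to such matrices; it is again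
diagonal because \<open>M\<close> is a sum of a left and a right multiplication. The inverse of a compression is
below the compression of the inverse: for every matrix \<open>z\<close>, the quadratic form of the inverse of
\<open>M + u\<close> at \<open>q\<close> is at least \<open>2 \<langle>q, z\<rangle> - \<langle>z, (M + u) z\<rangle>\<close>, and the right-hand side of this is largest
among the diagonal \<open>z\<close> for the coefficients \<open>\<zeta>\<close>.\<close>

lemma resolvent_compression:
  fixes E E' W :: "'a::euclidean_space set" and \<beta> a b :: "'a \<Rightarrow> real"
  assumes E: "onb E" and E': "onb E'" and W: "onb W"
    and a: "\<And>e. e \<in> E \<Longrightarrow> a e \<ge> 0" and b: "\<And>e. e \<in> E' \<Longrightarrow> b e \<ge> 0" and u: "u > 0"
  defines "q \<equiv> \<lambda>e e'. \<Sum>w\<in>W. \<beta> w * (e \<bullet> w) * (e' \<bullet> w)"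
    and "d \<equiv> \<lambda>w. (\<Sum>e\<in>E. (e \<bullet> w)\<^sup>2 * a e) + (\<Sum>e\<in>E'. (e \<bullet> w)\<^sup>2 * b e)"
  shows "(\<Sum>w\<in>W. (\<beta> w)\<^sup>2 / (d w + u)) \<le> (\<Sum>e\<in>E. \<Sum>e'\<in>E'. (q e e')\<^sup>2 / (a e + b e' + u))"
proof -
  have d0: "d w \<ge> 0" for w unfolding d_def using a b by (intro add_nonneg_nonneg sum_nonneg) auto
  have nw: "norm w = 1" if "w \<in> W" for w using W that by (simp add: onb_def)
  define \<zeta> where "\<zeta> w = \<beta> w / (d w + u)" for w
  define z where "z e e' = (\<Sum>w\<in>W. \<zeta> w * (e \<bullet> w) * (e' \<bullet> w))" for e e'
  have s1: "(\<Sum>e'\<in>E'. q e e' * z e e') = (\<Sum>w\<in>W. \<beta> w * \<zeta> w * (e \<bullet> w)\<^sup>2)" for e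
    unfolding q_def z_def onb_coefficients[OF W E'] by (simp add: power2_eq_square mult_ac)
  have s2: "(\<Sum>e'\<in>E'. (z e e')\<^sup>2) = (\<Sum>w\<in>W. (\<zeta> w)\<^sup>2 * (e \<bullet> w)\<^sup>2)" for e
    unfolding power2_eq_square z_def onb_coefficients[OF W E'] by (simp add: mult_ac)
  have s3: "(\<Sum>e\<in>E. (z e e')\<^sup>2) = (\<Sum>w\<in>W. (\<zeta> w)\<^sup>2 * (e' \<bullet> w)\<^sup>2)" for e'
  proof -
    have z: "z e e' = (\<Sum>w\<in>W. (\<zeta> w * (e' \<bullet> w)) * (e \<bullet> w))" for e by (simp add: z_def mult_ac)
    show ?thesis unfolding power2_eq_square z onb_coefficients[OF W E] by (simp add: mult_ac)
  qed
  have p: "(\<Sum>e\<in>E. (e \<bullet> w)\<^sup>2) = 1" if "w \<in> W" for w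
    using onb_parseval[OF E nw[OF that]] by (simp add: inner_commute)
  have qz: "(\<Sum>e\<in>E. \<Sum>e'\<in>E'. q e e' * z e e') = (\<Sum>w\<in>W. \<beta> w * \<zeta> w)"
  proof -
    have "(\<Sum>e\<in>E. \<Sum>w\<in>W. \<beta> w * \<zeta> w * (e \<bullet> w)\<^sup>2) = (\<Sum>w\<in>W. \<beta> w * \<zeta> w * (\<Sum>e\<in>E. (e \<bullet> w)\<^sup>2))"
      by (subst sum.swap) (simp add: sum_distrib_left)
    then show ?thesis by (simp add: s1 p)
  qed
  have zz: "(\<Sum>e\<in>E. \<Sum>e'\<in>E'. (a e + b e' + u) * (z e e')\<^sup>2) = (\<Sum>w\<in>W. (\<zeta> w)\<^sup>2 * (d w + u))"
  proof -
    have "(\<Sum>e\<in>E. \<Sum>e'\<in>E'. (a e + b e' + u) * (z e e')\<^sup>2)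
      = (\<Sum>e\<in>E. a e * (\<Sum>e'\<in>E'. (z e e')\<^sup>2)) + (\<Sum>e'\<in>E'. b e' * (\<Sum>e\<in>E. (z e e')\<^sup>2)) + u * (\<Sum>e\<in>E. \<Sum>e'\<in>E'. (z e e')\<^sup>2)"
      unfolding sum_distrib_left
      by (subst (3) sum.swap) (simp add: sum.distrib[symmetric] distrib_right)
    also have "(\<Sum>e\<in>E. a e * (\<Sum>e'\<in>E'. (z e e')\<^sup>2)) = (\<Sum>w\<in>W. (\<zeta> w)\<^sup>2 * (\<Sum>e\<in>E. (e \<bullet> w)\<^sup>2 * a e))"
      unfolding s2 sum_distrib_left by (subst sum.swap) (simp add: mult_ac)
    also have "(\<Sum>e'\<in>E'. b e' * (\<Sum>e\<in>E. (z e e')\<^sup>2)) = (\<Sum>w\<in>W. (\<zeta> w)\<^sup>2 * (\<Sum>e\<in>E'. (e \<bullet> w)\<^sup>2 * b e))"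
      unfolding s3 sum_distrib_left by (subst sum.swap) (simp add: mult_ac)
    also have "(\<Sum>e\<in>E. \<Sum>e'\<in>E'. (z e e')\<^sup>2) = (\<Sum>w\<in>W. (\<zeta> w)\<^sup>2 * (\<Sum>e\<in>E. (e \<bullet> w)\<^sup>2))"
      unfolding s2 sum_distrib_left by (subst sum.swap) simp
    also have "\<dots> = (\<Sum>w\<in>W. (\<zeta> w)\<^sup>2)" by (simp add: p)
    finally show ?thesis unfolding d_def by (simp add: distrib_left sum.distrib sum_distrib_left mult_ac)
  qed
  have "(\<Sum>w\<in>W. (\<beta> w)\<^sup>2 / (d w + u)) = 2 * (\<Sum>w\<in>W. \<beta> w * \<zeta> w) - (\<Sum>w\<in>W. (\<zeta> w)\<^sup>2 * (d w + u))"
  proof -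
    have "(\<beta> w)\<^sup>2 / (d w + u) = 2 * (\<beta> w * \<zeta> w) - (\<zeta> w)\<^sup>2 * (d w + u)" for w
    proof -
      have "d w + u \<noteq> 0" using d0[of w] u by simp
      then have "\<beta> w = \<zeta> w * (d w + u)" and "d w + u \<noteq> 0" by (simp_all add: \<zeta>_def)
      then have "(\<beta> w)\<^sup>2 / (d w + u) = (\<zeta> w)\<^sup>2 * (d w + u)" "\<beta> w * \<zeta> w = (\<zeta> w)\<^sup>2 * (d w + u)"
        by (simp_all add: power2_eq_square)
      then show ?thesis by simp
    qed
    then show ?thesis by (simp add: sum_distrib_left sum_subtractf)
  qed
  also have "\<dots> = (\<Sum>e\<in>E. \<Sum>e'\<in>E'. 2 * (q e e' * z e e') - (a e + b e' + u) * (z e e')\<^sup>2)"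
    by (simp add: qz[symmetric] zz[symmetric] sum_subtractf sum_distrib_left)
  also have "\<dots> \<le> (\<Sum>e\<in>E. \<Sum>e'\<in>E'. (q e e')\<^sup>2 / (a e + b e' + u))"
  proof (intro sum_mono)
    fix e e' assume "e \<in> E" "e' \<in> E'"
    then have M: "a e + b e' + u > 0" (is "?M > 0") using a b u by (simp add: add_nonneg_pos)
    have "0 \<le> (q e e' - ?M * z e e')\<^sup>2 / ?M" using M by simp
    also have "\<dots> = (q e e')\<^sup>2 / ?M - (2 * (q e e' * z e e') - ?M * (z e e')\<^sup>2)"
      using M by (simp add: power2_eq_square field_simps)
    finally show "2 * (q e e' * z e e') - ?M * (z e e')\<^sup>2 \<le> (q e e')\<^sup>2 / ?M" by simp
  qed
  finally show ?thesis .
qed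

text \<open>The gradient of the trace of \<open>\<Phi>\<close> at \<open>T\<close> is the operator \<open>\<phi>(T)\<close>, with \<open>\<phi>\<close> the derivative of \<open>\<Phi>\<close>; its
pairing with a direction is the sum of \<open>\<phi>\<close> at the eigenvalues times the diagonal entries of the
direction. The identity reduces monotonicity of the gradient to monotonicity of \<open>\<phi>\<close>.\<close>

lemma trace_monotonicity_expansion:
  assumes S: "selfadj S" "eigbasis S E'" and T: "selfadj T" "eigbasis T E"
  shows "(\<Sum>e\<in>E'. \<phi> (e \<bullet> S e) * (e \<bullet> (S e - T e))) - (\<Sum>e\<in>E. \<phi> (e \<bullet> T e) * (e \<bullet> (S e - T e)))
    = (\<Sum>e\<in>E. \<Sum>e'\<in>E'. (e \<bullet> e')\<^sup>2 * ((\<phi> (e' \<bullet> S e') - \<phi> (e \<bullet> T e)) * (e' \<bullet> S e' - e \<bullet> T e)))"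
proof -
  note oE = eigbasis_onb[OF T(2)] and oE' = eigbasis_onb[OF S(2)]
  have 1: "(\<Sum>e\<in>E'. \<phi> (e \<bullet> S e) * (e \<bullet> T e)) = (\<Sum>e\<in>E. \<Sum>e'\<in>E'. (e \<bullet> e')\<^sup>2 * (\<phi> (e' \<bullet> S e') * (e \<bullet> T e)))"
    unfolding trace_product_in_other_basis[OF T, where E = E'] by (subst sum.swap) (simp add: inner_commute)
  have 2: "(\<Sum>e\<in>E. \<phi> (e \<bullet> T e) * (e \<bullet> S e)) = (\<Sum>e\<in>E. \<Sum>e'\<in>E'. (e \<bullet> e')\<^sup>2 * (\<phi> (e \<bullet> T e) * (e' \<bullet> S e')))"
    by (rule trace_product_in_other_basis[OF S])
  note 3 = trace_in_other_basis'[OF oE S(2), where \<phi> = "\<lambda>t. \<phi> t * t"]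
  note 4 = trace_in_other_basis[OF T(2) oE', where \<phi> = "\<lambda>t. \<phi> t * t"]
  show ?thesis
    unfolding inner_diff_right right_diff_distrib sum_subtractf 1 2 3 4
    by (simp add: algebra_simps sum.distrib sum_subtractf)
qed

text \<open>The identity behind Klein's inequality: the Bregman distance of a trace function is an average of
scalar Bregman distances.\<close>

lemma trace_bregman_expansion:
  assumes S: "selfadj S" "eigbasis S E'" and T: "selfadj T" "eigbasis T E"
  shows "(\<Sum>e\<in>E'. \<phi> (e \<bullet> S e)) - (\<Sum>e\<in>E. \<phi> (e \<bullet> T e)) - (\<Sum>e\<in>E. \<psi> (e \<bullet> T e) * (e \<bullet> (S e - T e)))
    = (\<Sum>e\<in>E. \<Sum>e'\<in>E'. (e \<bullet> e')\<^sup>2 * (\<phi> (e' \<bullet> S e') - \<phi> (e \<bullet> T e) - \<psi> (e \<bullet> T e) * (e' \<bullet> S e' - e \<bullet> T e)))"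
proof -
  note oE = eigbasis_onb[OF T(2)] and oE' = eigbasis_onb[OF S(2)]
  have 2: "(\<Sum>e\<in>E. \<psi> (e \<bullet> T e) * (e \<bullet> S e)) = (\<Sum>e\<in>E. \<Sum>e'\<in>E'. (e \<bullet> e')\<^sup>2 * (\<psi> (e \<bullet> T e) * (e' \<bullet> S e')))"
    by (rule trace_product_in_other_basis[OF S])
  note 3 = trace_in_other_basis'[OF oE S(2), where \<phi> = \<phi>]
  note 4 = trace_in_other_basis[OF T(2) oE', where \<phi> = "\<lambda>t. \<psi> t * t"]
  note 5 = trace_in_other_basis[OF T(2) oE', where \<phi> = \<phi>]
  show ?thesis
    unfolding inner_diff_right right_diff_distrib sum_subtractf 2 3 4 5
    by (simp add: algebra_simps sum.distrib sum_subtractf)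
qed

text \<open>Diagonal entries in another basis are averages of the eigenvalues, so Jensen's inequality applies.\<close>

lemma pinching_powr:
  assumes p: "1 < p" and E: "onb E" and W: "onb W" and a: "\<And>e. e \<in> E \<Longrightarrow> 0 \<le> a e"
  shows "(\<Sum>w\<in>W. (\<Sum>e\<in>E. (e \<bullet> w)\<^sup>2 * a e) powr p) \<le> (\<Sum>e\<in>E. a e powr p)"
proof -
  have n: "norm w = 1" if "w \<in> W" for w using W that by (simp add: onb_def)
  have n': "norm e = 1" if "e \<in> E" for e using E that by (simp add: onb_def)
  have "(\<Sum>w\<in>W. (\<Sum>e\<in>E. (e \<bullet> w)\<^sup>2 * a e) powr p) \<le> (\<Sum>w\<in>W. \<Sum>e\<in>E. (e \<bullet> w)\<^sup>2 * a e powr p)"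
    using onb_parseval[OF E n] a
    by (intro sum_mono powr_jensen[OF p onb_finite[OF E]]) (auto simp: inner_commute)
  also have "\<dots> = (\<Sum>e\<in>E. (\<Sum>w\<in>W. (e \<bullet> w)\<^sup>2) * a e powr p)"
    by (subst sum.swap) (simp add: sum_distrib_right)
  also have "\<dots> = (\<Sum>e\<in>E. a e powr p)"
    by (intro sum.cong refl) (simp add: onb_parseval[OF W n'])
  finally show ?thesis .
qed

text \<open>This is the analytic core. The shift \<open>\<delta>\<close> makes all weights positive and is removed in the limit at the
end. When both operators vanish, the left-hand side is 0 by the convention \<open>0 powr a = 0\<close>.\<close>

theorem trace_powr_strongly_monotone:
  fixes S T :: "'a::euclidean_space \<Rightarrow> 'a"
  assumes p: "1 < p" "p \<le> 2"
    and S: "selfadj S" "eigbasis S E'" and T: "selfadj T" "eigbasis T E"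
    and W: "eigbasis (\<lambda>x. S x - T x) W"
  shows "p * (p - 1) * (\<Sum>w\<in>W. \<bar>w \<bullet> (S w - T w)\<bar> powr p) powr (2 / p) *
      (((\<Sum>e\<in>E'. \<bar>e \<bullet> S e\<bar> powr p) + (\<Sum>e\<in>E. \<bar>e \<bullet> T e\<bar> powr p)) / 2) powr (- ((2 - p) / p))
    \<le> (\<Sum>e\<in>E'. dpow p (e \<bullet> S e) * (e \<bullet> (S e - T e))) - (\<Sum>e\<in>E. dpow p (e \<bullet> T e) * (e \<bullet> (S e - T e)))"
    (is "?c * ?B * ?G powr ?r \<le> ?M")
proof -
  note oE = eigbasis_onb[OF T(2)] and oE' = eigbasis_onb[OF S(2)] and oW = eigbasis_onb[OF W]
  have fin: "finite E" "finite E'" "finite W" using onb_finite oE oE' oW by auto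
  have nw: "norm w = 1" if "w \<in> W" for w using oW that by (simp add: onb_def)
  define \<tau> where "\<tau> e = e \<bullet> T e" for e
  define \<mu> where "\<mu> e = e \<bullet> S e" for e
  define \<beta> where "\<beta> w = w \<bullet> (S w - T w)" for w
  define q where "q e e' = (\<Sum>w\<in>W. \<beta> w * (e \<bullet> w) * (e' \<bullet> w))" for e e'
  have q: "(q e e')\<^sup>2 = (e \<bullet> e')\<^sup>2 * (\<mu> e' - \<tau> e)\<^sup>2" if "e \<in> E" "e' \<in> E'" for e e'
  proof -
    have "q e e' = e' \<bullet> (S e - T e)"
      using eigbasis_expand[OF selfadj_diff[OF S(1) T(1)] W, of e' e] by (simp add: q_def \<beta>_def mult_ac)
    also have "\<dots> = (\<mu> e' - \<tau> e) * (e \<bullet> e')"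
      unfolding \<mu>_def \<tau>_def by (rule cross_matrix_entry[OF S(1) T(1) T(2) S(2) that])
    finally show ?thesis by (simp add: power_mult_distrib)
  qed
  have qq: "(\<Sum>w\<in>W. (\<beta> w)\<^sup>2) = (\<Sum>e\<in>E. \<Sum>e'\<in>E'. (q e e')\<^sup>2)"
  proof -
    have "(\<Sum>e'\<in>E'. (q e e')\<^sup>2) = (\<Sum>w\<in>W. (\<beta> w)\<^sup>2 * (e \<bullet> w)\<^sup>2)" for e
      unfolding q_def power2_eq_square onb_coefficients[OF oW oE'] by (simp add: mult_ac)
    then have "(\<Sum>e\<in>E. \<Sum>e'\<in>E'. (q e e')\<^sup>2) = (\<Sum>w\<in>W. (\<beta> w)\<^sup>2 * (\<Sum>e\<in>E. (e \<bullet> w)\<^sup>2))"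
      by (simp only:) (subst sum.swap, simp add: sum_distrib_left)
    also have "\<dots> = (\<Sum>w\<in>W. (\<beta> w)\<^sup>2)"
      using onb_parseval[OF oE nw] by (simp add: inner_commute)
    finally show ?thesis by simp
  qed
  define G where "G \<delta> = ((\<Sum>e\<in>E'. (\<bar>\<mu> e\<bar> + \<delta>) powr p) + (\<Sum>e\<in>E. (\<bar>\<tau> e\<bar> + \<delta>) powr p)) / 2" for \<delta>
  have M: "?M = (\<Sum>e\<in>E. \<Sum>e'\<in>E'. (e \<bullet> e')\<^sup>2 * ((dpow p (\<mu> e') - dpow p (\<tau> e)) * (\<mu> e' - \<tau> e)))"
    unfolding \<mu>_def \<tau>_def by (rule trace_monotonicity_expansion[OF S T])
  have main: "?c * ?B * G \<delta> powr ?r \<le> ?M" if \<delta>: "\<delta> > 0" for \<delta>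
  proof -
    \<comment> \<open>\<open>a e + b e'\<close> is the shifted mean of the absolute eigenvalues.\<close>
    define a where "a e = (\<bar>\<tau> e\<bar> + \<delta>) / 2" for e
    define b where "b e = (\<bar>\<mu> e\<bar> + \<delta>) / 2" for e
    define d where "d w = (\<Sum>e\<in>E. (e \<bullet> w)\<^sup>2 * a e) + (\<Sum>e\<in>E'. (e \<bullet> w)\<^sup>2 * b e)" for w
    have a: "a e > 0" and b: "b e > 0" for e using \<delta> by (auto simp: a_def b_def)
    have d: "d w > 0" if w: "w \<in> W" for w
    proof -
      have "0 < \<delta> / 2 * (\<Sum>e\<in>E. (e \<bullet> w)\<^sup>2)"
        using \<delta> onb_parseval[OF oE nw[OF w]] by (simp add: inner_commute)
      also have "\<dots> \<le> (\<Sum>e\<in>E. (e \<bullet> w)\<^sup>2 * a e)"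
        unfolding sum_distrib_left mult.commute[of "\<delta> / 2"] by (intro sum_mono mult_left_mono) (auto simp: a_def)
      moreover have "0 \<le> (\<Sum>e\<in>E'. (e \<bullet> w)\<^sup>2 * b e)" using b by (intro sum_nonneg mult_nonneg_nonneg) (auto intro: less_imp_le)
      ultimately show ?thesis unfolding d_def by linarith
    qed
    have "(\<Sum>w\<in>W. (\<beta> w)\<^sup>2 * d w powr (- (2 - p)))
      \<le> (\<Sum>x\<in>E \<times> E'. (q (fst x) (snd x))\<^sup>2 * (a (fst x) + b (snd x)) powr (- (2 - p)))"
    proof (rule resolvent_comparison_imp_powr_comparison)
      fix u :: real assume u: "u > 0"
      have "(\<Sum>w\<in>W. (\<beta> w)\<^sup>2 / (d w + u)) \<le> (\<Sum>e\<in>E. \<Sum>e'\<in>E'. (q e e')\<^sup>2 / (a e + b e' + u))"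
        unfolding d_def q_def using a b
        by (intro resolvent_compression[OF oE oE' oW _ _ u]) (auto intro: less_imp_le)
      then show "(\<Sum>w\<in>W. (\<beta> w)\<^sup>2 / (d w + u)) \<le> (\<Sum>x\<in>E \<times> E'. (q (fst x) (snd x))\<^sup>2 / (a (fst x) + b (snd x) + u))"
        by (simp add: sum.cartesian_product split_def)
    next
      show "(\<Sum>w\<in>W. (\<beta> w)\<^sup>2) \<le> (\<Sum>x\<in>E \<times> E'. (q (fst x) (snd x))\<^sup>2)"
        unfolding qq by (simp add: sum.cartesian_product split_def)
    qed (use p d a b in \<open>auto intro: add_pos_pos\<close>)
    also have "\<dots> = (\<Sum>e\<in>E. \<Sum>e'\<in>E'. (q e e')\<^sup>2 * (a e + b e') powr (- (2 - p)))"
      by (simp add: sum.cartesian_product split_def)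
    finally have 1: "(\<Sum>w\<in>W. (\<beta> w)\<^sup>2 * d w powr (- (2 - p)))
      \<le> (\<Sum>e\<in>E. \<Sum>e'\<in>E'. (q e e')\<^sup>2 * (a e + b e') powr (- (2 - p)))" .
    have c: "?c \<ge> 0" using p by simp
    have 2: "?c * (\<Sum>e\<in>E. \<Sum>e'\<in>E'. (q e e')\<^sup>2 * (a e + b e') powr (- (2 - p))) \<le> ?M"
      unfolding M sum_distrib_left
    proof (intro sum_mono)
      fix e e' assume e: "e \<in> E" "e' \<in> E'"
      have m: "a e + b e' = (\<bar>\<mu> e'\<bar> + \<bar>\<tau> e\<bar>) / 2 + \<delta>" by (simp add: a_def b_def field_simps)
      have "?c * ((q e e')\<^sup>2 * (a e + b e') powr (- (2 - p))) =
        (e \<bullet> e')\<^sup>2 * (?c * ((\<bar>\<mu> e'\<bar> + \<bar>\<tau> e\<bar>) / 2 + \<delta>) powr (- (2 - p)) * (\<mu> e' - \<tau> e)\<^sup>2)"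
        unfolding q[OF e] m by (simp only: mult_ac)
      also have "\<dots> \<le> (e \<bullet> e')\<^sup>2 * ((dpow p (\<mu> e') - dpow p (\<tau> e)) * (\<mu> e' - \<tau> e))"
        by (intro mult_left_mono dpow_strongly_monotone[OF p \<delta>]) auto
      finally show "?c * ((q e e')\<^sup>2 * (a e + b e') powr (- (2 - p))) \<le> \<dots>" .
    qed
    have 3: "(\<Sum>w\<in>W. \<bar>\<beta> w\<bar> powr p) powr (2 / p) * (\<Sum>w\<in>W. d w powr p) powr ?r
      \<le> (\<Sum>w\<in>W. (\<beta> w)\<^sup>2 * d w powr (- (2 - p)))"
      by (rule weighted_square_sum_lower_bound[OF p fin(3) d])
    have 4: "(\<Sum>w\<in>W. d w powr p) \<le> G \<delta>"
    proof -
      define A where "A w = (\<Sum>e\<in>E. (e \<bullet> w)\<^sup>2 * (\<bar>\<tau> e\<bar> + \<delta>))" for w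
      define B where "B w = (\<Sum>e\<in>E'. (e \<bullet> w)\<^sup>2 * (\<bar>\<mu> e\<bar> + \<delta>))" for w
      have A0: "A w \<ge> 0" and B0: "B w \<ge> 0" for w using \<delta> unfolding A_def B_def
        by (auto intro!: sum_nonneg mult_nonneg_nonneg)
      have dw: "d w = (A w + B w) / 2" for w
        unfolding d_def A_def B_def a_def b_def times_divide_eq_right sum_divide_distrib[symmetric]
        by (rule add_divide_distrib[symmetric])
      have "d w powr p \<le> (A w powr p + B w powr p) / 2" for w
      proof -
        have "(\<Sum>i\<in>UNIV. (1 / 2) * (if i then A w else B w)) powr p \<le> (\<Sum>i\<in>UNIV. (1 / 2) * (if i then A w else B w) powr p)"
          using A0 B0 by (intro powr_jensen[OF p(1)]) (auto simp: UNIV_bool)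
        then show ?thesis unfolding dw by (simp add: UNIV_bool add_divide_distrib add.commute)
      qed
      then have "(\<Sum>w\<in>W. d w powr p) \<le> ((\<Sum>w\<in>W. A w powr p) + (\<Sum>w\<in>W. B w powr p)) / 2"
        unfolding sum.distrib[symmetric] sum_divide_distrib by (rule sum_mono)
      moreover have "(\<Sum>w\<in>W. A w powr p) \<le> (\<Sum>e\<in>E. (\<bar>\<tau> e\<bar> + \<delta>) powr p)"
        unfolding A_def using \<delta> by (intro pinching_powr[OF p(1) oE oW]) auto
      moreover have "(\<Sum>w\<in>W. B w powr p) \<le> (\<Sum>e\<in>E'. (\<bar>\<mu> e\<bar> + \<delta>) powr p)"
        unfolding B_def using \<delta> by (intro pinching_powr[OF p(1) oE' oW]) auto
      ultimately show ?thesis unfolding G_def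
        by (elim order_trans) (intro divide_right_mono, subst add.commute, intro add_mono, simp_all)
    qed
    have "W \<noteq> {}" using onb_card[OF oW] by (metis DIM_positive card.empty less_irrefl)
    then have 5: "(\<Sum>w\<in>W. d w powr p) > 0" using fin(3) by (intro sum_pos) (auto dest: d)
    have 6: "G \<delta> powr ?r \<le> (\<Sum>w\<in>W. d w powr p) powr ?r" using p 4 5 by (intro powr_mono2') auto
    have "?c * ?B * G \<delta> powr ?r \<le> ?c * (?B * (\<Sum>w\<in>W. d w powr p) powr ?r)"
      unfolding mult.assoc[of ?c] by (intro mult_left_mono 6 c) auto
    also have "\<dots> \<le> ?c * (\<Sum>e\<in>E. \<Sum>e'\<in>E'. (q e e')\<^sup>2 * (a e + b e') powr (- (2 - p)))"
      using order_trans[OF 3 1] c unfolding \<beta>_def by (intro mult_left_mono) auto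
    also note 2
    finally show ?thesis .
  qed
  have G0: "?G = G 0" unfolding G_def \<tau>_def \<mu>_def by simp
  have Gnn: "G 0 \<ge> 0" unfolding G_def by (intro divide_nonneg_nonneg add_nonneg_nonneg sum_nonneg) auto
  show ?thesis
  proof (cases "G 0 = 0")
    case True
    have "0 \<le> ?c * ?B * G 1 powr ?r" using p by simp
    also have "\<dots> \<le> ?M" by (rule main) simp
    finally show ?thesis unfolding G0 True by simp
  next
    case False
    have "(G \<longlongrightarrow> G 0) (at_right 0)"
      unfolding G_def by (intro tendsto_intros tendsto_powr2) (auto intro!: tendsto_eq_intros simp: eventually_at_filter p less_imp_le less_trans[OF zero_less_one p(1)])
    then have "((\<lambda>\<delta>. ?c * ?B * G \<delta> powr ?r) \<longlongrightarrow> ?c * ?B * G 0 powr ?r) (at_right 0)"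
      using False by (intro tendsto_intros) auto
    moreover have "\<forall>\<^sub>F \<delta> in at_right 0. ?c * ?B * G \<delta> powr ?r \<le> ?M"
      using main by (auto simp: eventually_at_filter)
    ultimately have "?c * ?B * G 0 powr ?r \<le> ?M"
      by (intro tendsto_upperbound[where F = "at_right 0"]) auto
    then show ?thesis unfolding G0 .
  qed
qed

section \<open>From local to global supporting lines\<close>

text \<open>If the difference \<open>j\<close> of \<open>k\<close> and its chord had a positive maximum, its derivative would vanish at the
leftmost maximizer \<open>z\<close>, so the local supporting line there would be horizontal, and points slightly to
the left of \<open>z\<close> would be maximizers too.\<close>

lemma local_support_imp_below_chord:
  fixes k k' :: "real \<Rightarrow> real"
  assumes der: "\<And>t. t \<in> {0..1} \<Longrightarrow> (k has_real_derivative k' t) (at t)"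
    and loc: "\<And>t. t \<in> {0..1} \<Longrightarrow> \<forall>\<^sub>F s in at t. k t + k' t * (s - t) \<le> k s"
    and t: "t \<in> {0..1}"
  shows "k t \<le> (1 - t) * k 0 + t * k 1"
proof (rule ccontr)
  assume neg: "\<not> ?thesis"
  define j where "j = (\<lambda>t. k t - ((1 - t) * k 0 + t * k 1))"
  have dj: "(j has_real_derivative (k' t - (k 1 - k 0))) (at t)" if "t \<in> {0..1}" for t
    unfolding j_def using der[OF that] by (auto intro!: derivative_eq_intros simp: algebra_simps)
  have cont: "continuous_on {0..1} j"
    using dj by (meson DERIV_isCont continuous_at_imp_continuous_on)
  have "\<exists>m\<in>{0..1}. \<forall>s\<in>{0..1}. j s \<le> j m"
    using cont by (intro continuous_attains_sup) auto
  then obtain m where m: "m \<in> {0..1}" "\<And>s. s \<in> {0..1} \<Longrightarrow> j s \<le> j m" by blast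
  define Z where "Z = {s \<in> {0..1}. j s = j m}"
  have "closed Z" unfolding Z_def using cont by (intro continuous_closed_preimage_constant) auto
  moreover have "m \<in> Z" using m by (simp add: Z_def)
  moreover have bdd: "bdd_below Z" by (rule bdd_belowI[of _ 0]) (auto simp: Z_def)
  ultimately have Inf: "Inf Z \<in> Z" by (intro closed_contains_Inf) auto
  define z where "z = Inf Z"
  have z: "z \<in> {0..1}" "j z = j m" using Inf by (auto simp: z_def Z_def)
  have "j z > 0" using neg m(2)[OF t] z(2) by (simp add: j_def)
  then have "z \<noteq> 0" "z \<noteq> 1" by (auto simp: j_def)
  with z have z01: "0 < z" "z < 1" by auto
  have d0: "k' z - (k 1 - k 0) = 0"
  proof (rule DERIV_local_max[OF dj[OF z(1)]])
    show "0 < min z (1 - z)" using z01 by simp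
    show "\<forall>y. \<bar>z - y\<bar> < min z (1 - z) \<longrightarrow> j y \<le> j z" using m(2) z by (auto simp: abs_if split: if_splits)
  qed
  have "\<forall>\<^sub>F s in at z. j z \<le> j s"
    using loc[OF z(1)]
  proof eventually_elim
    case (elim s)
    have "k' z = k 1 - k 0" using d0 by simp
    with elim show ?case by (simp add: j_def algebra_simps)
  qed
  then obtain d where d: "d > 0" "\<And>s. s \<noteq> z \<Longrightarrow> dist s z < d \<Longrightarrow> j z \<le> j s"
    unfolding eventually_at by auto
  \<comment> \<open>A point strictly between 0 and \<open>z\<close>, in reach of the local supporting line.\<close>
  define s where "s = z - min (d / 2) (z / 2)"
  have s: "s < z" "0 < s" "dist s z < d" using d(1) z01 by (auto simp: s_def dist_real_def min_def)
  then have "j z \<le> j s" by (intro d(2)) auto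
  then have "s \<in> Z" using m(2)[of s] s z z01 by (auto simp: Z_def)
  then have "z \<le> s" unfolding z_def using bdd by (rule cInf_lower)
  with s show False by simp
qed

lemma local_support_imp_above_tangent:
  fixes k k' :: "real \<Rightarrow> real"
  assumes der: "\<And>t. t \<in> {0..1} \<Longrightarrow> (k has_real_derivative k' t) (at t)"
    and loc: "\<And>t. t \<in> {0..1} \<Longrightarrow> \<forall>\<^sub>F s in at t. k t + k' t * (s - t) \<le> k s"
  shows "k 0 + k' 0 \<le> k 1"
proof -
  have "((\<lambda>t. (k t - k 0) / (t - 0)) \<longlongrightarrow> k' 0) (at 0)"
    using der[of 0] by (simp add: has_field_derivative_iff)
  then have "((\<lambda>t. (k t - k 0) / (t - 0)) \<longlongrightarrow> k' 0) (at_right 0)"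
    by (rule tendsto_mono[OF at_le, rotated]) simp
  moreover have "\<forall>\<^sub>F t in at_right 0. (k t - k 0) / (t - 0) \<le> k 1 - k 0"
  proof -
    have "(k t - k 0) / (t - 0) \<le> k 1 - k 0" if "0 < t" "t < 1" for t
    proof -
      have "k t \<le> (1 - t) * k 0 + t * k 1"
        using that by (intro local_support_imp_below_chord[OF der loc]) auto
      then have "k t - k 0 \<le> (k 1 - k 0) * t" by (simp add: algebra_simps)
      then show ?thesis using that by (simp add: pos_divide_le_eq)
    qed
    then show ?thesis unfolding eventually_at_right_field by (intro exI[of _ 1]) auto
  qed
  ultimately have "k' 0 \<le> k 1 - k 0" by (intro tendsto_upperbound[where F = "at_right 0"]) auto
  then show ?thesis by simp
qed

section \<open>Schatten norms of linear families of self-adjoint operators\<close>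

text \<open>A linear, injective parametrization of self-adjoint operators. Its instances are diagonal operators
for vectors and symmetric dilations for rectangular matrices.\<close>

locale selfadj_family =
  fixes J :: "'v::euclidean_space \<Rightarrow> 'a::euclidean_space \<Rightarrow> 'a" and p :: real
  assumes selfadj_J: "selfadj (J x)"
    and J_add: "J (x + y) v = J x v + J y v"
    and J_scale: "J (c *\<^sub>R x) v = c *\<^sub>R J x v"
    and J_faithful: "(\<And>v. J x v = 0) \<Longrightarrow> x = 0"
    and p: "1 < p" "p \<le> 2"
begin

definition basis :: "'v \<Rightarrow> 'a set" where
  "basis x = (SOME E. eigbasis (J x) E)"

definition F :: "'v \<Rightarrow> real" where
  "F x = (\<Sum>e\<in>basis x. \<bar>e \<bullet> J x e\<bar> powr p)"

definition DF :: "'v \<Rightarrow> 'v \<Rightarrow> real" where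
  "DF x h = (\<Sum>e\<in>basis x. dpow p (e \<bullet> J x e) * (e \<bullet> J h e))"

lemma basis: "eigbasis (J x) (basis x)"
  unfolding basis_def using selfadj_eigbasis_exists[OF selfadj_J] by (rule someI_ex)

lemma F_eq: "eigbasis (J x) E \<Longrightarrow> F x = (\<Sum>e\<in>E. \<bar>e \<bullet> J x e\<bar> powr p)"
  unfolding F_def by (rule trace_fun_unique[OF selfadj_J basis])

lemma J_diff: "J (x - y) v = J x v - J y v"
  using J_add[of "x - y" y v] by simp

lemma J_zero: "J 0 v = 0" using J_diff[of 0 0 v] by simp

lemma F_nonneg: "F x \<ge> 0" unfolding F_def by (intro sum_nonneg) auto

lemma F_scale: "F (c *\<^sub>R x) = \<bar>c\<bar> powr p * F x"
proof -
  have "eigbasis (J (c *\<^sub>R x)) (basis x)"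
    using basis[of x] unfolding eigbasis_def J_scale
    by (metis inner_scaleR_right scaleR_scaleR)
  then show ?thesis unfolding F_def[of x]
    by (subst F_eq, assumption) (simp add: J_scale abs_mult powr_mult sum_distrib_left)
qed

lemma F_zero [simp]: "F 0 = 0" unfolding F_def by (simp add: J_zero)

lemma F_eq_0_iff: "F x = 0 \<longleftrightarrow> x = 0"
proof
  assume "F x = 0"
  then have 0: "\<forall>e\<in>basis x. e \<bullet> J x e = 0"
    unfolding F_def using onb_finite[OF eigbasis_onb[OF basis]] by (subst (asm) sum_nonneg_eq_0_iff) auto
  have "J x v \<bullet> J x v = 0" for v
    unfolding eigbasis_expand[OF selfadj_J basis, where y = v] using 0 by simp
  then show "x = 0" by (intro J_faithful) simp
qed simp

lemma F_pos_iff: "F x > 0 \<longleftrightarrow> x \<noteq> 0"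
  using F_eq_0_iff[of x] F_nonneg[of x] by linarith

lemma DF_add: "DF x (h + h') = DF x h + DF x h'"
  by (simp add: DF_def J_add inner_add_right distrib_left sum.distrib)

lemma DF_scale: "DF x (c *\<^sub>R h) = c * DF x h"
  by (simp add: DF_def J_scale sum_distrib_left mult_ac)

lemma bounded_linear_DF: "bounded_linear (DF x)"
  by (intro linear_conv_bounded_linear[THEN iffD1] linearI) (auto simp: DF_add DF_scale)

lemma bregman_expansion:
  "F y - F x - DF x (y - x) = (\<Sum>e\<in>basis x. \<Sum>e'\<in>basis y. (e \<bullet> e')\<^sup>2 *
     (\<bar>e' \<bullet> J y e'\<bar> powr p - \<bar>e \<bullet> J x e\<bar> powr p - dpow p (e \<bullet> J x e) * (e' \<bullet> J y e' - e \<bullet> J x e)))"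
  using trace_bregman_expansion[OF selfadj_J basis selfadj_J basis,
      where \<phi> = "\<lambda>t. \<bar>t\<bar> powr p" and \<psi> = "dpow p", of y x]
  by (simp add: F_def DF_def J_diff)

lemma F_above_tangent: "F x + DF x (y - x) \<le> F y"
proof -
  have "0 \<le> F y - F x - DF x (y - x)"
    unfolding bregman_expansion
  proof (intro sum_nonneg mult_nonneg_nonneg)
    fix e e'
    show "0 \<le> \<bar>e' \<bullet> J y e'\<bar> powr p - \<bar>e \<bullet> J x e\<bar> powr p - dpow p (e \<bullet> J x e) * (e' \<bullet> J y e' - e \<bullet> J x e)"
      using abs_powr_tangent[OF p(1), of "e \<bullet> J x e" "e' \<bullet> J y e'"] by simp
  qed auto
  then show ?thesis by simp
qed

text \<open>By convexity in both directions the scalar Bregman distance is at most the product of the increments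
of the derivative and of the argument, which is of order \<open>\<bar>m - l\<bar> powr p\<close>. The weight \<open>c\<^sup>2\<close> is at most
\<open>\<bar>c\<bar> powr p\<close> because \<open>p \<le> 2\<close>, so each term is bounded by a power of an entry of \<open>J (y - x)\<close>.\<close>

lemma bregman_upper_bound:
  obtains C where "C \<ge> 0" "\<And>x y. F y - F x - DF x (y - x) \<le> C * norm (y - x) powr p"
proof -
  have lin: "linear (J x)" for x using selfadj_J by (simp add: selfadj_def)
  have "bilinear J" unfolding bilinear_def using lin by (auto intro!: linearI simp: J_add J_scale)
  then obtain K where K: "K > 0" "\<And>x v. norm (J x v) \<le> K * norm x * norm v"
    using bilinear_bounded_pos by blast
  define C where "C = real DIM('a) * (real DIM('a) * (2 * p * K powr p))"
  have "F y - F x - DF x (y - x) \<le> C * norm (y - x) powr p" for x y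
  proof -
    let ?N = "2 * p * K powr p * norm (y - x) powr p"
    have t: "(e \<bullet> e')\<^sup>2 * (\<bar>e' \<bullet> J y e'\<bar> powr p - \<bar>e \<bullet> J x e\<bar> powr p - dpow p (e \<bullet> J x e) * (e' \<bullet> J y e' - e \<bullet> J x e))
      \<le> ?N" if e: "e \<in> basis x" "e' \<in> basis y" for e e'
    proof -
      define l where "l = e \<bullet> J x e"
      define m where "m = e' \<bullet> J y e'"
      define c where "c = e \<bullet> e'"
      have ne: "norm e = 1" "norm e' = 1" using e eigbasis_norm basis by auto
      have c1: "\<bar>c\<bar> \<le> 1" unfolding c_def using Cauchy_Schwarz_ineq2[of e e'] ne by simp
      have cross: "e' \<bullet> J (y - x) e = (m - l) * c"
        unfolding J_diff m_def l_def c_def by (rule cross_matrix_entry[OF selfadj_J selfadj_J basis basis e])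
      have "\<bar>m\<bar> powr p - \<bar>l\<bar> powr p - dpow p l * (m - l) \<le> (dpow p m - dpow p l) * (m - l)"
        using abs_powr_tangent[OF p(1), of m l] by (simp add: algebra_simps)
      also have "\<dots> \<le> \<bar>dpow p m - dpow p l\<bar> * \<bar>m - l\<bar>" by (simp add: abs_mult[symmetric])
      also have "\<dots> \<le> 2 * p * \<bar>m - l\<bar> powr (p - 1) * \<bar>m - l\<bar>"
        by (intro mult_right_mono dpow_holder p) auto
      also have "\<dots> = 2 * p * \<bar>m - l\<bar> powr p"
        using powr_mult_base[of "\<bar>m - l\<bar>" "p - 1"] by (simp add: mult.commute mult.left_commute)
      finally have "c\<^sup>2 * (\<bar>m\<bar> powr p - \<bar>l\<bar> powr p - dpow p l * (m - l)) \<le> c\<^sup>2 * (2 * p * \<bar>m - l\<bar> powr p)"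
        by (intro mult_left_mono) auto
      also have "\<dots> \<le> \<bar>c\<bar> powr p * (2 * p * \<bar>m - l\<bar> powr p)"
      proof (intro mult_right_mono)
        show "c\<^sup>2 \<le> \<bar>c\<bar> powr p"
        proof (cases "c = 0")
          case False
          then have "c\<^sup>2 = \<bar>c\<bar> powr 2" by simp
          also have "\<dots> \<le> \<bar>c\<bar> powr p" using False c1 p by (intro powr_mono') auto
          finally show ?thesis .
        qed simp
      qed (use p in auto)
      also have "\<dots> = 2 * p * \<bar>e' \<bullet> J (y - x) e\<bar> powr p"
        unfolding cross abs_mult powr_mult by (simp only: mult_ac)
      also have "\<dots> \<le> 2 * p * (K * norm (y - x)) powr p"
      proof (intro mult_left_mono powr_mono2)
        have "\<bar>e' \<bullet> J (y - x) e\<bar> \<le> norm e' * norm (J (y - x) e)" by (rule Cauchy_Schwarz_ineq2)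
        also have "\<dots> \<le> K * norm (y - x)" using K(2)[of "y - x" e] ne by simp
        finally show "\<bar>e' \<bullet> J (y - x) e\<bar> \<le> K * norm (y - x)" .
      qed (use p in auto)
      also have "\<dots> = ?N" by (simp add: powr_mult)
      finally show ?thesis unfolding l_def m_def c_def .
    qed
    have "F y - F x - DF x (y - x) \<le> (\<Sum>e\<in>basis x. \<Sum>e'\<in>basis y. ?N)"
      unfolding bregman_expansion by (intro sum_mono t)
    also have "\<dots> = C * norm (y - x) powr p"
      using onb_card[OF eigbasis_onb[OF basis[of x]]] onb_card[OF eigbasis_onb[OF basis[of y]]]
      by (simp add: C_def)
    finally show ?thesis .
  qed
  moreover have "C \<ge> 0" unfolding C_def using p by simp
  ultimately show ?thesis using that by blast
qed

lemma F_has_derivative: "(F has_derivative DF x) (at x)"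
proof -
  obtain C where C: "C \<ge> 0" "\<And>x y. F y - F x - DF x (y - x) \<le> C * norm (y - x) powr p"
    using bregman_upper_bound by blast
  have "((\<lambda>y. norm (F y - F x - DF x (y - x)) / norm (y - x)) \<longlongrightarrow> 0) (at x)"
  proof (rule Lim_null_comparison)
    show "\<forall>\<^sub>F y in at x. norm (norm (F y - F x - DF x (y - x)) / norm (y - x)) \<le> C * norm (y - x) powr (p - 1)"
      unfolding eventually_at_filter
    proof (intro always_eventually allI impI)
      fix y assume "y \<noteq> x"
      then have n: "norm (y - x) > 0" by simp
      have "\<bar>F y - F x - DF x (y - x)\<bar> \<le> C * norm (y - x) powr p"
        using C(2)[of y x] F_above_tangent[of x y] by simp
      also have "\<dots> = C * norm (y - x) powr (p - 1) * norm (y - x)"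
        using powr_mult_base[of "norm (y - x)" "p - 1"] n by (simp add: mult.commute)
      finally show "norm (norm (F y - F x - DF x (y - x)) / norm (y - x)) \<le> C * norm (y - x) powr (p - 1)"
        using n by (simp add: pos_divide_le_eq)
    qed
    have "((\<lambda>y. C * norm (y - x) powr (p - 1)) \<longlongrightarrow> C * norm (x - x) powr (p - 1)) (at x)"
      using p by (intro tendsto_intros tendsto_powr2) auto
    then show "((\<lambda>y. C * norm (y - x) powr (p - 1)) \<longlongrightarrow> 0) (at x)" by simp
  qed
  then show ?thesis
    unfolding has_derivative_iff_norm using bounded_linear_DF by simp
qed

lemma DF_strongly_monotone:
  "p * (p - 1) * F (y - x) powr (2 / p) * ((F y + F x) / 2) powr (- ((2 - p) / p))
     \<le> DF y (y - x) - DF x (y - x)"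
proof -
  have "eigbasis (\<lambda>v. J y v - J x v) (basis (y - x))" using basis[of "y - x"] by (simp add: J_diff[abs_def])
  from trace_powr_strongly_monotone[OF p selfadj_J basis selfadj_J basis this]
  show ?thesis by (simp add: F_def DF_def J_diff)
qed

lemma F_on_segment:
  assumes "0 \<le> t" "t \<le> 1"
  shows "F (x + t *\<^sub>R (y - x)) \<le> max (F x) (F y)"
proof -
  let ?z = "x + t *\<^sub>R (y - x)"
  have "x - ?z = (- t) *\<^sub>R (y - x)" "y - ?z = (1 - t) *\<^sub>R (y - x)" by (simp_all add: algebra_simps)
  then have "F ?z - t * DF ?z (y - x) \<le> F x" "F ?z + (1 - t) * DF ?z (y - x) \<le> F y"
    using F_above_tangent[of ?z x] F_above_tangent[of ?z y] by (simp_all only: DF_scale)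
  then have "(1 - t) * (F ?z - t * DF ?z (y - x)) \<le> (1 - t) * F x"
    "t * (F ?z + (1 - t) * DF ?z (y - x)) \<le> t * F y"
    using assms by (auto intro!: mult_left_mono)
  then have "F ?z \<le> (1 - t) * F x + t * F y" by (simp add: algebra_simps)
  also have "\<dots> \<le> (1 - t) * max (F x) (F y) + t * max (F x) (F y)"
    using assms by (intro add_mono mult_left_mono) auto
  finally show ?thesis by (simp add: algebra_simps)
qed

lemma F_powr_scale: "F (c *\<^sub>R h) powr (2 / p) = c\<^sup>2 * F h powr (2 / p)"
proof -
  have "(\<bar>c\<bar> powr p) powr (2 / p) = c\<^sup>2"
    using p by (cases "c = 0") (simp_all add: powr_powr)
  then show ?thesis by (simp add: F_scale powr_mult)
qed

text \<open>Integration of the monotonicity estimate along the segment. Convexity bounds \<open>F\<close> there by its values at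
the endpoints, and \<open>x \<noteq> 0\<close> keeps the base of the negative power positive.\<close>

lemma bregman_lower_bound:
  assumes "x \<noteq> 0"
  shows "p * (p - 1) / 2 * F (y - x) powr (2 / p) * (max (F x) (F y)) powr (- ((2 - p) / p))
    \<le> F y - F x - DF x (y - x)"
proof -
  define h where "h = y - x"
  define M where "M = max (F x) (F y)"
  define c where "c = p * (p - 1) * F h powr (2 / p) * M powr (- ((2 - p) / p))"
  define k where "k = (\<lambda>t. F (x + t *\<^sub>R h) - t * DF x h - c / 2 * t\<^sup>2)"
  have Fx: "F x > 0" using assms F_pos_iff by simp
  have "k 0 \<le> k 1"
  proof (rule DERIV_nonneg_imp_nondecreasing[where f = k and a = 0 and b = 1])
    fix t :: real assume t: "0 \<le> t" "t \<le> 1"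
    let ?z = "x + t *\<^sub>R h"
    have 1: "((\<lambda>t. F (x + t *\<^sub>R h)) has_real_derivative DF ?z h) (at t)"
    proof -
      have "((\<lambda>t. F (x + t *\<^sub>R h)) has_derivative (\<lambda>s. DF ?z (s *\<^sub>R h))) (at t)"
        by (rule has_derivative_compose[OF _ F_has_derivative]) (auto intro!: derivative_eq_intros)
      then show ?thesis unfolding DF_scale has_field_derivative_def by (simp add: mult_commute_abs)
    qed
    have 2: "((\<lambda>t::real. t\<^sup>2) has_real_derivative 2 * t) (at t)" by (auto intro!: derivative_eq_intros)
    have "(k has_real_derivative DF ?z h - 1 * DF x h - c / 2 * (2 * t)) (at t)"
      unfolding k_def by (rule DERIV_diff[OF DERIV_diff[OF 1 DERIV_cmult_right[OF DERIV_ident]] DERIV_cmult[OF 2]])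
    moreover have "0 \<le> DF ?z h - 1 * DF x h - c / 2 * (2 * t)"
    proof (cases "t = 0")
      case False
      have "p * (p - 1) * F (?z - x) powr (2 / p) * ((F ?z + F x) / 2) powr (- ((2 - p) / p))
        \<le> DF ?z (?z - x) - DF x (?z - x)" by (rule DF_strongly_monotone)
      moreover have "?z - x = t *\<^sub>R h" by simp
      ultimately have "t\<^sup>2 * (p * (p - 1) * F h powr (2 / p) * ((F ?z + F x) / 2) powr (- ((2 - p) / p)))
        \<le> t * (DF ?z h - DF x h)"
        by (simp only: DF_scale F_powr_scale right_diff_distrib mult_ac)
      moreover have "c \<le> p * (p - 1) * F h powr (2 / p) * ((F ?z + F x) / 2) powr (- ((2 - p) / p))"
        unfolding c_def
      proof (intro mult_left_mono powr_mono2')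
        have "F ?z \<le> M" unfolding M_def h_def by (rule F_on_segment[OF t])
        moreover have "F x \<le> M" unfolding M_def by simp
        ultimately have "F ?z + F x \<le> M + M" by (rule add_mono)
        then show "(F ?z + F x) / 2 \<le> M" by simp
        show "0 < (F ?z + F x) / 2" using add_nonneg_pos[OF F_nonneg[of ?z] Fx] by simp
      qed (use p in auto)
      then have "t\<^sup>2 * c \<le> t\<^sup>2 * (p * (p - 1) * F h powr (2 / p) * ((F ?z + F x) / 2) powr (- ((2 - p) / p)))"
        by (intro mult_left_mono) auto
      ultimately have "t * (t * c) \<le> t * (DF ?z h - DF x h)" by (simp add: power2_eq_square mult.assoc)
      then have "t * c \<le> DF ?z h - DF x h" using t False by simp
      then show ?thesis by (simp add: mult.commute)
    qed simp
    ultimately show "\<exists>d. (k has_real_derivative d) (at t) \<and> 0 \<le> d" by blast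
  qed simp
  then have "c / 2 \<le> F y - F x - DF x h" by (simp add: k_def h_def)
  then show ?thesis unfolding c_def M_def h_def by simp
qed

end

context selfadj_family
begin

text \<open>Half the squared Schatten norm of \<open>J x\<close>.\<close>

definition Phi :: "'v \<Rightarrow> real" where
  "Phi x = F x powr (2 / p) / 2"

definition DPhi :: "'v \<Rightarrow> 'v \<Rightarrow> real" where
  "DPhi x h = F x powr (2 / p - 1) / p * DF x h"

lemma bounded_linear_DPhi: "bounded_linear (DPhi x)"
  unfolding DPhi_def by (intro bounded_linear_mult_right[THEN bounded_linear_compose] bounded_linear_DF)

lemma DPhi_scale: "DPhi x (c *\<^sub>R h) = c * DPhi x h"
  by (simp add: DPhi_def DF_scale)

lemma DPhi_0: "DPhi 0 h = 0" by (simp add: DPhi_def)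

lemma Phi_0: "Phi 0 = 0" by (simp add: Phi_def)

lemma Phi_nonneg: "Phi x \<ge> 0" by (simp add: Phi_def)

text \<open>Away from 0 by the chain rule; at 0 because \<open>Phi\<close> is bounded by a multiple of the squared norm.\<close>

lemma Phi_has_derivative: "(Phi has_derivative DPhi x) (at x)"
proof (cases "x = 0")
  case False
  then have Fx: "F x > 0" using F_pos_iff by simp
  have d: "((\<lambda>u. u powr (2 / p) / 2) has_real_derivative (2 / p * F x powr (2 / p - 1)) / 2) (at (F x))"
    by (intro DERIV_cdivide has_real_derivative_powr Fx)
  have "((\<lambda>y. F y powr (2 / p) / 2) has_derivative (\<lambda>h. DF x h * ((2 / p * F x powr (2 / p - 1)) / 2))) (at x)"
    using has_derivative_compose[OF F_has_derivative, of "\<lambda>u. u powr (2 / p) / 2", OF d[unfolded has_field_derivative_def]]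
    by (simp only: mult.commute)
  moreover have "(\<lambda>h. DF x h * ((2 / p * F x powr (2 / p - 1)) / 2)) = DPhi x"
    by (simp add: DPhi_def fun_eq_iff)
  moreover have "(\<lambda>y. F y powr (2 / p) / 2) = Phi" by (simp add: Phi_def fun_eq_iff)
  ultimately show ?thesis by simp
next
  case True
  obtain C where C: "C \<ge> 0" "\<And>x y. F y - F x - DF x (y - x) \<le> C * norm (y - x) powr p"
    using bregman_upper_bound by blast
  have DF0: "DF 0 h = 0" for h unfolding DF_def by (simp add: J_zero dpow_def)
  have le: "Phi y \<le> C powr (2 / p) / 2 * norm y * norm y" for y
  proof -
    have "F y \<le> C * norm y powr p" using C(2)[of y 0] by (simp add: DF0)
    then have "F y powr (2 / p) \<le> (C * norm y powr p) powr (2 / p)"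
      using p F_nonneg by (intro powr_mono2) auto
    also have "\<dots> = C powr (2 / p) * (norm y * norm y)"
      using p by (cases "y = 0") (simp_all add: powr_mult powr_powr power2_eq_square)
    finally show ?thesis by (simp add: Phi_def mult.assoc)
  qed
  have "((\<lambda>y. norm (Phi y - Phi 0 - DPhi 0 (y - 0)) / norm (y - 0)) \<longlongrightarrow> 0) (at 0)"
  proof (rule Lim_null_comparison)
    show "\<forall>\<^sub>F y in at 0. norm (norm (Phi y - Phi 0 - DPhi 0 (y - 0)) / norm (y - 0)) \<le> C powr (2 / p) / 2 * norm y"
      unfolding eventually_at_filter
    proof (intro always_eventually allI impI)
      fix y :: 'v assume "y \<noteq> 0"
      then have n: "norm y > 0" by simp
      then show "norm (norm (Phi y - Phi 0 - DPhi 0 (y - 0)) / norm (y - 0)) \<le> C powr (2 / p) / 2 * norm y"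
        using le[of y] Phi_nonneg[of y] by (simp add: Phi_0 DPhi_0 pos_divide_le_eq)
    qed
    show "((\<lambda>y. C powr (2 / p) / 2 * norm y) \<longlongrightarrow> 0) (at (0::'v))"
      by (intro tendsto_mult_right_zero tendsto_norm_zero tendsto_ident_at)
  qed
  then show ?thesis
    unfolding True has_derivative_iff_norm using bounded_linear_DPhi by simp
qed

text \<open>As \<open>2 / p \<ge> 1\<close>, the outer power is convex, so its tangent at \<open>F x\<close> passes the lower bound for the Bregman
distance of \<open>F\<close> on to \<open>Phi\<close>. The powers of \<open>F\<close> cancel up to a factor that tends to 1 as \<open>y\<close> approaches \<open>x\<close>.\<close>

lemma Phi_local_strong_convexity:
  assumes "x \<noteq> 0"
  shows "Phi x + DPhi x (y - x) + (p - 1) / 2 * F (y - x) powr (2 / p) * (F x / max (F x) (F y)) powr (2 / p - 1)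
    \<le> Phi y"
proof -
  have Fx: "F x > 0" using assms F_pos_iff by simp
  define M where "M = max (F x) (F y)"
  have M: "M > 0" unfolding M_def using Fx by (simp add: less_max_iff_disj)
  have r: "- ((2 - p) / p) = - (2 / p - 1)" using p by (simp add: diff_divide_distrib)
  \<comment> \<open>For \<open>p = 2\<close> the power is linear and \<open>abs_powr_tangent\<close> does not apply.\<close>
  have e: "F x powr (2 / p) = F x * F x powr (2 / p - 1)" using powr_mult_base[of "F x" "2 / p - 1"] Fx by simp
  have "Phi x + F x powr (2 / p - 1) / p * (F y - F x) \<le> Phi y"
  proof (cases "p = 2")
    case True
    then show ?thesis unfolding Phi_def using Fx F_nonneg[of y] by (simp add: diff_divide_distrib)
  next
    case False
    then have q: "1 < 2 / p" using p by simp
    have "\<bar>F x\<bar> powr (2 / p) + dpow (2 / p) (F x) * (F y - F x) \<le> \<bar>F y\<bar> powr (2 / p)"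
      by (rule abs_powr_tangent[OF q])
    moreover have "dpow (2 / p) (F x) * (F y - F x) = 2 * (F x powr (2 / p - 1) / p * (F y - F x))"
      using Fx by (simp add: dpow_def)
    ultimately show ?thesis using Fx F_nonneg[of y] by (simp add: Phi_def mult_ac)
  qed
  moreover have "F x powr (2 / p - 1) / p * (p * (p - 1) / 2 * F (y - x) powr (2 / p) * M powr (- (2 / p - 1)))
    \<le> F x powr (2 / p - 1) / p * (F y - F x - DF x (y - x))"
    using bregman_lower_bound[OF assms, of y] p unfolding M_def r by (intro mult_left_mono) auto
  moreover have "F x powr (2 / p - 1) / p * (p * (p - 1) / 2 * F (y - x) powr (2 / p) * M powr (- (2 / p - 1)))
    = (p - 1) / 2 * F (y - x) powr (2 / p) * (F x / M) powr (2 / p - 1)"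
  proof -
    have "(F x / M) powr (2 / p - 1) = F x powr (2 / p - 1) * M powr (- (2 / p - 1))"
      unfolding powr_minus divide_inverse[of "F x powr _", symmetric] by (rule powr_divide)
    moreover have "a / p * (p * (p - 1) / 2 * b * c) = (p - 1) / 2 * b * (a * c)" for a b c :: real
      using p by simp
    ultimately show ?thesis by simp
  qed
  ultimately show ?thesis unfolding DPhi_def M_def[symmetric] right_diff_distrib by linarith
qed

lemma Phi_eventually_strongly_convex:
  assumes c: "c < (p - 1) / 2"
  shows "\<forall>\<^sub>F y in nhds x. Phi x + DPhi x (y - x) + c * F (y - x) powr (2 / p) \<le> Phi y"
proof (cases "x = 0")
  case True
  have "c * F y powr (2 / p) \<le> Phi y" for y
  proof -
    have "c * F y powr (2 / p) \<le> 1 / 2 * F y powr (2 / p)" using c p by (intro mult_right_mono) auto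
    then show ?thesis by (simp add: Phi_def)
  qed
  then show ?thesis by (simp add: True DPhi_0 Phi_0)
next
  case False
  then have Fx: "F x > 0" using F_pos_iff by simp
  have "isCont F x" by (rule has_derivative_continuous[OF F_has_derivative])
  then have "((\<lambda>y. F y) \<longlongrightarrow> F x) (nhds x)" unfolding isCont_def tendsto_at_iff_tendsto_nhds .
  then have "((\<lambda>y. (p - 1) / 2 * (F x / max (F x) (F y)) powr (2 / p - 1)) \<longlongrightarrow>
      (p - 1) / 2 * (F x / max (F x) (F x)) powr (2 / p - 1)) (nhds x)"
    using Fx by (intro tendsto_intros) auto
  moreover have "(p - 1) / 2 * (F x / max (F x) (F x)) powr (2 / p - 1) = (p - 1) / 2" using Fx by simp
  ultimately have "\<forall>\<^sub>F y in nhds x. c < (p - 1) / 2 * (F x / max (F x) (F y)) powr (2 / p - 1)"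
    using c by (simp only: order_tendstoD)
  then show ?thesis
  proof eventually_elim
    case (elim y)
    then have "c * F (y - x) powr (2 / p) \<le> (p - 1) / 2 * (F x / max (F x) (F y)) powr (2 / p - 1) * F (y - x) powr (2 / p)"
      by (intro mult_right_mono) auto
    also have "\<dots> = (p - 1) / 2 * F (y - x) powr (2 / p) * (F x / max (F x) (F y)) powr (2 / p - 1)"
      by (simp only: mult_ac)
    finally show ?case using Phi_local_strong_convexity[OF False, of y] by linarith
  qed
qed

text \<open>After subtraction of a quadratic with a slightly smaller modulus, the restriction of \<open>Phi\<close> to the
segment has local supporting lines, hence lies above its tangent at \<open>x\<close>; then the modulus tends to
\<open>(p - 1) / 2\<close>.\<close>

theorem Phi_strongly_convex:
  "Phi x + DPhi x (y - x) + (p - 1) / 2 * F (y - x) powr (2 / p) \<le> Phi y"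
proof -
  define h where "h = y - x"
  define N where "N = F h powr (2 / p)"
  have *: "Phi x + DPhi x h + c * N \<le> Phi y" if c: "c < (p - 1) / 2" for c
  proof -
    define k where "k = (\<lambda>t. Phi (x + t *\<^sub>R h) - c * N * t\<^sup>2)"
    define k' where "k' = (\<lambda>t. DPhi (x + t *\<^sub>R h) h - c * N * (2 * t))"
    have "k 0 + k' 0 \<le> k 1"
    proof (rule local_support_imp_above_tangent)
      fix t :: real
      let ?z = "x + t *\<^sub>R h"
      have 1: "((\<lambda>t. Phi (x + t *\<^sub>R h)) has_real_derivative DPhi ?z h) (at t)"
      proof -
        have "((\<lambda>t. Phi (x + t *\<^sub>R h)) has_derivative (\<lambda>s. DPhi ?z (s *\<^sub>R h))) (at t)"
          by (rule has_derivative_compose[OF _ Phi_has_derivative]) (auto intro!: derivative_eq_intros)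
        then show ?thesis unfolding DPhi_scale has_field_derivative_def by (simp add: mult_commute_abs)
      qed
      have 2: "((\<lambda>t::real. t\<^sup>2) has_real_derivative 2 * t) (at t)" by (auto intro!: derivative_eq_intros)
      show "(k has_real_derivative k' t) (at t)"
        unfolding k_def k'_def by (rule DERIV_diff[OF 1 DERIV_cmult[OF 2]])
      have "((\<lambda>s. x + s *\<^sub>R h) \<longlongrightarrow> ?z) (at t)" by (intro tendsto_intros)
      then have "\<forall>\<^sub>F s in at t. Phi ?z + DPhi ?z ((x + s *\<^sub>R h) - ?z) + c * F ((x + s *\<^sub>R h) - ?z) powr (2 / p) \<le> Phi (x + s *\<^sub>R h)"
        using Phi_eventually_strongly_convex[OF c, of ?z] unfolding filterlim_iff by blast
      then show "\<forall>\<^sub>F s in at t. k t + k' t * (s - t) \<le> k s"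
      proof eventually_elim
        case (elim s)
        have "(x + s *\<^sub>R h) - ?z = (s - t) *\<^sub>R h" by (simp add: algebra_simps)
        with elim have "Phi ?z + (s - t) * DPhi ?z h + c * ((s - t)\<^sup>2 * N) \<le> Phi (x + s *\<^sub>R h)"
          by (simp only: DPhi_scale F_powr_scale N_def)
        then show ?case by (simp add: k_def k'_def power2_eq_square algebra_simps)
      qed
    qed
    then show ?thesis by (simp add: k_def k'_def h_def)
  qed
  have "((\<lambda>c. Phi x + DPhi x h + c * N) \<longlongrightarrow> Phi x + DPhi x h + (p - 1) / 2 * N) (at_left ((p - 1) / 2))"
    by (intro tendsto_intros)
  moreover have "\<forall>\<^sub>F c in at_left ((p - 1) / 2). Phi x + DPhi x h + c * N \<le> Phi y"
    unfolding eventually_at_filter using * by (intro always_eventually) auto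
  ultimately have "Phi x + DPhi x h + (p - 1) / 2 * N \<le> Phi y"
    by (intro tendsto_upperbound[where F = "at_left ((p - 1) / 2)"]) auto
  then show ?thesis by (simp add: N_def h_def)
qed

text \<open>By homogeneity it suffices to bound \<open>F\<close> away from 0 on the unit sphere, which is compact.\<close>

lemma F_powr_lower_bound: "\<exists>c>0. \<forall>x. c * norm x \<le> F x powr (1 / p)"
proof -
  have cont: "continuous_on (sphere 0 1) F"
    by (intro continuous_at_imp_continuous_on ballI has_derivative_continuous[OF F_has_derivative])
  obtain b :: 'v where "b \<in> Basis" using nonempty_Basis by blast
  then have "b \<in> sphere 0 1" by simp
  then have "\<exists>m\<in>sphere 0 1. \<forall>y\<in>sphere 0 1. F m \<le> F y"
    by (intro continuous_attains_inf cont compact_sphere) blast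
  then obtain m where m: "norm m = 1" "\<And>y. norm y = 1 \<Longrightarrow> F m \<le> F y" by auto
  have Fm: "F m > 0" using m(1) F_pos_iff[of m] by fastforce
  have "F m powr (1 / p) * norm x \<le> F x powr (1 / p)" for x
  proof (cases "x = 0")
    case False
    define u where "u = inverse (norm x) *\<^sub>R x"
    have "norm u = 1" using False by (simp add: u_def)
    then have "F m powr (1 / p) \<le> F u powr (1 / p)" using p Fm m(2) by (intro powr_mono2) auto
    moreover have "x = norm x *\<^sub>R u" using False by (simp add: u_def)
    then have "F x = norm x powr p * F u" using F_scale[of "norm x" u] by simp
    then have "F x powr (1 / p) = norm x * F u powr (1 / p)"
      using p False by (simp add: powr_mult powr_powr)
    ultimately show ?thesis by (simp add: mult.commute mult_left_mono)
  qed simp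
  then show ?thesis using Fm by (intro exI[of _ "F m powr (1 / p)"]) auto
qed

end

section \<open>Mirror descent\<close>

text \<open>A hyperplane separates \<open>(x, f x)\<close> from the strict epigraph of \<open>f\<close> over \<open>V\<close>. Choosing its normal parallel
to the affine hull of these sets puts the slope into \<open>V\<close>. The hyperplane cannot be vertical, because
\<open>V\<close> extends from \<open>x\<close> in the direction opposite to the normal.\<close>

lemma subgradient_exists:
  fixes V :: "'v::euclidean_space set"
  assumes V: "subspace V" and f: "convex_on V f" and x: "x \<in> V"
  shows "subdifferential V f x \<noteq> {}"
proof -
  define S where "S = {(y, r). y \<in> V \<and> f y < r}"
  have conv: "convex S"
  proof (rule convexI)
    fix a b :: "'v \<times> real" and u v :: real
    assume a: "a \<in> S" and b: "b \<in> S" and uv: "0 \<le> u" "0 \<le> v" "u + v = 1"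
    obtain a1 a2 b1 b2 where ab: "a = (a1, a2)" "b = (b1, b2)" by (meson surj_pair)
    have *: "a1 \<in> V" "f a1 < a2" "b1 \<in> V" "f b1 < b2" using a b by (auto simp: S_def ab)
    have "f (u *\<^sub>R a1 + v *\<^sub>R b1) \<le> u * f a1 + v * f b1"
      using f uv * by (auto simp: convex_on_def)
    also have "\<dots> < u * a2 + v * b2"
      using uv * by (cases "u = 0") (auto intro!: add_less_le_mono mult_left_mono)
    finally show "u *\<^sub>R a + v *\<^sub>R b \<in> S"
      using * V by (auto simp: S_def ab subspace_add subspace_scale)
  qed
  have ne: "S \<noteq> {}" using x by (auto simp: S_def intro!: exI[of _ x] lt_ex gt_ex)
  have zn: "(x, f x) \<notin> S" by (simp add: S_def)
  obtain a b where ab: "(x, f x) + a \<in> affine hull (insert (x, f x) S)" "a \<noteq> 0" "a \<bullet> (x, f x) \<le> b"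
    "\<And>s. s \<in> S \<Longrightarrow> b \<le> a \<bullet> s"
    using separating_hyperplane_set_point_inaff[OF conv ne zn] by metis
  obtain a1 a2 where a: "a = (a1, a2)" by (meson surj_pair)
  have "affine hull (insert (x, f x) S) \<subseteq> V \<times> UNIV"
    using V x by (intro hull_minimal) (auto simp: S_def intro!: subspace_imp_affine subspace_Times)
  then have "x + a1 \<in> V" using ab(1) a by auto
  then have a1: "a1 \<in> V" using subspace_diff[OF V, of "x + a1" x] x by simp
  have sep: "a1 \<bullet> x + a2 * f x \<le> a1 \<bullet> y + a2 * r" if "y \<in> V" "f y < r" for y r
    using ab(3) ab(4)[of "(y, r)"] that by (simp add: a S_def)
  have sep': "a1 \<bullet> x + a2 * f x \<le> a1 \<bullet> y + a2 * f y" if "y \<in> V" for y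
  proof -
    have "((\<lambda>r. a1 \<bullet> y + a2 * r) \<longlongrightarrow> a1 \<bullet> y + a2 * f y) (at_right (f y))" by (intro tendsto_intros)
    moreover have "\<forall>\<^sub>F r in at_right (f y). a1 \<bullet> x + a2 * f x \<le> a1 \<bullet> y + a2 * r"
      unfolding eventually_at_filter using sep[OF that] by (intro always_eventually) auto
    ultimately show ?thesis by (intro tendsto_lowerbound[where F = "at_right (f y)"]) auto
  qed
  have "a2 \<ge> 0" using sep[OF x, of "f x + 1"] by (simp add: distrib_left)
  moreover have "a2 \<noteq> 0"
  proof
    assume a2: "a2 = 0"
    have "x - a1 \<in> V" using x a1 V by (simp add: subspace_diff)
    from sep'[OF this] have "a1 \<bullet> a1 \<le> 0" by (simp add: a2 inner_diff_right)
    then show False using ab(2) a a2 by (metis inner_gt_zero_iff not_less prod.inject zero_prod_def)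
  qed
  ultimately have a2: "a2 > 0" by simp
  have "(- 1 / a2) *\<^sub>R a1 \<in> subdifferential V f x"
    unfolding subdifferential_def
  proof (intro CollectI conjI ballI)
    show "(- 1 / a2) *\<^sub>R a1 \<in> V" using a1 V by (simp add: subspace_scale subspace_neg)
    fix y assume "y \<in> V"
    have "a2 * f y \<ge> a2 * f x - a1 \<bullet> (y - x)" using sep'[OF \<open>y \<in> V\<close>] by (simp add: inner_diff_right)
    then show "f x + (- 1 / a2) *\<^sub>R a1 \<bullet> (y - x) \<le> f y" using a2 by (simp add: field_simps)
  qed
  then show ?thesis by blast
qed

text \<open>The properties of the norm \<open>N\<close> on which mirror descent depends: half the square of \<open>N\<close> is
differentiable, with derivative \<open>D\<close>, strongly convex with modulus \<open>\<sigma>\<close>, and coercive. They are asked for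
on the whole space, whereas the method runs in the subspace \<open>V\<close>.\<close>

locale mirror_space =
  fixes V :: "'v::euclidean_space set" and N :: "'v \<Rightarrow> real" and D :: "'v \<Rightarrow> 'v \<Rightarrow> real" and \<sigma> :: real
  assumes V: "subspace V" and \<sigma>: "\<sigma> > 0"
    and N_nonneg: "N x \<ge> 0" and N_0: "N 0 = 0" and N_minus: "N (- x) = N x"
    and N_lower: "\<exists>c>0. \<forall>x. c * norm x \<le> N x"
    and deriv: "((\<lambda>x. (N x)\<^sup>2 / 2) has_derivative D x) (at x)"
    and D_0: "D 0 d = 0"
    and strong: "(N x)\<^sup>2 / 2 + D x (y - x) + \<sigma> / 2 * (N (y - x))\<^sup>2 \<le> (N y)\<^sup>2 / 2"
begin

definition h :: "'v \<Rightarrow> 'v \<Rightarrow> real" where "h z = (\<lambda>x. (N (x - z))\<^sup>2 / 2)"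

lemma linear_D: "linear (D x)"
  using has_derivative_bounded_linear[OF deriv] by (rule bounded_linear.linear)

lemma h_deriv: "(h z has_derivative D (x - z)) (at x)"
proof -
  have "((\<lambda>x. x - z) has_derivative (\<lambda>d. d)) (at x)" by (auto intro!: derivative_eq_intros)
  from has_derivative_compose[OF this deriv] show ?thesis by (simp add: h_def)
qed

lemma gradient_in_V: "\<exists>g\<in>V. \<forall>d\<in>V. g \<bullet> d = D w d"
proof -
  define g0 where "g0 = (\<Sum>b\<in>Basis. D w b *\<^sub>R b)"
  have g0: "D w d = g0 \<bullet> d" for d
  proof -
    have "D w d = D w (\<Sum>b\<in>Basis. (d \<bullet> b) *\<^sub>R b)" by (simp add: euclidean_representation)
    also have "\<dots> = (\<Sum>b\<in>Basis. (d \<bullet> b) * D w b)"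
      by (simp add: linear_sum[OF linear_D] linear_scale[OF linear_D])
    also have "\<dots> = g0 \<bullet> d" by (simp add: g0_def inner_sum_left inner_commute[of d] mult.commute)
    finally show ?thesis .
  qed
  obtain g g' where g: "g \<in> span V" "\<And>w. w \<in> span V \<Longrightarrow> orthogonal g' w" "g0 = g + g'"
    using orthogonal_subspace_decomp_exists[of V g0] by metis
  then have "g \<in> V" "\<And>d. d \<in> V \<Longrightarrow> g \<bullet> d = g0 \<bullet> d"
    using V by (auto simp: span_eq_iff[THEN iffD2] inner_add_left orthogonal_def)
  then show ?thesis using g0 by auto
qed

text \<open>The derivative within \<open>V\<close> depends on the functional only through its restriction to \<open>V\<close>, and \<open>V\<close> contains a
line through \<open>x\<close> in each of its directions, which makes the representing vector in \<open>V\<close> unique.\<close>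

lemma grad_on_eq:
  assumes x: "x \<in> V" and g: "g \<in> V" "\<And>d. d \<in> V \<Longrightarrow> g \<bullet> d = D (x - z) d"
  shows "grad_on V (h z) x = g"
proof -
  have gd: "(h z has_derivative (\<lambda>d. g \<bullet> d)) (at x within V)"
  proof -
    have "(h z has_derivative D (x - z)) (at x within V)" by (rule has_derivative_at_withinI[OF h_deriv])
    then have "((\<lambda>y. norm (h z y - h z x - D (x - z) (y - x)) / norm (y - x)) \<longlongrightarrow> 0) (at x within V)"
      by (simp add: has_derivative_iff_norm)
    moreover have "\<forall>\<^sub>F y in at x within V. norm (h z y - h z x - D (x - z) (y - x)) / norm (y - x) =
      norm (h z y - h z x - g \<bullet> (y - x)) / norm (y - x)"
      unfolding eventually_at_filter using g(2) x V by (intro always_eventually) (auto simp: subspace_diff)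
    ultimately have "((\<lambda>y. norm (h z y - h z x - g \<bullet> (y - x)) / norm (y - x)) \<longlongrightarrow> 0) (at x within V)"
      by (rule Lim_transform_eventually)
    then show ?thesis by (simp add: has_derivative_iff_norm bounded_linear_inner_right)
  qed
  show ?thesis unfolding grad_on_def
  proof (rule the_equality)
    show "g \<in> V \<and> (h z has_derivative (\<lambda>d. g \<bullet> d)) (at x within V)" using g gd by simp
    fix g' assume g': "g' \<in> V \<and> (h z has_derivative (\<lambda>d. g' \<bullet> d)) (at x within V)"
    define v where "v = g' - g"
    have vV: "v \<in> V" using g g' V by (simp add: v_def subspace_diff)
    have sub: "range (\<lambda>t. x + t *\<^sub>R v) \<subseteq> V" using x vV V by (auto simp: subspace_add subspace_scale)
    have c: "((\<lambda>t. h z (x + t *\<^sub>R v)) has_derivative (\<lambda>t. k \<bullet> (t *\<^sub>R v))) (at 0)"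
      if k: "(h z has_derivative (\<lambda>d. k \<bullet> d)) (at x within V)" for k
    proof (rule has_derivative_in_compose[where g = "h z" and s = UNIV and f = "\<lambda>t. x + t *\<^sub>R v"])
      show "((\<lambda>t. x + t *\<^sub>R v) has_derivative (\<lambda>t. t *\<^sub>R v)) (at 0)" by (auto intro!: derivative_eq_intros)
      show "(h z has_derivative (\<lambda>d. k \<bullet> d)) (at (x + 0 *\<^sub>R v) within range (\<lambda>t. x + t *\<^sub>R v))"
        using has_derivative_subset[OF k sub] by simp
    qed
    have "(\<lambda>t. g' \<bullet> (t *\<^sub>R v)) = (\<lambda>t. g \<bullet> (t *\<^sub>R v))"
      using c[of g'] c[OF gd] g' by (intro has_derivative_unique) auto
    then have "g' \<bullet> (1 *\<^sub>R v) = g \<bullet> (1 *\<^sub>R v)" by (rule fun_cong)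
    then have "v \<bullet> v = 0" by (simp add: v_def inner_diff_left)
    then show "g' = g" by (simp add: v_def)
  qed
qed

text \<open>The function \<open>\<phi>\<close> is coercive on \<open>V\<close>, so it has a minimizer there, at which its derivative along \<open>V\<close> vanishes.\<close>

lemma gradient_surjective:
  assumes \<theta>: "\<theta> \<in> V"
  shows "\<exists>w\<in>V. \<forall>d\<in>V. D w d = \<theta> \<bullet> d"
proof -
  obtain c where c: "c > 0" "\<And>x. c * norm x \<le> N x" using N_lower by blast
  define \<phi> where "\<phi> = (\<lambda>w. (N w)\<^sup>2 / 2 - \<theta> \<bullet> w)"
  \<comment> \<open>Beyond radius \<open>R\<close>, half of \<open>c\<^sup>2 (norm w)\<^sup>2\<close> exceeds the linear term.\<close>
  define R where "R = 2 * norm \<theta> / c\<^sup>2"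
  have R0: "R \<ge> 0" by (simp add: R_def)
  have d\<phi>: "(\<phi> has_derivative (\<lambda>d. D w d - \<theta> \<bullet> d)) (at w)" for w
    unfolding \<phi>_def by (intro has_derivative_diff deriv has_derivative_inner_right has_derivative_ident)
  have cont: "continuous_on X \<phi>" for X
    by (intro continuous_at_imp_continuous_on ballI has_derivative_continuous[OF d\<phi>])
  have "compact (V \<inter> cball 0 R)" using V by (simp add: closed_Int_compact closed_subspace)
  moreover have zero: "0 \<in> V \<inter> cball 0 R" using V R0 by (simp add: subspace_0)
  ultimately have "\<exists>w\<in>V \<inter> cball 0 R. \<forall>y\<in>V \<inter> cball 0 R. \<phi> w \<le> \<phi> y"
    by (intro continuous_attains_inf cont) auto
  then obtain w where w: "w \<in> V" "\<And>y. y \<in> V \<Longrightarrow> norm y \<le> R \<Longrightarrow> \<phi> w \<le> \<phi> y" by auto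
  have min: "\<phi> w \<le> \<phi> y" if y: "y \<in> V" for y
  proof (cases "norm y \<le> R")
    case False
    then have ny: "norm y > R" by simp
    then have "c\<^sup>2 * norm y \<ge> 2 * norm \<theta>" using c(1) by (simp add: R_def pos_divide_less_eq mult.commute)
    then have "norm y * (c\<^sup>2 * norm y) \<ge> norm y * (2 * norm \<theta>)" by (intro mult_left_mono) auto
    moreover have "(c * norm y)\<^sup>2 \<le> (N y)\<^sup>2" using c by (intro power_mono) auto
    moreover have "\<theta> \<bullet> y \<le> norm \<theta> * norm y" by (rule norm_cauchy_schwarz)
    ultimately have "0 \<le> \<phi> y" by (simp add: \<phi>_def power2_eq_square mult_ac)
    moreover have "\<phi> w \<le> \<phi> 0" using w(2)[of 0] zero by simp
    ultimately show ?thesis by (simp add: \<phi>_def N_0)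
  qed (use w y in auto)
  have "D w d = \<theta> \<bullet> d" if d: "d \<in> V" for d
  proof -
    have "((\<lambda>t. \<phi> (w + t *\<^sub>R d)) has_derivative (\<lambda>t. D w (t *\<^sub>R d) - \<theta> \<bullet> (t *\<^sub>R d))) (at 0)"
      using d\<phi>[of w] by (intro has_derivative_compose[where g = \<phi> and f = "\<lambda>t. w + t *\<^sub>R d"])
        (auto intro!: derivative_eq_intros)
    then have "((\<lambda>t. \<phi> (w + t *\<^sub>R d)) has_real_derivative (D w d - \<theta> \<bullet> d)) (at 0)"
      by (simp add: has_field_derivative_def linear_scale[OF linear_D] right_diff_distrib[symmetric] mult_commute_abs)
    then have "D w d - \<theta> \<bullet> d = 0"
    proof (rule DERIV_local_min[where d = 1])
      show "\<forall>y. \<bar>0 - y\<bar> < 1 \<longrightarrow> \<phi> (w + 0 *\<^sub>R d) \<le> \<phi> (w + y *\<^sub>R d)"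
        using min w(1) d V by (auto simp: subspace_add subspace_scale)
    qed simp
    then show ?thesis by simp
  qed
  then show ?thesis using w(1) by blast
qed

lemma inverse_gradient:
  assumes z: "z \<in> V" and \<theta>: "\<theta> \<in> V"
  defines "y \<equiv> inv_into V (grad_on V (h z)) \<theta>"
  shows "y \<in> V" and "\<And>d. d \<in> V \<Longrightarrow> D (y - z) d = \<theta> \<bullet> d"
proof -
  obtain w where w: "w \<in> V" "\<And>d. d \<in> V \<Longrightarrow> D w d = \<theta> \<bullet> d" using gradient_surjective[OF \<theta>] by blast
  have "z + w \<in> V" using z w V by (simp add: subspace_add)
  moreover have "grad_on V (h z) (z + w) = \<theta>"
    using w calculation by (intro grad_on_eq \<theta>) auto
  ultimately have im: "\<theta> \<in> grad_on V (h z) ` V" by (metis imageI)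
  show yV: "y \<in> V" unfolding y_def by (rule inv_into_into[OF im])
  obtain g where g: "g \<in> V" "\<And>d. d \<in> V \<Longrightarrow> g \<bullet> d = D (y - z) d" using gradient_in_V by blast
  have "grad_on V (h z) y = \<theta>" unfolding y_def by (rule f_inv_into_f[OF im])
  moreover have "grad_on V (h z) y = g" by (rule grad_on_eq[OF yV g])
  ultimately have "g = \<theta>" by simp
  then show "\<And>d. d \<in> V \<Longrightarrow> D (y - z) d = \<theta> \<bullet> d" using g(2) by simp
qed

lemma subgradient_le:
  assumes lip: "lipschitz_wrt V N L f" and y: "y \<in> V" and g: "g \<in> subdifferential V f y" and w: "w \<in> V"
  shows "g \<bullet> w \<le> L * N w"
proof -
  have yw: "y + w \<in> V" using y w V by (simp add: subspace_add)
  have "f y + g \<bullet> w \<le> f (y + w)" using g yw by (auto simp: subdifferential_def)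
  moreover have "\<bar>f (y + w) - f y\<bar> \<le> L * N ((y + w) - y)" using lip y yw unfolding lipschitz_wrt_def by blast
  ultimately show ?thesis by simp
qed

lemma mirror_iterates:
  fixes y \<theta> g :: "nat \<Rightarrow> 'v"
  assumes z: "z \<in> V" and y0: "y 0 = z" and \<theta>0: "\<theta> 0 = 0"
    and step: "\<And>s. s \<in> {1..T} \<Longrightarrow> g s \<in> subdifferential V f (y (s - 1)) \<and>
       \<theta> s = \<theta> (s - 1) - \<eta> *\<^sub>R g s \<and> y s = inv_into V (grad_on V (h z)) (\<theta> s)"
    and s: "s \<le> T"
  shows "y s \<in> V \<and> \<theta> s \<in> V \<and> (\<forall>d\<in>V. D (y s - z) d = \<theta> s \<bullet> d)"
  using s
proof (induction s)
  case 0
  then show ?case using z V by (simp add: y0 \<theta>0 D_0 subspace_0)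
next
  case (Suc s)
  then have s: "Suc s \<in> {1..T}" and IH: "\<theta> s \<in> V" by auto
  have "g (Suc s) \<in> V" using step[OF s] by (simp add: subdifferential_def)
  then have \<theta>V: "\<theta> (Suc s) \<in> V" using step[OF s] IH V by (simp add: subspace_diff subspace_scale)
  show ?case using inverse_gradient[OF z \<theta>V] step[OF s] \<theta>V by metis
qed

text \<open>The potential \<open>B s\<close> is the Bregman distance from the iterate \<open>y s\<close> to \<open>xs\<close>. Each step lowers it by
\<open>\<eta>\<close> times the gap, up to an error that strong convexity bounds by \<open>\<eta>\<^sup>2 L\<^sup>2 / (2 \<sigma>)\<close>; it starts at half the squared
distance and stays nonnegative.\<close>

lemma mirror_bound:
  assumes z: "z \<in> V" and lip: "lipschitz_wrt V N L f" and run: "mirror V (h z) f z T \<eta> x"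
    and \<eta>: "\<eta> > 0" and T: "T > 0" and xs: "xs \<in> V"
  shows "f x - f xs \<le> (N (z - xs))\<^sup>2 / (2 * \<eta> * real T) + \<eta> * L\<^sup>2 / (2 * \<sigma>)"
proof -
  obtain y \<theta> g where y0: "y 0 = z" and \<theta>0: "\<theta> 0 = 0"
    and step: "\<And>s. s \<in> {1..T} \<Longrightarrow> g s \<in> subdifferential V f (y (s - 1)) \<and>
       \<theta> s = \<theta> (s - 1) - \<eta> *\<^sub>R g s \<and> y s = inv_into V (grad_on V (h z)) (\<theta> s)"
    and out: "\<exists>s\<le>T. x = y s \<and> (\<forall>r\<le>T. f (y s) \<le> f (y r))"
    using run unfolding mirror_def by blast
  have best: "f x \<le> f (y r)" if "r \<le> T" for r using out that by blast
  note inv = mirror_iterates[OF z y0 \<theta>0 step]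
  define B where "B s = h z xs - h z (y s) - \<theta> s \<bullet> (xs - y s)" for s
  have breg: "h z a + D (a - z) (b - a) + \<sigma> / 2 * (N (b - a))\<^sup>2 \<le> h z b" for a b
    using strong[of "a - z" "b - z"] by (simp add: h_def)
  have B0: "B 0 = (N (z - xs))\<^sup>2 / 2"
    using N_minus[of "z - xs"] by (simp add: B_def y0 \<theta>0 h_def N_0)
  have BT: "B T \<ge> 0"
  proof -
    have "D (y T - z) (xs - y T) = \<theta> T \<bullet> (xs - y T)" using inv[of T] xs V by (simp add: subspace_diff)
    moreover have "\<sigma> / 2 * (N (xs - y T))\<^sup>2 \<ge> 0" using \<sigma> by simp
    ultimately show ?thesis using breg[of "y T" xs] by (simp add: B_def)
  qed
  have st: "\<eta> * (f (y s) - f xs) \<le> B s - B (Suc s) + \<eta>\<^sup>2 * L\<^sup>2 / (2 * \<sigma>)" if s: "s < T" for s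
  proof -
    have s1: "Suc s \<in> {1..T}" using s by simp
    define G where "G = g (Suc s)"
    have G: "G \<in> subdifferential V f (y s)" and \<theta>S: "\<theta> (Suc s) = \<theta> s - \<eta> *\<^sub>R G"
      using step[OF s1] by (auto simp: G_def)
    have yV: "y s \<in> V" "y (Suc s) \<in> V" using inv[of s] inv[of "Suc s"] s by auto
    define d where "d = y s - y (Suc s)"
    have dV: "d \<in> V" using yV V by (simp add: d_def subspace_diff)
    have "f y' \<ge> f (y s) + G \<bullet> (y' - y s)" if "y' \<in> V" for y' using G that by (simp add: subdifferential_def)
    from this[OF xs] have "\<eta> * (f (y s) - f xs) \<le> \<eta> * (G \<bullet> (y s - xs))"
      using \<eta> by (intro mult_left_mono) (simp_all add: inner_diff_right)
    moreover have "h z (y s) - \<theta> s \<bullet> d + \<sigma> / 2 * (N d)\<^sup>2 \<le> h z (y (Suc s))"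
    proof -
      have e: "y (Suc s) - y s = - d" by (simp add: d_def)
      have "D (y s - z) (- d) = \<theta> s \<bullet> (- d)" using inv[of s] s dV V by (simp add: subspace_neg)
      then show ?thesis using breg[of "y s" "y (Suc s)"] unfolding e by (simp add: N_minus)
    qed
    moreover have "\<eta> * (G \<bullet> d) \<le> \<eta> * (L * N d)"
      using subgradient_le[OF lip yV(1) G dV] \<eta> by (intro mult_left_mono) auto
    moreover have "\<eta> * (L * N d) - \<sigma> / 2 * (N d)\<^sup>2 \<le> \<eta>\<^sup>2 * L\<^sup>2 / (2 * \<sigma>)"
    proof -
      have "0 \<le> (\<eta> * L - \<sigma> * N d)\<^sup>2 / (2 * \<sigma>)" using \<sigma> by simp
      also have "\<dots> = \<eta>\<^sup>2 * L\<^sup>2 / (2 * \<sigma>) - (\<eta> * (L * N d) - \<sigma> / 2 * (N d)\<^sup>2)"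
        using \<sigma> by (simp add: power2_eq_square field_simps)
      finally show ?thesis by simp
    qed
    moreover have "\<eta> * (G \<bullet> (y s - xs)) - (B s - B (Suc s)) = h z (y s) - h z (y (Suc s)) - \<theta> s \<bullet> d + \<eta> * (G \<bullet> d)"
      unfolding B_def \<theta>S d_def by (simp add: inner_simps algebra_simps)
    ultimately show ?thesis by linarith
  qed
  have sum: "\<eta> * (\<Sum>s<n. f (y s) - f xs) \<le> B 0 - B n + real n * (\<eta>\<^sup>2 * L\<^sup>2 / (2 * \<sigma>))" if "n \<le> T" for n
    using that
  proof (induction n)
    case (Suc n)
    define E where "E = \<eta>\<^sup>2 * L\<^sup>2 / (2 * \<sigma>)"
    show ?case using Suc st[of n] unfolding E_def[symmetric] by (simp add: distrib_left distrib_right)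
  qed simp
  have "(\<Sum>s<T. f x - f xs) \<le> (\<Sum>s<T. f (y s) - f xs)" by (intro sum_mono) (simp add: best)
  then have "\<eta> * (real T * (f x - f xs)) \<le> \<eta> * (\<Sum>s<T. f (y s) - f xs)"
    using \<eta> by (intro mult_left_mono) auto
  also have "\<dots> \<le> B 0 + real T * (\<eta>\<^sup>2 * L\<^sup>2 / (2 * \<sigma>))" using sum[of T] BT by simp
  finally have "(f x - f xs) * (\<eta> * real T) \<le> B 0 + real T * (\<eta>\<^sup>2 * L\<^sup>2 / (2 * \<sigma>))" by (simp add: mult_ac)
  then have "f x - f xs \<le> (B 0 + real T * (\<eta>\<^sup>2 * L\<^sup>2 / (2 * \<sigma>))) / (\<eta> * real T)"
    using \<eta> T by (simp add: pos_le_divide_eq)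
  also have "\<dots> = (N (z - xs))\<^sup>2 / (2 * \<eta> * real T) + \<eta> * L\<^sup>2 / (2 * \<sigma>)"
    using \<eta> T \<sigma> unfolding B0 by (simp add: field_simps power2_eq_square)
  finally show ?thesis .
qed

lemma mirror_in_V:
  assumes z: "z \<in> V" and run: "mirror V (h z) f z T \<eta> x"
  shows "x \<in> V"
proof -
  obtain y \<theta> g where y0: "y 0 = z" and \<theta>0: "\<theta> 0 = 0"
    and step: "\<And>s. s \<in> {1..T} \<Longrightarrow> g s \<in> subdifferential V f (y (s - 1)) \<and>
       \<theta> s = \<theta> (s - 1) - \<eta> *\<^sub>R g s \<and> y s = inv_into V (grad_on V (h z)) (\<theta> s)"
    and out: "\<exists>s\<le>T. x = y s \<and> (\<forall>r\<le>T. f (y s) \<le> f (y r))"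
    using run unfolding mirror_def by blast
  show ?thesis using out mirror_iterates[OF z y0 \<theta>0 step] by blast
qed

lemma mirror_exists:
  assumes f: "convex_on V f" and z: "z \<in> V"
  shows "\<exists>x. mirror V (h z) f z T \<eta> x"
proof -
  define sg where "sg y = (SOME g. g \<in> subdifferential V f y)" for y
  have sg: "sg y \<in> subdifferential V f y" if "y \<in> V" for y
    unfolding sg_def using subgradient_exists[OF V f that] by (simp add: some_in_eq)
  define \<theta>y where "\<theta>y = rec_nat (0, z) (\<lambda>_ (\<theta>, y). let \<theta>' = \<theta> - \<eta> *\<^sub>R sg y in (\<theta>', inv_into V (grad_on V (h z)) \<theta>'))"
  define \<theta> where "\<theta> s = fst (\<theta>y s)" for s
  define y where "y s = snd (\<theta>y s)" for s
  have 0: "\<theta> 0 = 0" "y 0 = z" by (simp_all add: \<theta>_def y_def \<theta>y_def)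
  have S: "\<theta> (Suc s) = \<theta> s - \<eta> *\<^sub>R sg (y s)" "y (Suc s) = inv_into V (grad_on V (h z)) (\<theta> (Suc s))" for s
    by (simp_all add: \<theta>_def y_def \<theta>y_def Let_def split_def)
  have inV: "\<theta> s \<in> V \<and> y s \<in> V" for s
  proof (induction s)
    case (Suc s)
    then have "sg (y s) \<in> V" using sg[of "y s"] by (simp add: subdifferential_def)
    then have "\<theta> (Suc s) \<in> V" using Suc V by (simp add: S(1) subspace_diff subspace_scale)
    then show ?case using inverse_gradient(1)[OF z, of "\<theta> (Suc s)"] by (simp only: S(2))
  qed (use z V in \<open>simp add: 0 subspace_0\<close>)
  have "\<exists>s\<in>{..T}. \<forall>r\<in>{..T}. f (y s) \<le> f (y r)"
    using ex_is_arg_min_if_finite[of "{..T}" "\<lambda>s. f (y s)"] by (auto simp: is_arg_min_linorder)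
  then obtain s where s: "s \<le> T" "\<forall>r\<le>T. f (y s) \<le> f (y r)" by auto
  have "mirror V (h z) f z T \<eta> (y s)"
    unfolding mirror_def
  proof (intro exI conjI ballI)
    fix s assume "s \<in> {1..T}"
    then obtain s' where s': "s = Suc s'" by (cases s) auto
    show "(\<lambda>s. sg (y (s - 1))) s \<in> subdifferential V f (y (s - 1))" using sg inV by simp
    show "\<theta> s = \<theta> (s - 1) - \<eta> *\<^sub>R sg (y (s - 1))" by (simp add: s' S(1))
    show "y s = inv_into V (grad_on V (h z)) (\<theta> s)" unfolding s' by (rule S(2))
  qed (use s 0 in auto)
  then show ?thesis by blast
qed

text \<open>With the given step size both terms of the mirror descent bound are at most half of the next target
gap: the second by the definition of \<open>\<eta>\<close>, the first by sharpness and the choice of \<open>t\<close>, since consecutive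
targets differ by the factor \<open>exp (1 / 2)\<close>. If \<open>L \<le> 0\<close>, then \<open>f\<close> is constant and the step size can
degenerate, so this case is separate.\<close>

theorem restarted_mirror_descent:
  assumes nrm: "nrm p = N" and p: "1 < p" "p \<le> 2" "\<sigma> = p - 1"
    and conv: "convex_on V f" and lip: "lipschitz_wrt V (nrm p) L f" and sharp: "sharp_wrt V (nrm p) \<mu> f"
    and x0: "x0 \<in> V" "f x0 - min_on V f \<le> \<epsilon>0" and eps: "0 < \<epsilon>" "\<epsilon> \<le> \<epsilon>0"
  shows "RMD_guarantee V nrm p f L \<mu> x0 \<epsilon>0 \<epsilon>"
proof -
  let ?K = "rmd_K \<epsilon>0 \<epsilon>" and ?t = "rmd_t L \<mu> p" and ?\<eta> = "rmd_eta L p \<epsilon>0"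
  define A where "A = argmin_on V f"
  define fs where "fs = min_on V f"
  have mu: "\<mu> > 0" and A: "A \<noteq> {}" using sharp by (auto simp: sharp_wrt_def A_def)
  have sh: "\<mu> * (INF x\<in>A. N (z - x)) \<le> f z - fs" if "z \<in> V" for z
    using sharp that by (simp add: sharp_wrt_def A_def fs_def nrm)
  have lip': "lipschitz_wrt V N L f" using lip by (simp add: nrm)
  have Amin: "x \<in> V \<and> (\<forall>y\<in>V. f x \<le> f y)" if "x \<in> A" for x
    using that by (auto simp: A_def argmin_on_def is_arg_min_linorder)
  have fsA: "f x = fs" if "x \<in> A" for x
    unfolding fs_def min_on_def using Amin[OF that]
    by (intro antisym cINF_greatest cINF_lower bdd_belowI2[where m = "f x"]) auto
  have fs_le: "fs \<le> f y" if "y \<in> V" for y using A Amin fsA that by (metis ex_in_conv)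
  have bdd: "bdd_below ((\<lambda>x. N (z - x)) ` A)" for z by (rule bdd_belowI2[where m = 0]) (rule N_nonneg)
  have INF_nonneg: "0 \<le> (INF x\<in>A. N (z - x))" for z using A N_nonneg by (intro cINF_greatest)
  have e0: "\<epsilon>0 > 0" using eps by simp
  have ek: "rmd_eps \<epsilon>0 k > 0" for k using e0 by (simp add: rmd_eps_def)
  have hh: "(\<lambda>x. (nrm p (x - z))\<^sup>2 / 2) = h z" for z by (simp add: h_def nrm)
  have const: "f y = fs" if "L \<le> 0" "y \<in> V" for y
  proof -
    obtain a where a: "a \<in> A" using A by blast
    then have "\<bar>f y - f a\<bar> \<le> L * N (y - a)" using lip' that Amin[OF a] unfolding lipschitz_wrt_def by blast
    also have "\<dots> \<le> 0" using that N_nonneg by (simp add: mult_nonpos_nonneg)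
    finally show ?thesis using fsA[OF a] by simp
  qed
  have bound: "f x - fs \<le> rmd_eps \<epsilon>0 (Suc k)"
    if z: "z \<in> V" "f z - fs \<le> rmd_eps \<epsilon>0 k" and run: "mirror V (h z) f z ?t (?\<eta> (Suc k)) x" for x z k
  proof (cases "L \<le> 0")
    case True
    then show ?thesis using const[OF True mirror_in_V[OF z(1) run]] ek[of "Suc k"] by simp
  next
    case False
    then have L: "L > 0" by simp
    define e where "e = rmd_eps \<epsilon>0 (Suc k)"
    define \<eta> where "\<eta> = ?\<eta> (Suc k)"
    define t where "t = real ?t"
    define d where "d = (INF a\<in>A. N (z - a))"
    have e: "e > 0" unfolding e_def by (rule ek)
    have \<eta>_eq: "\<eta> = (p - 1) * e / L\<^sup>2" by (simp add: \<eta>_def e_def rmd_eta_def)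
    have \<eta>: "\<eta> > 0" using e L p by (simp add: \<eta>_eq)
    have q: "exp 1 * L\<^sup>2 / (\<mu>\<^sup>2 * (p - 1)) > 0" using L mu p by simp
    have t: "exp 1 * L\<^sup>2 / (\<mu>\<^sup>2 * (p - 1)) \<le> t"
      unfolding t_def rmd_t_def by (rule real_nat_ceiling_ge)
    then have t0: "t > 0" using q by linarith
    then have T: "?t > 0" by (simp add: t_def)
    have *: "f x - fs \<le> r\<^sup>2 / (2 * \<eta> * t) + \<eta> * L\<^sup>2 / (2 * \<sigma>)" if r: "d < r" for r
    proof -
      \<comment> \<open>Any minimizer at distance less than \<open>r\<close> serves as comparison point, so the distance need not be
        attained.\<close>
      obtain a where a: "a \<in> A" "N (z - a) < r"
        using r A unfolding d_def by (auto simp: cINF_less_iff[OF A bdd])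
      have "f x - fs \<le> (N (z - a))\<^sup>2 / (2 * \<eta> * t) + \<eta> * L\<^sup>2 / (2 * \<sigma>)"
        using mirror_bound[OF z(1) lip' run \<eta>[unfolded \<eta>_def] T, of a] Amin[OF a(1)] fsA[OF a(1)]
        by (simp add: \<eta>_def t_def)
      also have "\<dots> \<le> r\<^sup>2 / (2 * \<eta> * t) + \<eta> * L\<^sup>2 / (2 * \<sigma>)"
        using a(2) N_nonneg \<eta> t0 by (intro add_right_mono divide_right_mono power_mono) auto
      finally show ?thesis .
    qed
    have "((\<lambda>r. r\<^sup>2 / (2 * \<eta> * t) + \<eta> * L\<^sup>2 / (2 * \<sigma>)) \<longlongrightarrow> d\<^sup>2 / (2 * \<eta> * t) + \<eta> * L\<^sup>2 / (2 * \<sigma>)) (at_right d)"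
      using \<eta> t0 by (intro tendsto_intros) auto
    moreover have "\<forall>\<^sub>F r in at_right d. f x - fs \<le> r\<^sup>2 / (2 * \<eta> * t) + \<eta> * L\<^sup>2 / (2 * \<sigma>)"
      unfolding eventually_at_filter using * by (intro always_eventually) auto
    ultimately have 1: "f x - fs \<le> d\<^sup>2 / (2 * \<eta> * t) + \<eta> * L\<^sup>2 / (2 * \<sigma>)"
      by (intro tendsto_lowerbound[where F = "at_right d"]) auto
    have "\<mu> * d \<le> rmd_eps \<epsilon>0 k" using sh[OF z(1)] z(2) unfolding d_def by linarith
    moreover have "d \<ge> 0" unfolding d_def by (rule INF_nonneg)
    ultimately have "(\<mu> * d)\<^sup>2 \<le> (rmd_eps \<epsilon>0 k)\<^sup>2" using mu by (intro power_mono) auto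
    also have "(rmd_eps \<epsilon>0 k)\<^sup>2 = exp 1 * e\<^sup>2"
    proof -
      have "rmd_eps \<epsilon>0 k = e * exp (1 / 2)"
        unfolding e_def rmd_eps_def by (simp add: exp_add[symmetric] field_simps)
      moreover have "(exp (1 / 2 :: real))\<^sup>2 = exp 1" by (simp add: power2_eq_square exp_add[symmetric])
      ultimately show ?thesis by (simp add: power_mult_distrib)
    qed
    finally have "\<mu>\<^sup>2 * d\<^sup>2 \<le> exp 1 * e\<^sup>2" by (simp add: power_mult_distrib)
    then have d2: "d\<^sup>2 \<le> exp 1 * e\<^sup>2 / \<mu>\<^sup>2" using mu by (simp add: pos_le_divide_eq mult.commute)
    also have "\<dots> = e * \<eta> * (exp 1 * L\<^sup>2 / (\<mu>\<^sup>2 * (p - 1)))"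
      using L mu p by (simp add: \<eta>_eq power2_eq_square)
    also have "\<dots> \<le> e * \<eta> * t" using e \<eta> t by (intro mult_left_mono) auto
    finally have "d\<^sup>2 / (2 * \<eta> * t) \<le> e * \<eta> * t / (2 * \<eta> * t)" using \<eta> t0 by (intro divide_right_mono) auto
    also have "\<dots> = e / 2" using \<eta> t0 by simp
    finally have "d\<^sup>2 / (2 * \<eta> * t) \<le> e / 2" .
    moreover have "\<eta> * L\<^sup>2 / (2 * \<sigma>) = e / 2"
    proof -
      have "\<eta> * L\<^sup>2 = \<sigma> * e" using L p(3) by (simp add: \<eta>_eq)
      then show ?thesis using \<sigma> by simp
    qed
    ultimately show ?thesis using 1 unfolding e_def by linarith
  qed
  have runs: "\<exists>xs. RMD V (nrm p) f x0 ?K ?\<eta> ?t xs"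
  proof -
    define M where "M k z = (SOME x. mirror V (h z) f z ?t (?\<eta> k) x)" for k z
    have M: "mirror V (h z) f z ?t (?\<eta> k) (M k z)" if "z \<in> V" for k z
      unfolding M_def using mirror_exists[OF conv that] by (rule someI_ex)
    define xs where "xs = rec_nat x0 (\<lambda>k z. M (Suc k) z)"
    have xs: "xs 0 = x0" "\<And>k. xs (Suc k) = M (Suc k) (xs k)" by (simp_all add: xs_def)
    have V: "xs k \<in> V" for k
      by (induction k) (simp_all add: xs x0(1) mirror_in_V[OF _ M])
    have "RMD V (nrm p) f x0 ?K ?\<eta> ?t xs"
      unfolding RMD_def hh
    proof (intro conjI ballI)
      fix k assume "k \<in> {1..?K}"
      then obtain k' where k: "k = Suc k'" by (cases k) auto
      show "mirror V (h (xs (k - 1))) f (xs (k - 1)) ?t (?\<eta> k) (xs k)"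
        using M[OF V[of k'], of k] by (simp add: k xs)
    qed (rule xs(1))
    then show ?thesis by blast
  qed
  have acc: "xs k \<in> V \<and> f (xs k) - fs \<le> rmd_eps \<epsilon>0 k"
    if run: "RMD V (nrm p) f x0 ?K ?\<eta> ?t xs" and k: "k \<le> ?K" for xs k
    using k
  proof (induction k)
    case 0
    then show ?case using run x0 by (simp add: RMD_def rmd_eps_def fs_def)
  next
    case (Suc k)
    have "Suc k \<in> {1..?K}" using Suc.prems by simp
    then have m: "mirror V (h (xs k)) f (xs k) ?t (?\<eta> (Suc k)) (xs (Suc k))"
      using run unfolding RMD_def hh by fastforce
    then show ?case using Suc bound[OF _ _ m] mirror_in_V[OF _ m] by simp
  qed
  have last: "rmd_eps \<epsilon>0 ?K \<le> \<epsilon>"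
  proof -
    have "2 * ln (\<epsilon>0 / \<epsilon>) \<le> real ?K" unfolding rmd_K_def by (rule real_nat_ceiling_ge)
    then have "exp (- real ?K / 2) \<le> exp (- ln (\<epsilon>0 / \<epsilon>))" by simp
    also have "\<dots> = \<epsilon> / \<epsilon>0" using eps e0 by (simp add: exp_minus)
    finally have "\<epsilon>0 * exp (- real ?K / 2) \<le> \<epsilon>0 * (\<epsilon> / \<epsilon>0)" using e0 by (intro mult_left_mono) auto
    then show ?thesis using e0 by (simp add: rmd_eps_def)
  qed
  have ratio: "\<mu> \<le> L \<or> (\<forall>x\<in>V. f x = fs)"
  proof (rule ccontr)
    assume "\<not> ?thesis"
    then obtain z where z: "z \<in> V" "f z \<noteq> fs" and Lmu: "L < \<mu>" by auto
    have L: "L > 0" using const z by force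
    define d where "d = (INF a\<in>A. N (z - a))"
    have "f z - fs \<le> L * N (z - a)" if "a \<in> A" for a
      using lip' z Amin[OF that] fsA[OF that] unfolding lipschitz_wrt_def by (metis abs_le_D1)
    then have "(f z - fs) / L \<le> N (z - a)" if "a \<in> A" for a
      using L that by (simp add: pos_divide_le_eq mult.commute)
    then have "(f z - fs) / L \<le> d" unfolding d_def using A by (intro cINF_greatest) auto
    then have le: "f z - fs \<le> L * d" using L by (simp add: pos_divide_le_eq mult.commute)
    moreover have "0 < f z - fs" using fs_le[OF z(1)] z(2) by simp
    ultimately have "d > 0" using L by (metis less_le_trans zero_less_mult_pos)
    then have "L * d < \<mu> * d" using Lmu by simp
    then show False using le sh[OF z(1)] unfolding d_def by linarith
  qed
  show ?thesis
    unfolding RMD_guarantee_def eps_optimizer_def fs_def[symmetric]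
    using runs acc last ratio by (meson order_refl order_trans)
qed

end

section \<open>Schatten norms as mirror maps\<close>

text \<open>The factor \<open>\<kappa>\<close> accounts for the dilation, in which each singular value is counted twice.\<close>

lemma (in selfadj_family) mirror_space_schatten:
  assumes V: "subspace V" and k: "\<kappa> > 0"
  shows "mirror_space V (\<lambda>x. \<kappa> * F x powr (1 / p)) (\<lambda>x d. \<kappa>\<^sup>2 * DPhi x d) (p - 1)"
proof -
  have sq: "(\<kappa> * F x powr (1 / p))\<^sup>2 = \<kappa>\<^sup>2 * F x powr (2 / p)" for x
    by (simp add: power_mult_distrib power2_eq_square powr_add[symmetric])
  have sq2: "(\<kappa> * F x powr (1 / p))\<^sup>2 / 2 = \<kappa>\<^sup>2 * Phi x" for x
    by (simp add: sq Phi_def)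
  show ?thesis
  proof
    show "subspace V" by (rule V)
    show "p - 1 > 0" using p by simp
    show "\<kappa> * F x powr (1 / p) \<ge> 0" for x using k by simp
    show "\<kappa> * F 0 powr (1 / p) = 0" by simp
    show "\<kappa> * F (- x) powr (1 / p) = \<kappa> * F x powr (1 / p)" for x using F_scale[of "-1" x] by simp
    obtain c where c: "c > 0" "\<And>x. c * norm x \<le> F x powr (1 / p)" using F_powr_lower_bound by blast
    have "\<kappa> * c * norm x \<le> \<kappa> * F x powr (1 / p)" for x
      using c(2)[of x] k by (simp add: mult.assoc)
    then show "\<exists>c>0. \<forall>x. c * norm x \<le> \<kappa> * F x powr (1 / p)"
      using c(1) k by (intro exI[of _ "\<kappa> * c"]) auto
    show "((\<lambda>x. (\<kappa> * F x powr (1 / p))\<^sup>2 / 2) has_derivative (\<lambda>d. \<kappa>\<^sup>2 * DPhi x d)) (at x)" for x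
      unfolding sq2 by (intro has_derivative_mult_right Phi_has_derivative)
    show "\<kappa>\<^sup>2 * DPhi 0 d = 0" for d by (simp add: DPhi_0)
    fix x y
    have "\<kappa>\<^sup>2 * (Phi x + DPhi x (y - x) + (p - 1) / 2 * F (y - x) powr (2 / p)) \<le> \<kappa>\<^sup>2 * Phi y"
      by (intro mult_left_mono Phi_strongly_convex) auto
    then show "(\<kappa> * F x powr (1 / p))\<^sup>2 / 2 + \<kappa>\<^sup>2 * DPhi x (y - x) + (p - 1) / 2 * (\<kappa> * F (y - x) powr (1 / p))\<^sup>2
      \<le> (\<kappa> * F y powr (1 / p))\<^sup>2 / 2"
      unfolding sq2 unfolding sq by (simp only: distrib_left mult.left_commute)
  qed
qed

section \<open>Vectors as diagonal operators\<close>

definition diag_op :: "real ^ 'n \<Rightarrow> real ^ 'n \<Rightarrow> real ^ 'n" where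
  "diag_op x v = (\<chi> i. x $ i * v $ i)"

lemma selfadj_family_diag:
  assumes "1 < p" "p \<le> 2"
  shows "selfadj_family (diag_op :: real ^ 'n \<Rightarrow> _) p"
proof
  show "selfadj (diag_op x)" for x :: "real ^ 'n"
    unfolding selfadj_def by (auto intro!: linearI simp: diag_op_def vec_eq_iff inner_vec_def algebra_simps)
  show "diag_op (x + y) v = diag_op x v + diag_op y v" for x y v :: "real ^ 'n"
    by (simp add: diag_op_def vec_eq_iff algebra_simps)
  show "diag_op (c *\<^sub>R x) v = c *\<^sub>R diag_op x v" for c and x v :: "real ^ 'n"
    by (simp add: diag_op_def vec_eq_iff)
  show "x = 0" if "\<And>v. diag_op x v = 0" for x :: "real ^ 'n"
    using that[of "\<chi> i. 1"] by (simp add: diag_op_def vec_eq_iff)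
qed (use assms in auto)

lemma diag_F:
  assumes "1 < p" "p \<le> 2"
  shows "selfadj_family.F diag_op p (x :: real ^ 'n) = (\<Sum>i\<in>UNIV. \<bar>x $ i\<bar> powr p)"
proof -
  interpret selfadj_family "diag_op :: real ^ 'n \<Rightarrow> _" p by (rule selfadj_family_diag[OF assms])
  have B: "(Basis :: (real ^ 'n) set) = range (\<lambda>i. axis i 1)" by (auto simp: Basis_vec_def)
  have ax: "axis i (1::real) \<bullet> v = v $ i" for i and v :: "real ^ 'n" by (simp add: inner_axis')
  have d: "diag_op x (axis i 1) = x $ i *\<^sub>R axis i 1" for i
    by (simp add: diag_op_def vec_eq_iff axis_def)
  have "eigbasis (diag_op x) Basis"
    unfolding eigbasis_def
  proof (intro conjI ballI)
    show "pairwise orthogonal (Basis :: (real ^ 'n) set)"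
      by (auto simp: pairwise_def orthogonal_def inner_Basis)
    fix e :: "real ^ 'n" assume "e \<in> Basis"
    then obtain i where "e = axis i 1" using B by auto
    then show "diag_op x e = (e \<bullet> diag_op x e) *\<^sub>R e" by (simp add: d ax)
  qed auto
  then have "F x = (\<Sum>e\<in>range (\<lambda>i. axis i (1::real)). \<bar>e \<bullet> diag_op x e\<bar> powr p)"
    unfolding B[symmetric] by (rule F_eq)
  also have "\<dots> = (\<Sum>i\<in>UNIV. \<bar>x $ i\<bar> powr p)"
    by (subst sum.reindex) (simp_all add: inj_on_def axis_eq_axis d ax)
  finally show ?thesis .
qed

section \<open>Singular values and the symmetric dilation\<close>

lemma inner_transpose: "(transpose A *v x) \<bullet> y = x \<bullet> (A *v y)" for A :: "real ^ 'N ^ 'n"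
  by (simp add: dot_lmul_matrix)

lemma inner_transpose': "x \<bullet> (transpose A *v y) = (A *v x) \<bullet> y" for A :: "real ^ 'N ^ 'n"
  by (metis inner_commute inner_transpose)

text \<open>The default simplification to \<open>x v* A\<close> would hide the transposes from these two rules.\<close>

declare transpose_matrix_vector [simp del]

definition dilation :: "real ^ 'N ^ 'n \<Rightarrow> (real ^ 'n) \<times> (real ^ 'N) \<Rightarrow> (real ^ 'n) \<times> (real ^ 'N)" where
  "dilation A v = (A *v snd v, transpose A *v fst v)"

lemma selfadj_family_dilation:
  assumes "1 < p" "p \<le> 2"
  shows "selfadj_family (dilation :: real ^ 'N ^ 'n \<Rightarrow> _) p"
proof
  show "selfadj (dilation x)" for x :: "real ^ 'N ^ 'n"
    unfolding selfadj_def
  proof (intro conjI allI linearI)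
    fix v w :: "(real ^ 'n) \<times> (real ^ 'N)"
    show "dilation x v \<bullet> w = v \<bullet> dilation x w"
      by (simp add: dilation_def inner_prod_def inner_transpose inner_transpose')
  qed (simp_all add: dilation_def matrix_vector_right_distrib scaleR_matrix_vector_assoc[symmetric] matrix_vector_mult_scaleR)
  show "dilation (x + y) v = dilation x v + dilation y v" for x y :: "real ^ 'N ^ 'n" and v
    by (simp add: dilation_def matrix_vector_mult_add_rdistrib transpose_def vec_eq_iff matrix_vector_mult_def algebra_simps sum.distrib)
  show "dilation (c *\<^sub>R x) v = c *\<^sub>R dilation x v" for c and x :: "real ^ 'N ^ 'n" and v
    by (simp add: dilation_def transpose_def vec_eq_iff matrix_vector_mult_def sum_distrib_left mult.assoc)
  show "x = 0" if "\<And>v. dilation x v = 0" for x :: "real ^ 'N ^ 'n"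
  proof -
    have "x *v y = 0 *v y" for y using that[of "(0, y)"] by (simp add: dilation_def zero_prod_def)
    then show ?thesis by (simp add: matrix_eq)
  qed
qed (use assms in auto)

definition gram :: "real ^ 'N ^ 'n \<Rightarrow> real ^ 'n \<Rightarrow> real ^ 'n" where
  "gram A v = (A ** transpose A) *v v"

lemma gram_alt: "gram A v = A *v (transpose A *v v)"
  by (simp add: gram_def matrix_vector_mul_assoc)

lemma gram_inner: "v \<bullet> gram A w = (transpose A *v v) \<bullet> (transpose A *v w)"
  by (simp add: gram_alt inner_transpose)

lemma selfadj_gram: "selfadj (gram A)"
  unfolding selfadj_def
proof (intro conjI allI)
  show "linear (gram A)" unfolding gram_def by (rule matrix_vector_mul_linear)
  show "gram A x \<bullet> y = x \<bullet> gram A y" for x y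
    by (metis gram_inner inner_commute)
qed

lemma sv_eigenspace_eq_span:
  assumes E: "eigbasis (gram A) E"
  shows "sv_eigenspace A s = span {e \<in> E. e \<bullet> gram A e = s\<^sup>2}"
proof
  have sub: "subspace (sv_eigenspace A s)"
    by (auto simp: subspace_def sv_eigenspace_def matrix_vector_right_distrib matrix_vector_mult_scaleR algebra_simps)
  show "span {e \<in> E. e \<bullet> gram A e = s\<^sup>2} \<subseteq> sv_eigenspace A s"
  proof (rule span_minimal[OF _ sub], clarify)
    fix e assume "e \<in> E" "e \<bullet> gram A e = s\<^sup>2"
    then have "gram A e = s\<^sup>2 *\<^sub>R e" using eigbasis_eigenvector[OF E] by metis
    then show "e \<in> sv_eigenspace A s" by (simp add: sv_eigenspace_def gram_def)
  qed
  show "sv_eigenspace A s \<subseteq> span {e \<in> E. e \<bullet> gram A e = s\<^sup>2}"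
  proof
    fix v assume "v \<in> sv_eigenspace A s"
    then have v: "gram A v = s\<^sup>2 *\<^sub>R v" by (simp add: sv_eigenspace_def gram_def)
    have "v = (\<Sum>e\<in>E. (v \<bullet> e) *\<^sub>R e)" using onb_expand[OF eigbasis_onb[OF E]] by metis
    also have "\<dots> \<in> span {e \<in> E. e \<bullet> gram A e = s\<^sup>2}"
    proof (rule span_sum)
      fix e assume e: "e \<in> E"
      show "(v \<bullet> e) *\<^sub>R e \<in> span {e \<in> E. e \<bullet> gram A e = s\<^sup>2}"
      proof (cases "e \<bullet> gram A e = s\<^sup>2")
        case True
        then show ?thesis using e by (intro span_scale span_base) auto
      next
        case False
        have "s\<^sup>2 * (v \<bullet> e) = gram A v \<bullet> e" by (simp add: v)
        also have "\<dots> = v \<bullet> gram A e" using selfadj_gram[of A] by (simp add: selfadj_def)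
        also have "\<dots> = (e \<bullet> gram A e) * (v \<bullet> e)"
          by (subst eigbasis_eigenvector[OF E e]) simp
        finally have "v \<bullet> e = 0" using False by simp
        then show ?thesis by (simp add: span_zero)
      qed
    qed
    finally show "v \<in> span {e \<in> E. e \<bullet> gram A e = s\<^sup>2}" .
  qed
qed

text \<open>Grouping an eigenbasis of the Gram matrix by singular values: the multiplicity of a singular value is
the number of basis vectors that belong to it.\<close>

lemma schatten_norm_eigbasis:
  assumes E: "eigbasis (gram A) E"
  shows "schatten_norm p A = (\<Sum>e\<in>E. sqrt (e \<bullet> gram A e) powr p) powr (1 / p)"
proof -
  define g where "g e = sqrt (e \<bullet> gram A e)" for e
  have g0: "g e \<ge> 0" and g2: "(g e)\<^sup>2 = e \<bullet> gram A e" for e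
    unfolding g_def gram_inner by simp_all
  have fin: "finite E" using onb_finite[OF eigbasis_onb[OF E]] .
  have ind: "independent E" using onb_independent[OF eigbasis_onb[OF E]] .
  have set: "{e \<in> E. e \<bullet> gram A e = s\<^sup>2} = {e \<in> E. g e = s}" if "s \<ge> 0" for s
    using that g0 by (auto simp: g2[symmetric] power2_eq_iff_nonneg)
  have dim: "dim (sv_eigenspace A s) = card {e \<in> E. g e = s}" if "s \<ge> 0" for s
    unfolding sv_eigenspace_eq_span[OF E] set[OF that] dim_span
    by (intro dim_eq_card_independent independent_mono[OF ind]) auto
  have sv: "singular_values A = g ` E"
  proof (intro set_eqI iffI)
    fix s assume "s \<in> singular_values A"
    then have s: "s \<ge> 0" and "\<exists>v\<in>span {e \<in> E. g e = s}. v \<noteq> 0"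
      unfolding singular_values_def sv_eigenspace_eq_span[OF E] using set by auto
    then have "{e \<in> E. g e = s} \<noteq> {}" by (metis singletonD span_empty)
    then show "s \<in> g ` E" by blast
  next
    fix s assume "s \<in> g ` E"
    then obtain e where e: "e \<in> E" "s = g e" by blast
    then have "e \<in> span {e \<in> E. g e = s}" by (intro span_base) auto
    moreover have "e \<noteq> 0" using eigbasis_norm[OF E e(1)] by auto
    ultimately show "s \<in> singular_values A"
      unfolding singular_values_def sv_eigenspace_eq_span[OF E] using set[of s] g0 e(2) by auto
  qed
  have "(\<Sum>s\<in>singular_values A. real (dim (sv_eigenspace A s)) * s powr p) =
    (\<Sum>s\<in>g ` E. \<Sum>e\<in>{e \<in> E. g e = s}. g e powr p)"
    unfolding sv
  proof (rule sum.cong[OF refl])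
    fix s assume "s \<in> g ` E"
    then have "s \<ge> 0" using g0 by auto
    then show "real (dim (sv_eigenspace A s)) * s powr p = (\<Sum>e\<in>{e \<in> E. g e = s}. g e powr p)"
      by (simp add: dim)
  qed
  also have "\<dots> = (\<Sum>e\<in>E. g e powr p)" by (rule sum.image_gen[OF fin, symmetric])
  finally show ?thesis by (simp add: schatten_norm_def g_def)
qed

text \<open>Both sides are compared without constructing eigenvectors of the dilation from singular vectors.
An eigenvector \<open>e\<close> of the Gram matrix is nonorthogonal to the first component of an eigenvector \<open>b\<close> of
the dilation only if the singular value of \<open>e\<close> equals the absolute eigenvalue of \<open>b\<close>. If this eigenvalue is
nonzero, both components of \<open>b\<close> have squared length \<open>1 / 2\<close>, which gives the factor 2; zero eigenvalues
do not contribute because \<open>0 powr p = 0\<close>.\<close>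

lemma dilation_trace:
  fixes A :: "real ^ 'N ^ 'n"
  assumes E: "eigbasis (gram A) E" and B: "eigbasis (dilation A) B"
  shows "(\<Sum>b\<in>B. \<bar>b \<bullet> dilation A b\<bar> powr p) = 2 * (\<Sum>e\<in>E. sqrt (e \<bullet> gram A e) powr p)"
proof -
  note oE = eigbasis_onb[OF E] and oB = eigbasis_onb[OF B]
  define \<nu> where "\<nu> b = b \<bullet> dilation A b" for b
  have eig: "A *v snd b = \<nu> b *\<^sub>R fst b" "transpose A *v fst b = \<nu> b *\<^sub>R snd b" if "b \<in> B" for b
  proof -
    have "dilation A b = \<nu> b *\<^sub>R b" unfolding \<nu>_def by (rule eigbasis_eigenvector[OF B that])
    then show "A *v snd b = \<nu> b *\<^sub>R fst b" "transpose A *v fst b = \<nu> b *\<^sub>R snd b"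
      by (simp_all add: dilation_def prod_eq_iff)
  qed
  have half: "\<bar>\<nu> b\<bar> powr p * (fst b \<bullet> fst b) = \<bar>\<nu> b\<bar> powr p / 2" if b: "b \<in> B" for b
  proof (cases "\<nu> b = 0")
    case False
    have "\<nu> b * (fst b \<bullet> fst b) = fst b \<bullet> (A *v snd b)" by (simp add: eig(1)[OF b])
    also have "\<dots> = (transpose A *v fst b) \<bullet> snd b" by (rule inner_transpose[symmetric])
    also have "\<dots> = \<nu> b * (snd b \<bullet> snd b)" by (simp add: eig(2)[OF b])
    finally have "fst b \<bullet> fst b = snd b \<bullet> snd b" using False by simp
    moreover have "fst b \<bullet> fst b + snd b \<bullet> snd b = 1"
      using eigbasis_norm[OF B b] by (simp add: norm_eq_1 inner_prod_def)
    ultimately have "fst b \<bullet> fst b = 1 / 2" by linarith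
    then show ?thesis by simp
  qed simp
  have match: "(e \<bullet> fst b)\<^sup>2 * sqrt (e \<bullet> gram A e) powr p = (e \<bullet> fst b)\<^sup>2 * \<bar>\<nu> b\<bar> powr p"
    if e: "e \<in> E" and b: "b \<in> B" for e b
  proof (cases "e \<bullet> fst b = 0")
    case False
    have "gram A e \<bullet> fst b = ((e \<bullet> gram A e) *\<^sub>R e) \<bullet> fst b"
      using eigbasis_eigenvector[OF E e] by (rule arg_cong)
    then have "(e \<bullet> gram A e) * (e \<bullet> fst b) = gram A e \<bullet> fst b" by (simp only: inner_scaleR_left)
    also have "\<dots> = e \<bullet> gram A (fst b)" using selfadj_gram[of A] by (simp add: selfadj_def)
    also have "\<dots> = (\<nu> b)\<^sup>2 * (e \<bullet> fst b)"
      by (simp add: gram_alt eig[OF b] matrix_vector_mult_scaleR power2_eq_square)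
    finally have "e \<bullet> gram A e = (\<nu> b)\<^sup>2" using False by simp
    then show ?thesis by simp
  qed simp
  have "(\<Sum>e\<in>E. sqrt (e \<bullet> gram A e) powr p) = (\<Sum>e\<in>E. \<Sum>b\<in>B. (e \<bullet> fst b)\<^sup>2 * sqrt (e \<bullet> gram A e) powr p)"
  proof (rule sum.cong[OF refl])
    fix e assume "e \<in> E"
    then have "norm (e, 0 :: real ^ 'N) = 1" using eigbasis_norm[OF E] by (simp add: norm_prod_def)
    from onb_parseval[OF oB this] have "(\<Sum>b\<in>B. (e \<bullet> fst b)\<^sup>2) = 1" by (simp add: inner_prod_def)
    then show "sqrt (e \<bullet> gram A e) powr p = (\<Sum>b\<in>B. (e \<bullet> fst b)\<^sup>2 * sqrt (e \<bullet> gram A e) powr p)"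
      by (simp add: sum_distrib_right[symmetric])
  qed
  also have "\<dots> = (\<Sum>e\<in>E. \<Sum>b\<in>B. (e \<bullet> fst b)\<^sup>2 * \<bar>\<nu> b\<bar> powr p)" by (intro sum.cong refl match)
  also have "\<dots> = (\<Sum>b\<in>B. \<bar>\<nu> b\<bar> powr p * (\<Sum>e\<in>E. (fst b \<bullet> e) * (fst b \<bullet> e)))"
    by (subst sum.swap) (simp add: sum_distrib_left power2_eq_square inner_commute mult.commute)
  also have "\<dots> = (\<Sum>b\<in>B. \<bar>\<nu> b\<bar> powr p / 2)" unfolding onb_inner_expand[OF oE] by (intro sum.cong refl half)
  finally show ?thesis unfolding \<nu>_def by (simp add: sum_divide_distrib[symmetric])
qed

lemma schatten_norm_dilation:
  assumes "1 < p" "p \<le> 2"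
  shows "schatten_norm p A = (1 / 2) powr (1 / p) * selfadj_family.F dilation p A powr (1 / p)"
proof -
  interpret selfadj_family "dilation :: real ^ 'N ^ 'n \<Rightarrow> _" p by (rule selfadj_family_dilation[OF assms])
  obtain E where E: "eigbasis (gram A) E" using selfadj_eigbasis_exists[OF selfadj_gram] by blast
  have "F A = 2 * (\<Sum>e\<in>E. sqrt (e \<bullet> gram A e) powr p)"
    unfolding F_def by (rule dilation_trace[OF E basis])
  then have "(\<Sum>e\<in>E. sqrt (e \<bullet> gram A e) powr p) = (1 / 2) * F A" by simp
  then show ?thesis unfolding schatten_norm_eigbasis[OF E] by (simp only: powr_mult)
qed

section \<open>Restarted mirror descent in Schatten norms\<close>

lemma subspace_sym_matrices: "subspace sym_matrices"
  by (auto simp: subspace_def sym_matrices_def transpose_def vec_eq_iff)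

theorem lp_restarted_mirror_descent:
  assumes "1 < p" "p \<le> 2" "convex_on V f" "subspace V"
    "lipschitz_wrt V (lp_norm p) L f" "sharp_wrt V (lp_norm p) \<mu> f"
    "x0 \<in> V" "f x0 - min_on V f \<le> \<epsilon>0" "0 < \<epsilon>" "\<epsilon> \<le> \<epsilon>0"
  shows "RMD_guarantee V lp_norm p f L \<mu> x0 \<epsilon>0 \<epsilon>"
proof -
  interpret S: selfadj_family "diag_op :: real ^ 'a \<Rightarrow> _" p by (rule selfadj_family_diag[OF assms(1,2)])
  interpret M: mirror_space V "\<lambda>x. 1 * S.F x powr (1 / p)" "\<lambda>x d. 1\<^sup>2 * S.DPhi x d" "p - 1"
    by (rule S.mirror_space_schatten[OF assms(4)]) simp
  have "lp_norm p = (\<lambda>x :: real ^ 'a. 1 * S.F x powr (1 / p))"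
    by (simp add: fun_eq_iff lp_norm_def diag_F[OF assms(1,2)])
  then show ?thesis using assms by (intro M.restarted_mirror_descent) auto
qed

theorem schatten_restarted_mirror_descent:
  fixes f :: "real ^ 'N ^ 'n \<Rightarrow> real"
  assumes "1 < p" "p \<le> 2" "convex_on V f" "subspace V"
    "lipschitz_wrt V (schatten_norm p) L f" "sharp_wrt V (schatten_norm p) \<mu> f"
    "x0 \<in> V" "f x0 - min_on V f \<le> \<epsilon>0" "0 < \<epsilon>" "\<epsilon> \<le> \<epsilon>0"
  shows "RMD_guarantee V schatten_norm p f L \<mu> x0 \<epsilon>0 \<epsilon>"
proof -
  interpret S: selfadj_family "dilation :: real ^ 'N ^ 'n \<Rightarrow> _" p by (rule selfadj_family_dilation[OF assms(1,2)])
  interpret M: mirror_space V "\<lambda>x. (1 / 2) powr (1 / p) * S.F x powr (1 / p)"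
    "\<lambda>x d. ((1 / 2) powr (1 / p))\<^sup>2 * S.DPhi x d" "p - 1"
    by (rule S.mirror_space_schatten[OF assms(4)]) simp
  have "schatten_norm p = (\<lambda>x :: real ^ 'N ^ 'n. (1 / 2) powr (1 / p) * S.F x powr (1 / p))"
    by (simp add: fun_eq_iff schatten_norm_dilation[OF assms(1,2)])
  then show ?thesis using assms by (intro M.restarted_mirror_descent) auto
qed

section \<open>Comparison with the 1-norm\<close>

lemma powr_sum_le_sum:
  fixes a :: "'i \<Rightarrow> real"
  assumes p: "1 < p" and I: "finite I" and a: "\<And>i. i \<in> I \<Longrightarrow> 0 \<le> a i"
  shows "(\<Sum>i\<in>I. a i powr p) powr (1 / p) \<le> (\<Sum>i\<in>I. a i)"
proof -
  define S where "S = (\<Sum>i\<in>I. a i)"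
  have S: "S \<ge> 0" unfolding S_def using a by (rule sum_nonneg)
  have "(\<Sum>i\<in>I. a i powr p) \<le> (\<Sum>i\<in>I. a i * S powr (p - 1))"
  proof (rule sum_mono)
    fix i assume i: "i \<in> I"
    have "a i \<le> S" unfolding S_def using i I a by (intro member_le_sum) auto
    then have "a i * a i powr (p - 1) \<le> a i * S powr (p - 1)"
      using a[OF i] p by (intro mult_left_mono powr_mono2) auto
    then show "a i powr p \<le> a i * S powr (p - 1)"
      using powr_mult_base[of "a i" "p - 1"] a[OF i] by simp
  qed
  also have "\<dots> = S * S powr (p - 1)" by (simp add: S_def sum_distrib_right)
  also have "\<dots> = S powr p" using powr_mult_base[OF S, of "p - 1"] by simp
  finally have "(\<Sum>i\<in>I. a i powr p) powr (1 / p) \<le> (S powr p) powr (1 / p)"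
    using p by (intro powr_mono2 sum_nonneg) auto
  also have "\<dots> = S" using p S by (simp add: powr_powr)
  finally show ?thesis unfolding S_def .
qed

text \<open>Jensen's inequality for the uniform weights \<open>1 / card I\<close>.\<close>

lemma sum_le_powr_sum:
  fixes a :: "'i \<Rightarrow> real"
  assumes p: "1 < p" and I: "finite I" "I \<noteq> {}" and a: "\<And>i. i \<in> I \<Longrightarrow> 0 \<le> a i"
  shows "(\<Sum>i\<in>I. a i) \<le> real (card I) powr (1 - 1 / p) * (\<Sum>i\<in>I. a i powr p) powr (1 / p)"
proof -
  define n where "n = real (card I)"
  define S where "S = (\<Sum>i\<in>I. a i)"
  define Q where "Q = (\<Sum>i\<in>I. a i powr p)"
  have n: "n > 0" unfolding n_def using I by (simp add: card_gt_0_iff)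
  have S: "S \<ge> 0" unfolding S_def using a by (rule sum_nonneg)
  have "(\<Sum>i\<in>I. 1 / n * a i) powr p \<le> (\<Sum>i\<in>I. 1 / n * a i powr p)"
    using n I a by (intro powr_jensen p) (auto simp: n_def)
  then have "(S / n) powr p \<le> Q / n"
    by (simp add: S_def Q_def sum_divide_distrib)
  then have "((S / n) powr p) powr (1 / p) \<le> (Q / n) powr (1 / p)"
    using p by (intro powr_mono2) auto
  then have "S / n \<le> (Q / n) powr (1 / p)" using p S n by (simp add: powr_powr)
  then have "S \<le> n * (Q / n) powr (1 / p)" using n by (simp add: pos_divide_le_eq mult.commute)
  also have "\<dots> = n powr (1 - 1 / p) * Q powr (1 / p)"
  proof -
    have "(Q / n) powr (1 / p) = Q powr (1 / p) / n powr (1 / p)" by (rule powr_divide)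
    moreover have "n powr (1 - 1 / p) = n / n powr (1 / p)" using n by (simp add: powr_diff)
    ultimately show ?thesis by simp
  qed
  finally show ?thesis unfolding S_def Q_def n_def .
qed

lemma ln_ge_1: "3 \<le> n \<Longrightarrow> 1 \<le> ln (real n)"
  using exp_le by (subst ln_ge_iff) (auto intro: order_trans)

lemma p1_range: assumes "3 \<le> n" shows "1 < p1 n" "p1 n \<le> 2"
  using ln_ge_1[OF assms] by (auto simp: p1_def)

text \<open>The exponent is chosen so that \<open>n powr (1 - 1 / p)\<close> is \<open>exp (ln n / (ln n + 1))\<close>.\<close>

lemma card_powr_p1_le: assumes "3 \<le> n" shows "real n powr (1 - 1 / p1 n) \<le> exp 1"
proof -
  have l: "1 \<le> ln (real n)" by (rule ln_ge_1[OF assms])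
  have e: "1 - 1 / p1 n = 1 / (ln (real n) + 1)" using l by (simp add: p1_def field_simps)
  have "(1 - 1 / p1 n) * ln (real n) \<le> 1" unfolding e using l by simp
  then show ?thesis using assms by (simp add: powr_def)
qed

lemma p1_norm_comparison:
  fixes a :: "'i \<Rightarrow> real"
  assumes n: "3 \<le> card I" and a: "\<And>i. i \<in> I \<Longrightarrow> 0 \<le> a i"
  defines "p \<equiv> p1 (card I)"
  shows "(\<Sum>i\<in>I. a i powr p) powr (1 / p) \<le> (\<Sum>i\<in>I. a i powr 1) powr (1 / 1)"
    and "(\<Sum>i\<in>I. a i powr 1) powr (1 / 1) \<le> exp 1 * (\<Sum>i\<in>I. a i powr p) powr (1 / p)"
proof -
  have I: "finite I" "I \<noteq> {}" using n by (auto intro: card_ge_0_finite)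
  have p: "1 < p" unfolding p_def by (rule p1_range[OF n])
  have "(\<Sum>i\<in>I. a i) \<ge> 0" using a by (rule sum_nonneg)
  then have 1: "(\<Sum>i\<in>I. a i powr 1) powr (1 / 1) = (\<Sum>i\<in>I. a i)"
    using a by (simp cong: sum.cong)
  show "(\<Sum>i\<in>I. a i powr p) powr (1 / p) \<le> (\<Sum>i\<in>I. a i powr 1) powr (1 / 1)"
    unfolding 1 by (rule powr_sum_le_sum[OF p I(1) a])
  have "(\<Sum>i\<in>I. a i) \<le> real (card I) powr (1 - 1 / p) * (\<Sum>i\<in>I. a i powr p) powr (1 / p)"
    by (rule sum_le_powr_sum[OF p I a])
  also have "\<dots> \<le> exp 1 * (\<Sum>i\<in>I. a i powr p) powr (1 / p)"
    unfolding p_def by (intro mult_right_mono card_powr_p1_le n) auto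
  finally show "(\<Sum>i\<in>I. a i powr 1) powr (1 / 1) \<le> exp 1 * (\<Sum>i\<in>I. a i powr p) powr (1 / p)"
    unfolding 1 .
qed

lemma lp_norm_p1_comparison:
  fixes x :: "real ^ 'n"
  assumes "3 \<le> CARD('n)"
  shows "lp_norm (p1 CARD('n)) x \<le> lp_norm 1 x" "lp_norm 1 x \<le> exp 1 * lp_norm (p1 CARD('n)) x"
  using p1_norm_comparison[of "UNIV :: 'n set" "\<lambda>i. \<bar>x $ i\<bar>"] assms by (simp_all add: lp_norm_def)

lemma schatten_norm_p1_comparison:
  fixes A :: "real ^ 'N ^ 'n"
  assumes "3 \<le> CARD('n)"
  shows "schatten_norm (p1 CARD('n)) A \<le> schatten_norm 1 A"
    "schatten_norm 1 A \<le> exp 1 * schatten_norm (p1 CARD('n)) A"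
proof -
  obtain E where E: "eigbasis (gram A) E" using selfadj_eigbasis_exists[OF selfadj_gram] by blast
  have c: "card E = CARD('n)" using onb_card[OF eigbasis_onb[OF E]] by simp
  have "0 \<le> sqrt (e \<bullet> gram A e)" for e by (simp add: gram_inner)
  then show "schatten_norm (p1 CARD('n)) A \<le> schatten_norm 1 A"
    "schatten_norm 1 A \<le> exp 1 * schatten_norm (p1 CARD('n)) A"
    using p1_norm_comparison[of E "\<lambda>e. sqrt (e \<bullet> gram A e)"] assms
    unfolding schatten_norm_eigbasis[OF E] c by auto
qed

lemma lp_norm_nonneg: "0 \<le> lp_norm p x" by (simp add: lp_norm_def)

lemma schatten_norm_nonneg: "0 \<le> schatten_norm p A" by (simp add: schatten_norm_def)

lemma sharp_wrt_smaller_norm: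
  assumes sharp: "sharp_wrt V nrm \<mu> f" and nn: "\<And>x. 0 \<le> nrm' x" and le: "\<And>x. nrm' x \<le> nrm x"
  shows "sharp_wrt V nrm' \<mu> f"
  unfolding sharp_wrt_def
proof (intro conjI ballI)
  show mu: "\<mu> > 0" and ne: "argmin_on V f \<noteq> {}" using sharp by (auto simp: sharp_wrt_def)
  fix z assume "z \<in> V"
  have "(INF x\<in>argmin_on V f. nrm' (z - x)) \<le> (INF x\<in>argmin_on V f. nrm (z - x))"
    using ne le nn by (intro cINF_mono) (auto intro!: bdd_belowI2[where m = 0])
  then have "\<mu> * (INF x\<in>argmin_on V f. nrm' (z - x)) \<le> \<mu> * (INF x\<in>argmin_on V f. nrm (z - x))"
    using mu by simp
  also have "\<dots> \<le> f z - min_on V f" using sharp \<open>z \<in> V\<close> by (simp add: sharp_wrt_def)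
  finally show "\<mu> * (INF x\<in>argmin_on V f. nrm' (z - x)) \<le> f z - min_on V f" .
qed

lemma lipschitz_wrt_equivalent_norm:
  assumes lip: "lipschitz_wrt V nrm L f" and le: "\<And>x. nrm' x \<le> nrm x" "\<And>x. nrm x \<le> C * nrm' x"
    and nn: "\<And>x. 0 \<le> nrm' x"
  shows "lipschitz_wrt V nrm' (C * L) f"
  unfolding lipschitz_wrt_def
proof (intro ballI)
  fix x y assume "x \<in> V" "y \<in> V"
  then have b: "\<bar>f x - f y\<bar> \<le> L * nrm (x - y)" using lip by (simp add: lipschitz_wrt_def)
  show "\<bar>f x - f y\<bar> \<le> C * L * nrm' (x - y)"
  proof (cases "L \<ge> 0")
    case True
    then have "L * nrm (x - y) \<le> L * (C * nrm' (x - y))" using le(2) by (intro mult_left_mono) auto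
    then show ?thesis using b by (simp add: mult_ac)
  next
    \<comment> \<open>a negative constant forces the distance, hence the difference, to vanish\<close>
    case False
    have "0 \<le> L * nrm (x - y)" using b abs_ge_zero order_trans by blast
    then have "nrm (x - y) \<le> 0" using False by (simp add: zero_le_mult_iff)
    then have "nrm (x - y) = 0" "nrm' (x - y) = 0" using le(1)[of "x - y"] nn[of "x - y"] by linarith+
    then show ?thesis using b by simp
  qed
qed

section \<open>Step counts\<close>

text \<open>Rounding up costs at most 1, which the lower bounds \<open>ln c\<close> on the logarithm and 1 on the ratio absorb
into the constant.\<close>

lemma total_steps_le:
  assumes c: "c > 1" "c \<le> \<epsilon>0 / \<epsilon>" and X: "1 \<le> L\<^sup>2 / (\<mu>\<^sup>2 * (p - 1))"
  shows "real (rmd_K \<epsilon>0 \<epsilon> * rmd_t L \<mu> p) \<le>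
    (2 + 1 / ln c) * (exp 1 + 1) * (L\<^sup>2 / (\<mu>\<^sup>2 * (p - 1)) * ln (\<epsilon>0 / \<epsilon>))"
proof -
  define X where "X = L\<^sup>2 / (\<mu>\<^sup>2 * (p - 1))"
  define l where "l = ln (\<epsilon>0 / \<epsilon>)"
  have lc: "ln c > 0" using c by simp
  have l: "l \<ge> ln c" unfolding l_def using c by simp
  have X1: "X \<ge> 1" unfolding X_def by (rule X)
  have "real (rmd_K \<epsilon>0 \<epsilon>) \<le> 2 * l + 1"
    unfolding rmd_K_def l_def[symmetric] using l lc of_int_ceiling_le_add_one[of "2 * l"] by simp
  also have "\<dots> \<le> (2 + 1 / ln c) * l"
    using l lc by (simp add: distrib_right pos_le_divide_eq)
  finally have K: "real (rmd_K \<epsilon>0 \<epsilon>) \<le> (2 + 1 / ln c) * l" .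
  have "rmd_t L \<mu> p = nat \<lceil>exp 1 * X\<rceil>" by (simp add: rmd_t_def X_def)
  moreover have "0 \<le> exp 1 * X" using X1 by simp
  then have "0 \<le> \<lceil>exp 1 * X\<rceil>" by linarith
  ultimately have "real (rmd_t L \<mu> p) \<le> exp 1 * X + 1"
    using of_int_ceiling_le_add_one[of "exp 1 * X"] by simp
  also have "\<dots> \<le> (exp 1 + 1) * X" using X1 by (simp add: distrib_right)
  finally have t: "real (rmd_t L \<mu> p) \<le> (exp 1 + 1) * X" .
  have "real (rmd_K \<epsilon>0 \<epsilon>) * real (rmd_t L \<mu> p) \<le> ((2 + 1 / ln c) * l) * ((exp 1 + 1) * X)"
    using l lc by (intro mult_mono K t) auto
  then show ?thesis unfolding X_def l_def by (simp add: mult_ac)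
qed

lemma ratio_ge_1:
  assumes "0 < \<mu>" "\<mu> \<le> L" "1 < p" "p \<le> (2::real)"
  shows "1 \<le> L\<^sup>2 / (\<mu>\<^sup>2 * (p - 1))"
proof -
  have "\<mu>\<^sup>2 * (p - 1) \<le> L\<^sup>2 * 1" using assms by (intro mult_mono power_mono) auto
  then show ?thesis using assms by (simp add: pos_le_divide_eq)
qed

lemma steps_bigo:
  assumes "c > 1"
  shows "(\<lambda>(L, \<mu>, p, \<epsilon>0, \<epsilon>). real (rmd_K \<epsilon>0 \<epsilon> * rmd_t L \<mu> p))
      \<in> O[principal (steps_range c)](\<lambda>(L, \<mu>, p, \<epsilon>0, \<epsilon>). L\<^sup>2 / (\<mu>\<^sup>2 * (p - 1)) * ln (\<epsilon>0 / \<epsilon>))"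
proof (rule bigoI[where c = "(2 + 1 / ln c) * (exp 1 + 1)"], unfold eventually_principal, clarify)
  fix L \<mu> p \<epsilon>0 \<epsilon> :: real
  assume "(L, \<mu>, p, \<epsilon>0, \<epsilon>) \<in> steps_range c"
  then have r: "0 < \<mu>" "\<mu> \<le> L" "1 < p" "p \<le> 2" "c \<le> \<epsilon>0 / \<epsilon>" by (auto simp: steps_range_def)
  have "ln (\<epsilon>0 / \<epsilon>) \<ge> 0" using assms r(5) by simp
  then have "0 \<le> L\<^sup>2 / (\<mu>\<^sup>2 * (p - 1)) * ln (\<epsilon>0 / \<epsilon>)" using r by simp
  with total_steps_le[OF assms r(5) ratio_ge_1[OF r(1-4)]]
  show "norm (real (rmd_K \<epsilon>0 \<epsilon> * rmd_t L \<mu> p))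
    \<le> (2 + 1 / ln c) * (exp 1 + 1) * norm (L\<^sup>2 / (\<mu>\<^sup>2 * (p - 1)) * ln (\<epsilon>0 / \<epsilon>))"
    by (simp only: real_norm_def abs_of_nonneg of_nat_0_le_iff)
qed

lemma steps_p1_bigo:
  assumes "c > 1"
  shows "(\<lambda>(L, \<mu>, n, \<epsilon>0, \<epsilon>). real (rmd_K \<epsilon>0 \<epsilon> * rmd_t (exp 1 * L) \<mu> (p1 n)))
      \<in> O[principal (steps_range1 c)](\<lambda>(L, \<mu>, n, \<epsilon>0, \<epsilon>).
            (exp 1 * L)\<^sup>2 / (\<mu>\<^sup>2 * (p1 n - 1)) * ln (\<epsilon>0 / \<epsilon>))"
proof (rule bigoI[where c = "(2 + 1 / ln c) * (exp 1 + 1)"], unfold eventually_principal, clarify)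
  fix L \<mu> \<epsilon>0 \<epsilon> :: real and n :: nat
  assume "(L, \<mu>, n, \<epsilon>0, \<epsilon>) \<in> steps_range1 c"
  then have r: "0 < \<mu>" "\<mu> \<le> exp 1 * L" "3 \<le> n" "c \<le> \<epsilon>0 / \<epsilon>" by (auto simp: steps_range1_def)
  note p = p1_range[OF r(3)]
  have "ln (\<epsilon>0 / \<epsilon>) \<ge> 0" using assms r(4) by simp
  then have "0 \<le> (exp 1 * L)\<^sup>2 / (\<mu>\<^sup>2 * (p1 n - 1)) * ln (\<epsilon>0 / \<epsilon>)" using r p by simp
  with total_steps_le[OF assms r(4) ratio_ge_1[OF r(1,2) p]]
  show "norm (real (rmd_K \<epsilon>0 \<epsilon> * rmd_t (exp 1 * L) \<mu> (p1 n)))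
    \<le> (2 + 1 / ln c) * (exp 1 + 1) * norm ((exp 1 * L)\<^sup>2 / (\<mu>\<^sup>2 * (p1 n - 1)) * ln (\<epsilon>0 / \<epsilon>))"
    by (simp only: real_norm_def abs_of_nonneg of_nat_0_le_iff)
qed

lemma p1_steps_eq:
  assumes "3 \<le> n"
  shows "(exp 1 * L)\<^sup>2 / (\<mu>\<^sup>2 * (p1 n - 1)) = (exp 1)\<^sup>2 * (L\<^sup>2 * ln (real n) / \<mu>\<^sup>2)"
  using ln_ge_1[OF assms] by (simp add: p1_def power_mult_distrib)

lemma steps_p1_bigo_ln:
  assumes "c > 1"
  shows "(\<lambda>(L, \<mu>, n, \<epsilon>0, \<epsilon>). real (rmd_K \<epsilon>0 \<epsilon> * rmd_t (exp 1 * L) \<mu> (p1 n)))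
      \<in> O[principal (steps_range1 c)](\<lambda>(L, \<mu>, n, \<epsilon>0, \<epsilon>).
            L\<^sup>2 * ln (real n) / \<mu>\<^sup>2 * ln (\<epsilon>0 / \<epsilon>))"
proof (rule landau_o.big.trans[OF steps_p1_bigo[OF assms]],
    rule bigoI[where c = "(exp 1)\<^sup>2"], unfold eventually_principal, clarify)
  fix L \<mu> \<epsilon>0 \<epsilon> :: real and n :: nat
  assume "(L, \<mu>, n, \<epsilon>0, \<epsilon>) \<in> steps_range1 c"
  then have n: "3 \<le> n" by (simp add: steps_range1_def)
  show "norm ((exp 1 * L)\<^sup>2 / (\<mu>\<^sup>2 * (p1 n - 1)) * ln (\<epsilon>0 / \<epsilon>))
    \<le> (exp 1)\<^sup>2 * norm (L\<^sup>2 * ln (real n) / \<mu>\<^sup>2 * ln (\<epsilon>0 / \<epsilon>))"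
    unfolding p1_steps_eq[OF n] by (simp add: abs_mult)
qed

lemma rmd_t_p1:
  assumes "3 \<le> n"
  shows "rmd_t (exp 1 * L) \<mu> (p1 n) = nat \<lceil>exp 3 * L\<^sup>2 * ln (real n) / \<mu>\<^sup>2\<rceil>"
proof -
  have e: "exp 1 * (exp 1)\<^sup>2 = (exp 3 :: real)"
    by (simp add: power2_eq_square mult_exp_exp)
  have "exp 1 * (exp 1 * L)\<^sup>2 / (\<mu>\<^sup>2 * (p1 n - 1)) = exp 1 * ((exp 1)\<^sup>2 * (L\<^sup>2 * ln (real n) / \<mu>\<^sup>2))"
    unfolding p1_steps_eq[OF assms, symmetric] by simp
  also have "\<dots> = exp 3 * L\<^sup>2 * ln (real n) / \<mu>\<^sup>2"
    unfolding mult.assoc[of "exp 1", symmetric] e by simp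
  finally show ?thesis unfolding rmd_t_def by simp
qed

lemma rmd_eta_p1:
  assumes "3 \<le> n"
  shows "rmd_eta (exp 1 * L) (p1 n) \<epsilon>0 k = rmd_eps \<epsilon>0 k / ((exp 1)\<^sup>2 * L\<^sup>2 * ln (real n))"
  using ln_ge_1[OF assms] by (simp add: rmd_eta_def p1_def power_mult_distrib)

section \<open>Restarted mirror descent for the 1-norm\<close>

theorem lp_norm_1_restarted_mirror_descent:
  fixes f :: "real ^ 'n \<Rightarrow> real"
  assumes n: "3 \<le> CARD('n)" and V: "subspace V" and f: "convex_on V f"
    and lip: "lipschitz_wrt V (lp_norm 1) L f" and sharp: "sharp_wrt V (lp_norm 1) \<mu> f"
  shows "sharp_wrt V (lp_norm (p1 CARD('n))) \<mu> f"
    and "lipschitz_wrt V (lp_norm (p1 CARD('n))) (exp 1 * L) f"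
    and "x0 \<in> V \<Longrightarrow> f x0 - min_on V f \<le> \<epsilon>0 \<Longrightarrow> 0 < \<epsilon> \<Longrightarrow> \<epsilon> \<le> \<epsilon>0 \<Longrightarrow>
      RMD_guarantee V lp_norm (p1 CARD('n)) f (exp 1 * L) \<mu> x0 \<epsilon>0 \<epsilon>"
proof -
  note cmp = lp_norm_p1_comparison[OF n]
  show s: "sharp_wrt V (lp_norm (p1 CARD('n))) \<mu> f"
    by (rule sharp_wrt_smaller_norm[OF sharp lp_norm_nonneg cmp(1)])
  show l: "lipschitz_wrt V (lp_norm (p1 CARD('n))) (exp 1 * L) f"
    by (rule lipschitz_wrt_equivalent_norm[OF lip cmp lp_norm_nonneg])
  show "RMD_guarantee V lp_norm (p1 CARD('n)) f (exp 1 * L) \<mu> x0 \<epsilon>0 \<epsilon>"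
    if "x0 \<in> V" "f x0 - min_on V f \<le> \<epsilon>0" "0 < \<epsilon>" "\<epsilon> \<le> \<epsilon>0"
    by (rule lp_restarted_mirror_descent[OF p1_range[OF n] f V l s that])
qed

theorem schatten_norm_1_restarted_mirror_descent:
  fixes f :: "real ^ 'N ^ 'n \<Rightarrow> real"
  assumes n: "3 \<le> CARD('n)" and V: "subspace V" and f: "convex_on V f"
    and lip: "lipschitz_wrt V (schatten_norm 1) L f" and sharp: "sharp_wrt V (schatten_norm 1) \<mu> f"
  shows "sharp_wrt V (schatten_norm (p1 CARD('n))) \<mu> f"
    and "lipschitz_wrt V (schatten_norm (p1 CARD('n))) (exp 1 * L) f"
    and "x0 \<in> V \<Longrightarrow> f x0 - min_on V f \<le> \<epsilon>0 \<Longrightarrow> 0 < \<epsilon> \<Longrightarrow> \<epsilon> \<le> \<epsilon>0 \<Longrightarrow>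
      RMD_guarantee V schatten_norm (p1 CARD('n)) f (exp 1 * L) \<mu> x0 \<epsilon>0 \<epsilon>"
proof -
  note cmp = schatten_norm_p1_comparison[OF n]
  show s: "sharp_wrt V (schatten_norm (p1 CARD('n))) \<mu> f"
    by (rule sharp_wrt_smaller_norm[OF sharp schatten_norm_nonneg cmp(1)])
  show l: "lipschitz_wrt V (schatten_norm (p1 CARD('n))) (exp 1 * L) f"
    by (rule lipschitz_wrt_equivalent_norm[OF lip cmp schatten_norm_nonneg])
  show "RMD_guarantee V schatten_norm (p1 CARD('n)) f (exp 1 * L) \<mu> x0 \<epsilon>0 \<epsilon>"
    if "x0 \<in> V" "f x0 - min_on V f \<le> \<epsilon>0" "0 < \<epsilon>" "\<epsilon> \<le> \<epsilon>0"
    by (rule schatten_restarted_mirror_descent[OF p1_range[OF n] f V l s that])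
qed

theorem theorem2:
  fixes p L \<mu> \<epsilon>0 \<epsilon> :: real
    and f :: "real ^ 'n \<Rightarrow> real" and x0 :: "real ^ 'n"
    and g :: "real ^ 'n ^ 'n \<Rightarrow> real" and y0 :: "real ^ 'n ^ 'n"
    and h :: "real ^ 'N ^ 'n \<Rightarrow> real" and z0 :: "real ^ 'N ^ 'n"
  shows "
    (1 < p \<and> p \<le> 2 \<and> convex_on UNIV f \<and>
      lipschitz_wrt UNIV (lp_norm p) L f \<and> sharp_wrt UNIV (lp_norm p) \<mu> f \<and>
      x0 \<in> UNIV \<and> f x0 - min_on UNIV f \<le> \<epsilon>0 \<and> 0 < \<epsilon> \<and> \<epsilon> \<le> \<epsilon>0 \<longrightarrow>
        RMD_guarantee UNIV lp_norm p f L \<mu> x0 \<epsilon>0 \<epsilon>) \<and>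
    (1 < p \<and> p \<le> 2 \<and> convex_on sym_matrices g \<and>
      lipschitz_wrt sym_matrices (schatten_norm p) L g \<and> sharp_wrt sym_matrices (schatten_norm p) \<mu> g \<and>
      y0 \<in> sym_matrices \<and> g y0 - min_on sym_matrices g \<le> \<epsilon>0 \<and> 0 < \<epsilon> \<and> \<epsilon> \<le> \<epsilon>0 \<longrightarrow>
        RMD_guarantee sym_matrices schatten_norm p g L \<mu> y0 \<epsilon>0 \<epsilon>) \<and>
    (CARD('n) \<le> CARD('N) \<and> 1 < p \<and> p \<le> 2 \<and> convex_on UNIV h \<and>
      lipschitz_wrt UNIV (schatten_norm p) L h \<and> sharp_wrt UNIV (schatten_norm p) \<mu> h \<and>
      z0 \<in> UNIV \<and> h z0 - min_on UNIV h \<le> \<epsilon>0 \<and> 0 < \<epsilon> \<and> \<epsilon> \<le> \<epsilon>0 \<longrightarrow>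
        RMD_guarantee UNIV schatten_norm p h L \<mu> z0 \<epsilon>0 \<epsilon>) \<and>
    (\<forall>c>1. (\<lambda>(L, \<mu>, p, \<epsilon>0, \<epsilon>). real (rmd_K \<epsilon>0 \<epsilon> * rmd_t L \<mu> p))
      \<in> O[principal (steps_range c)](\<lambda>(L, \<mu>, p, \<epsilon>0, \<epsilon>). L\<^sup>2 / (\<mu>\<^sup>2 * (p - 1)) * ln (\<epsilon>0 / \<epsilon>))) \<and>
    (3 \<le> CARD('n) \<and> convex_on UNIV f \<and>
      lipschitz_wrt UNIV (lp_norm 1) L f \<and> sharp_wrt UNIV (lp_norm 1) \<mu> f \<longrightarrow>
        sharp_wrt UNIV (lp_norm (p1 CARD('n))) \<mu> f \<and>
        lipschitz_wrt UNIV (lp_norm (p1 CARD('n))) (exp 1 * L) f \<and>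
        (x0 \<in> UNIV \<and> f x0 - min_on UNIV f \<le> \<epsilon>0 \<and> 0 < \<epsilon> \<and> \<epsilon> \<le> \<epsilon>0 \<longrightarrow>
           RMD_guarantee UNIV lp_norm (p1 CARD('n)) f (exp 1 * L) \<mu> x0 \<epsilon>0 \<epsilon>)) \<and>
    (3 \<le> CARD('n) \<and> convex_on sym_matrices g \<and>
      lipschitz_wrt sym_matrices (schatten_norm 1) L g \<and> sharp_wrt sym_matrices (schatten_norm 1) \<mu> g \<longrightarrow>
        sharp_wrt sym_matrices (schatten_norm (p1 CARD('n))) \<mu> g \<and>
        lipschitz_wrt sym_matrices (schatten_norm (p1 CARD('n))) (exp 1 * L) g \<and>
        (y0 \<in> sym_matrices \<and> g y0 - min_on sym_matrices g \<le> \<epsilon>0 \<and> 0 < \<epsilon> \<and> \<epsilon> \<le> \<epsilon>0 \<longrightarrow>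
           RMD_guarantee sym_matrices schatten_norm (p1 CARD('n)) g (exp 1 * L) \<mu> y0 \<epsilon>0 \<epsilon>)) \<and>
    (CARD('n) \<le> CARD('N) \<and> 3 \<le> CARD('n) \<and> convex_on UNIV h \<and>
      lipschitz_wrt UNIV (schatten_norm 1) L h \<and> sharp_wrt UNIV (schatten_norm 1) \<mu> h \<longrightarrow>
        sharp_wrt UNIV (schatten_norm (p1 CARD('n))) \<mu> h \<and>
        lipschitz_wrt UNIV (schatten_norm (p1 CARD('n))) (exp 1 * L) h \<and>
        (z0 \<in> UNIV \<and> h z0 - min_on UNIV h \<le> \<epsilon>0 \<and> 0 < \<epsilon> \<and> \<epsilon> \<le> \<epsilon>0 \<longrightarrow>
           RMD_guarantee UNIV schatten_norm (p1 CARD('n)) h (exp 1 * L) \<mu> z0 \<epsilon>0 \<epsilon>)) \<and>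
    (\<forall>n\<ge>3. \<forall>L \<mu> \<epsilon>0 k.
      rmd_t (exp 1 * L) \<mu> (p1 n) = nat \<lceil>exp 3 * L\<^sup>2 * ln (real n) / \<mu>\<^sup>2\<rceil> \<and>
      rmd_eta (exp 1 * L) (p1 n) \<epsilon>0 k = rmd_eps \<epsilon>0 k / ((exp 1)\<^sup>2 * L\<^sup>2 * ln (real n))) \<and>
    (\<forall>c>1. (\<lambda>(L, \<mu>, n, \<epsilon>0, \<epsilon>). real (rmd_K \<epsilon>0 \<epsilon> * rmd_t (exp 1 * L) \<mu> (p1 n)))
      \<in> O[principal (steps_range1 c)](\<lambda>(L, \<mu>, n, \<epsilon>0, \<epsilon>).
            (exp 1 * L)\<^sup>2 / (\<mu>\<^sup>2 * (p1 n - 1)) * ln (\<epsilon>0 / \<epsilon>))) \<and>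
    (\<forall>c>1. (\<lambda>(L, \<mu>, n, \<epsilon>0, \<epsilon>). real (rmd_K \<epsilon>0 \<epsilon> * rmd_t (exp 1 * L) \<mu> (p1 n)))
      \<in> O[principal (steps_range1 c)](\<lambda>(L, \<mu>, n, \<epsilon>0, \<epsilon>).
            L\<^sup>2 * ln (real n) / \<mu>\<^sup>2 * ln (\<epsilon>0 / \<epsilon>)))"
proof (intro conjI, goal_cases)
  case 1
  show ?case by (intro impI, elim conjE) (rule lp_restarted_mirror_descent[OF _ _ _ subspace_UNIV])
next
  case 2
  show ?case by (intro impI, elim conjE) (rule schatten_restarted_mirror_descent[OF _ _ _ subspace_sym_matrices])
next
  case 3
  show ?case by (intro impI, elim conjE) (rule schatten_restarted_mirror_descent[OF _ _ _ subspace_UNIV])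
next
  case 4
  show ?case using steps_bigo by blast
next
  case 5
  show ?case
    by (intro impI, elim conjE)
      (intro conjI impI; (elim conjE)?; rule lp_norm_1_restarted_mirror_descent[OF _ subspace_UNIV])
next
  case 6
  show ?case
    by (intro impI, elim conjE)
      (intro conjI impI; (elim conjE)?; rule schatten_norm_1_restarted_mirror_descent[OF _ subspace_sym_matrices])
next
  case 7
  show ?case
    by (intro impI, elim conjE)
      (intro conjI impI; (elim conjE)?; rule schatten_norm_1_restarted_mirror_descent[OF _ subspace_UNIV])
next
  case 8
  show ?case using rmd_t_p1 rmd_eta_p1 by blast
next
  case 9
  show ?case using steps_p1_bigo by blast
next
  case 10
  show ?case using steps_p1_bigo_ln by blast
qed

end
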